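(* Let $(M,F)$ be a homogeneous Finsler space of odd dimension, with $G$ a connected Lie group acting transitively on $M$ by isometries, and let $p\in M$. Then $M$ admits a homogeneous geodesic through $p$.
   Context: **Finsler spaces.** A Minkowski norm on a finite-dimensional real vector space $\mathbb{V}$ is a nonnegative function $F:\mathbb{V}\to\mathbb{R}$ which is smooth on $\mathbb{V}\setminus\{0\}$, positively homogeneous ($F(\lambda y)=\lambda F(y)$ for all $\lambda>0$), and whose Hessian $g_{ij}(y)=(\tfrac12F^2)_{y^iy^j}$ is positive definite at every $y\in\mathbb{V}\setminus\{0\}$ (here $y^i$ are linear coordinates of $y$ and the subscripts denote partial derivatives). A Finsler metric on a smooth manifold $M$ is a function $F$ on $TM$ which is smooth on $TM\setminus\{0\}$ (the complement of the zero section) and whose restriction to each $T_xM$ is a Minkowski norm. Then $(M,F)$ is called a Finsler space. It is not assumed that $F(x,-y)=F(x,y)$. **Chern connection and geodesics.** Let $(x^i)$ be local coordinates on $M$ and $(x^i,y^i)$ the induced natural coordinates on $TM\setminus\{0\}$, where $y=y^i\frac{\partial}{\partial x^i}$. Put $g_{ij}(x,y)=(\tfrac12F^2)_{y^iy^j}$ and $C_{ijk}(x,y)=(\tfrac14F^2)_{y^iy^jy^k}$, let $(g^{ij})$ be the inverse matrix of $(g_{ij})$, raise indices with $g^{ij}$, and set (with the summation convention) $$\gamma^i_{jk}=\tfrac12 g^{is}\Big(\frac{\partial g_{sj}}{\partial x^k}-\frac{\partial g_{jk}}{\partial x^s}+\frac{\partial g_{ks}}{\partial x^j}\Big),\qquad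 N^i_j=\gamma^i_{jk}y^k-C^i_{jk}\gamma^k_{rs}y^ry^s,$$ $$\Gamma^l_{jk}=\gamma^l_{jk}-g^{li}\big(C_{ijs}N^s_k-C_{jks}N^s_i+C_{kis}N^s_j\big).$$ The functions $\Gamma^i_{jk}(x,y)$ are the Christoffel symbols of the Chern connection. For a nowhere vanishing vector field $V$ (on an open set), an affine connection $\nabla^V$ is defined by $$\nabla^V_{W_1}W_2|_x=\big[W_1(W_2^i)+W_2^jW_1^k\,\Gamma^i_{jk}(x,V)\big]\frac{\partial}{\partial x^i}.$$ For a regular smooth curve $\gamma$ (that is, with nowhere vanishing velocity) with velocity field $T$, and vector fields $W_1,W_2$ along $\gamma$, put $D_{W_1}W_2=\nabla^{T'}_{W_1'}W_2'$, where $T',W_1',W_2'$ are smooth local extensions of $T,W_1,W_2$; for the derivatives $D_TW$ along $\gamma$ used below, the result does not depend on the extensions. The curve $\gamma$ is a geodesic if $D_T\big(\frac{T}{F(T)}\big)=0$. A geodesic of constant speed satisfies $D_TT=0$; its parameter is then called affine. **Homogeneity.** The Finsler space $(M,F)$ is homogeneous if there is a connected Lie group $G$ acting smoothly and transitively on $M$ by isometries, i.e. by diffeomorphisms $\phi$ with $F(\phi(x),\phi_*y)=F(x,y)$ for all $x\in M$, $y\in T_xM$. Let $\mathfrak{g}$ be the Lie algebra of $G$. A geodesic $\gamma(s)$ through $p$, with affine parameter $s$ in an open interval $J$, is homogeneous if there exist a diffeomorphism $s=\varphi(t)$ from $\mathbb{R}$ onto $J$ and a nonzero vector $X\in\mathfrak{g}$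 such that $\gamma(\varphi(t))=\exp(tX)(p)$ for all $t\in\mathbb{R}$. *)

theory Defs
  imports "HOL-Analysis.Analysis" "HOL-Algebra.Group_Action"
begin

section \<open>Smooth functions\<close>

text \<open>\<open>smooth_on S f\<close> is meant for open \<open>S\<close>: all derivatives are taken in the ambient space.
  The second parameter of \<open>Ck_on\<close> is a function on a finite-dimensional space, so that it is enough
  to differentiate \<open>x \<mapsto> Df(x) v\<close> again for each fixed direction \<open>v\<close>.\<close>

primrec Ck_on :: "nat \<Rightarrow> ('a::euclidean_space \<Rightarrow> 'b::euclidean_space) \<Rightarrow> 'a set \<Rightarrow> bool" where
  "Ck_on 0 f S \<longleftrightarrow> continuous_on S f"
| "Ck_on (Suc k) f S \<longleftrightarrow> (\<forall>x\<in>S. f differentiable (at x)) \<and>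
     (\<forall>v. Ck_on k (\<lambda>x. frechet_derivative f (at x) v) S)"

definition smooth_on :: "'a::euclidean_space set \<Rightarrow> ('a \<Rightarrow> 'b::euclidean_space) \<Rightarrow> bool" where
  "smooth_on S f \<longleftrightarrow> (\<forall>k. Ck_on k f S)"


section \<open>Smooth manifolds\<close>

text \<open>A chart is a pair of a domain and a coordinate map; the values of the coordinate map outside
  the domain are irrelevant. Manifolds carry an explicit topology (so the point set need not be a
  whole type) and an atlas, which need not be maximal: all notions below depend only on the smooth
  structure it generates. The dimension is that of the model space \<open>'a\<close>.\<close>

type_synonym ('m, 'a) chart = "'m set \<times> ('m \<Rightarrow> 'a)"

abbreviation dom_of :: "('m, 'a) chart \<Rightarrow> 'm set" where
  "dom_of c \<equiv> fst c"

abbreviation crd :: "('m, 'a) chart \<Rightarrow> 'm \<Rightarrow> 'a" where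
  "crd c \<equiv> snd c"

abbreviation crd_inv :: "('m, 'a) chart \<Rightarrow> 'a \<Rightarrow> 'm" where
  "crd_inv c \<equiv> inv_into (fst c) (snd c)"

record ('m, 'a) mfd =
  mtop :: "'m topology"
  atlas :: "('m, 'a) chart set"

abbreviation points :: "('m, 'a) mfd \<Rightarrow> 'm set" where
  "points M \<equiv> topspace (mtop M)"

definition charts_at :: "('m, 'a) mfd \<Rightarrow> 'm \<Rightarrow> ('m, 'a) chart set" where
  "charts_at M x = {c \<in> atlas M. x \<in> dom_of c}"

definition second_countable_space :: "'m topology \<Rightarrow> bool" where
  "second_countable_space X \<longleftrightarrow>
     (\<exists>\<B>. countable \<B> \<and> (\<forall>B\<in>\<B>. openin X B) \<and>
          (\<forall>U. openin X U \<longrightarrow> (\<exists>\<C>\<subseteq>\<B>. U = \<Union>\<C>)))"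

definition smooth_manifold :: "('m, 'a::euclidean_space) mfd \<Rightarrow> bool" where
  "smooth_manifold M \<longleftrightarrow>
     Hausdorff_space (mtop M) \<and> second_countable_space (mtop M) \<and>
     (\<Union>c\<in>atlas M. dom_of c) = points M \<and>
     (\<forall>c\<in>atlas M. openin (mtop M) (dom_of c) \<and> open (crd c ` dom_of c) \<and>
        homeomorphic_map (subtopology (mtop M) (dom_of c))
          (top_of_set (crd c ` dom_of c)) (crd c)) \<and>
     (\<forall>c\<in>atlas M. \<forall>d\<in>atlas M.
        smooth_on (crd c ` (dom_of c \<inter> dom_of d)) (crd d \<circ> crd_inv c))"

definition smooth_map ::
    "('m, 'a::euclidean_space) mfd \<Rightarrow> ('k, 'b::euclidean_space) mfd \<Rightarrow> ('m \<Rightarrow> 'k) \<Rightarrow> bool" where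
  "smooth_map M N f \<longleftrightarrow>
     continuous_map (mtop M) (mtop N) f \<and>
     (\<forall>c\<in>atlas M. \<forall>d\<in>atlas N.
        smooth_on (crd c ` {x \<in> dom_of c. f x \<in> dom_of d}) (crd d \<circ> f \<circ> crd_inv c))"

definition diffeo ::
    "('m, 'a::euclidean_space) mfd \<Rightarrow> ('k, 'b::euclidean_space) mfd \<Rightarrow> ('m \<Rightarrow> 'k) \<Rightarrow> bool" where
  "diffeo M N f \<longleftrightarrow> bij_betw f (points M) (points N) \<and>
     smooth_map M N f \<and> smooth_map N M (inv_into (points M) f)"

definition prod_mfd :: "('m, 'a) mfd \<Rightarrow> ('k, 'b) mfd \<Rightarrow> ('m \<times> 'k, 'a \<times> 'b) mfd" where
  "prod_mfd M N = \<lparr>mtop = prod_topology (mtop M) (mtop N),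
     atlas = {(dom_of c \<times> dom_of d, map_prod (crd c) (crd d)) | c d. c \<in> atlas M \<and> d \<in> atlas N}\<rparr>"

text \<open>An open subset of a Euclidean space as a manifold.\<close>

definition open_mfd :: "'a::euclidean_space set \<Rightarrow> ('a, 'a) mfd" where
  "open_mfd S = \<lparr>mtop = top_of_set S, atlas = {(S, id)}\<rparr>"


section \<open>Tangent vectors\<close>

text \<open>A tangent vector at \<open>x\<close> is the family of its component vectors with respect to all charts of
  the atlas around \<open>x\<close>, related by the Jacobians of the coordinate changes. The family is \<open>0\<close> at
  pairs that are not charts around \<open>x\<close>, so linear operations are pointwise. The base
  point is not part of a tangent vector; functions on the tangent bundle take it as a separate
  argument.\<close>

type_synonym ('m, 'a) tvec = "('m, 'a) chart \<Rightarrow> 'a"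

definition tangent_space :: "('m, 'a::euclidean_space) mfd \<Rightarrow> 'm \<Rightarrow> ('m, 'a) tvec set" where
  "tangent_space M x =
     {v. (\<forall>c\<in>charts_at M x. \<forall>d\<in>charts_at M x.
            v d = frechet_derivative (crd d \<circ> crd_inv c) (at (crd c x)) (v c)) \<and>
         (\<forall>c. c \<notin> charts_at M x \<longrightarrow> v c = 0)}"

definition tzero :: "('m, 'a::real_vector) tvec" where
  "tzero = (\<lambda>c. 0)"

definition tscale :: "real \<Rightarrow> ('m, 'a::real_vector) tvec \<Rightarrow> ('m, 'a) tvec" where
  "tscale r v = (\<lambda>c. r *\<^sub>R v c)"

text \<open>The tangent vector at \<open>x\<close> with components \<open>y\<close> in the chart \<open>c\<close>.\<close>

definition tvec_of ::
    "('m, 'a::euclidean_space) mfd \<Rightarrow> ('m, 'a) chart \<Rightarrow> 'm \<Rightarrow> 'a \<Rightarrow> ('m, 'a) tvec" where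
  "tvec_of M c x y = (\<lambda>d. if d \<in> charts_at M x
     then frechet_derivative (crd d \<circ> crd_inv c) (at (crd c x)) y else 0)"

definition pushforward ::
    "('m, 'a::euclidean_space) mfd \<Rightarrow> ('k, 'b::euclidean_space) mfd \<Rightarrow> ('m \<Rightarrow> 'k) \<Rightarrow> 'm \<Rightarrow>
     ('m, 'a) tvec \<Rightarrow> ('k, 'b) tvec" where
  "pushforward M N f x v = (\<lambda>d. if d \<in> charts_at N (f x)
     then let c = (SOME c. c \<in> charts_at M x)
          in frechet_derivative (crd d \<circ> f \<circ> crd_inv c) (at (crd c x)) (v c)
     else 0)"

definition velocity ::
    "('m, 'a::euclidean_space) mfd \<Rightarrow> (real \<Rightarrow> 'm) \<Rightarrow> real \<Rightarrow> ('m, 'a) tvec" where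
  "velocity M \<gamma> s = (\<lambda>c. if c \<in> charts_at M (\<gamma> s)
     then vector_derivative (crd c \<circ> \<gamma>) (at s) else 0)"

definition smooth_vector_field ::
    "('m, 'a::euclidean_space) mfd \<Rightarrow> 'm set \<Rightarrow> ('m \<Rightarrow> ('m, 'a) tvec) \<Rightarrow> bool" where
  "smooth_vector_field M U W \<longleftrightarrow>
     (\<forall>x\<in>U. W x \<in> tangent_space M x) \<and>
     (\<forall>c\<in>atlas M. smooth_on (crd c ` (U \<inter> dom_of c)) (\<lambda>\<xi>. W (crd_inv c \<xi>) c))"


section \<open>Finsler metrics\<close>

definition partial :: "'n::finite \<Rightarrow> (real^'n \<Rightarrow> real) \<Rightarrow> real^'n \<Rightarrow> real" where
  "partial i f y = frechet_derivative f (at y) (axis i 1)"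

definition hessian_half_sq :: "(real^'n::finite \<Rightarrow> real) \<Rightarrow> real^'n \<Rightarrow> real^'n^'n" where
  "hessian_half_sq f y = (\<chi> i j. partial j (partial i (\<lambda>y. (1/2) * (f y)\<^sup>2)) y)"

definition minkowski_norm :: "(real^'n::finite \<Rightarrow> real) \<Rightarrow> bool" where
  "minkowski_norm f \<longleftrightarrow>
     (\<forall>y. f y \<ge> 0) \<and>
     smooth_on (UNIV - {0}) f \<and>
     (\<forall>r y. r > 0 \<longrightarrow> f (r *\<^sub>R y) = r * f y) \<and>
     (\<forall>y. y \<noteq> 0 \<longrightarrow> (\<forall>w. w \<noteq> 0 \<longrightarrow> w \<bullet> (hessian_half_sq f y *v w) > 0))"

text \<open>\<open>F x v\<close> is the value of the metric on \<open>v \<in> T\<^sub>xM\<close>; \<open>local_metric\<close> is its expression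
  \<open>F(x\<^sup>i, y\<^sup>i)\<close> in the natural coordinates on the tangent bundle induced by a chart.\<close>

type_synonym ('m, 'a) tb_fun = "'m \<Rightarrow> ('m, 'a) tvec \<Rightarrow> real"

definition local_metric :: "('m, 'a::euclidean_space) mfd \<Rightarrow> ('m, 'a) tb_fun \<Rightarrow>
     ('m, 'a) chart \<Rightarrow> 'a \<Rightarrow> 'a \<Rightarrow> real" where
  "local_metric M F c \<xi> y = F (crd_inv c \<xi>) (tvec_of M c (crd_inv c \<xi>) y)"

definition finsler_metric :: "('m, real^'n::finite) mfd \<Rightarrow> ('m, real^'n) tb_fun \<Rightarrow> bool" where
  "finsler_metric M F \<longleftrightarrow>
     (\<forall>c\<in>atlas M.
        smooth_on ((crd c ` dom_of c) \<times> (UNIV - {0})) (\<lambda>(\<xi>, y). local_metric M F c \<xi> y)) \<and>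
     (\<forall>x\<in>points M. \<forall>c\<in>charts_at M x. minkowski_norm (\<lambda>y. F x (tvec_of M c x y)))"

definition finsler_space :: "('m, real^'n::finite) mfd \<Rightarrow> ('m, real^'n) tb_fun \<Rightarrow> bool" where
  "finsler_space M F \<longleftrightarrow> smooth_manifold M \<and> finsler_metric M F"

definition finsler_isometry ::
    "('m, real^'n::finite) mfd \<Rightarrow> ('m, real^'n) tb_fun \<Rightarrow> ('m \<Rightarrow> 'm) \<Rightarrow> bool" where
  "finsler_isometry M F f \<longleftrightarrow> diffeo M M f \<and>
     (\<forall>x\<in>points M. \<forall>v\<in>tangent_space M x. F (f x) (pushforward M M f x v) = F x v)"


section \<open>The Chern connection\<close>

text \<open>Here \<open>L\<close> is a Finsler metric in coordinates, with position \<open>x\<close> and velocity \<open>y\<close>.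
  Names: \<open>gf\<close> for \<open>g\<^sub>i\<^sub>j\<close>, \<open>gf_inv\<close> for \<open>g\<^sup>i\<^sup>j\<close>, \<open>cartan\<close> for \<open>C\<^sub>i\<^sub>j\<^sub>k\<close>, \<open>cartan_up\<close> for \<open>C\<^sup>i\<^sub>j\<^sub>k\<close>,
  \<open>gam\<close> for \<open>\<gamma>\<^sup>i\<^sub>j\<^sub>k\<close>, \<open>nonlin\<close> for \<open>N\<^sup>i\<^sub>j\<close> and \<open>chern\<close> for \<open>\<Gamma>\<^sup>l\<^sub>j\<^sub>k\<close>.\<close>

type_synonym 'n lmetric = "real^'n \<Rightarrow> real^'n \<Rightarrow> real"

definition gf :: "'n::finite lmetric \<Rightarrow> 'n \<Rightarrow> 'n \<Rightarrow> real^'n \<Rightarrow> real^'n \<Rightarrow> real" where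
  "gf L i j x y = hessian_half_sq (L x) y $ i $ j"

definition gf_inv :: "'n::finite lmetric \<Rightarrow> 'n \<Rightarrow> 'n \<Rightarrow> real^'n \<Rightarrow> real^'n \<Rightarrow> real" where
  "gf_inv L i j x y = matrix_inv (hessian_half_sq (L x) y) $ i $ j"

definition cartan :: "'n::finite lmetric \<Rightarrow> 'n \<Rightarrow> 'n \<Rightarrow> 'n \<Rightarrow> real^'n \<Rightarrow> real^'n \<Rightarrow> real" where
  "cartan L i j k x y = partial k (partial j (partial i (\<lambda>y. (1/4) * (L x y)\<^sup>2))) y"

definition cartan_up :: "'n::finite lmetric \<Rightarrow> 'n \<Rightarrow> 'n \<Rightarrow> 'n \<Rightarrow> real^'n \<Rightarrow> real^'n \<Rightarrow> real" where
  "cartan_up L i j k x y = (\<Sum>s\<in>UNIV. gf_inv L i s x y * cartan L s j k x y)"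

definition gam :: "'n::finite lmetric \<Rightarrow> 'n \<Rightarrow> 'n \<Rightarrow> 'n \<Rightarrow> real^'n \<Rightarrow> real^'n \<Rightarrow> real" where
  "gam L i j k x y = (1/2) * (\<Sum>s\<in>UNIV. gf_inv L i s x y *
     (partial k (\<lambda>x. gf L s j x y) x
      - partial s (\<lambda>x. gf L j k x y) x
      + partial j (\<lambda>x. gf L k s x y) x))"

definition nonlin :: "'n::finite lmetric \<Rightarrow> 'n \<Rightarrow> 'n \<Rightarrow> real^'n \<Rightarrow> real^'n \<Rightarrow> real" where
  "nonlin L i j x y = (\<Sum>k\<in>UNIV. gam L i j k x y * y $ k)
     - (\<Sum>k\<in>UNIV. \<Sum>r\<in>UNIV. \<Sum>s\<in>UNIV. cartan_up L i j k x y * gam L k r s x y * y $ r * y $ s)"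

definition chern :: "'n::finite lmetric \<Rightarrow> 'n \<Rightarrow> 'n \<Rightarrow> 'n \<Rightarrow> real^'n \<Rightarrow> real^'n \<Rightarrow> real" where
  "chern L l j k x y = gam L l j k x y
     - (\<Sum>i\<in>UNIV. \<Sum>s\<in>UNIV. gf_inv L l i x y *
         (cartan L i j s x y * nonlin L s k x y
          - cartan L j k s x y * nonlin L s i x y
          + cartan L k i s x y * nonlin L s j x y))"

text \<open>\<open>nabla M F V W1 W2 x\<close> is the tangent vector at \<open>x\<close> whose components are given, in
  every chart around \<open>x\<close>, by the coordinate formula for the affine connection induced by \<open>V\<close>.
  It is only meaningful if \<open>V\<close> is nonzero at \<open>x\<close>.\<close>

definition nabla :: "('m, real^'n::finite) mfd \<Rightarrow> ('m, real^'n) tb_fun \<Rightarrow>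
     ('m \<Rightarrow> ('m, real^'n) tvec) \<Rightarrow> ('m \<Rightarrow> ('m, real^'n) tvec) \<Rightarrow> ('m \<Rightarrow> ('m, real^'n) tvec) \<Rightarrow>
     'm \<Rightarrow> ('m, real^'n) tvec" where
  "nabla M F V W1 W2 x = (\<lambda>c. if c \<in> charts_at M x
     then \<chi> i. frechet_derivative (\<lambda>\<xi>. W2 (crd_inv c \<xi>) c $ i) (at (crd c x)) (W1 x c)
            + (\<Sum>j\<in>UNIV. \<Sum>k\<in>UNIV. (W2 x c $ j) * (W1 x c $ k) *
                 chern (local_metric M F c) i j k (crd c x) (V x c))
     else 0)"

text \<open>\<open>has_covariant_derivative M F J \<gamma> W1 W2 t v\<close>: the vector \<open>v\<close> is the value of
  \<open>D\<^bsub>W1\<^esub> W2\<close> at \<open>t\<close>, where \<open>W1\<close> and \<open>W2\<close> are vector fields along the regular curve \<open>\<gamma>\<close>, computed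
  from smooth extensions \<open>T'\<close>, \<open>W1'\<close>, \<open>W2'\<close>. As \<open>\<gamma>\<close> may return to the same point, the
  extensions are only required to agree with the given fields for parameters near \<open>t\<close>. For
  \<open>W1\<close> equal to the velocity field, \<open>v\<close> is independent of the extensions.\<close>

definition has_covariant_derivative ::
    "('m, real^'n::finite) mfd \<Rightarrow> ('m, real^'n) tb_fun \<Rightarrow> real set \<Rightarrow> (real \<Rightarrow> 'm) \<Rightarrow>
     (real \<Rightarrow> ('m, real^'n) tvec) \<Rightarrow> (real \<Rightarrow> ('m, real^'n) tvec) \<Rightarrow> real \<Rightarrow>
     ('m, real^'n) tvec \<Rightarrow> bool" where
  "has_covariant_derivative M F J \<gamma> W1 W2 t v \<longleftrightarrow>
     (\<exists>I U T' W1' W2'.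
        open I \<and> t \<in> I \<and> I \<subseteq> J \<and> openin (mtop M) U \<and> \<gamma> ` I \<subseteq> U \<and>
        smooth_vector_field M U T' \<and> (\<forall>x\<in>U. T' x \<noteq> tzero) \<and>
        smooth_vector_field M U W1' \<and> smooth_vector_field M U W2' \<and>
        (\<forall>s\<in>I. T' (\<gamma> s) = velocity M \<gamma> s \<and> W1' (\<gamma> s) = W1 s \<and> W2' (\<gamma> s) = W2 s) \<and>
        v = nabla M F T' W1' W2' (\<gamma> t))"

definition regular_curve ::
    "('m, 'a::euclidean_space) mfd \<Rightarrow> real set \<Rightarrow> (real \<Rightarrow> 'm) \<Rightarrow> bool" where
  "regular_curve M J \<gamma> \<longleftrightarrow> open J \<and> is_interval J \<and> smooth_map (open_mfd J) M \<gamma> \<and>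
     (\<forall>s\<in>J. velocity M \<gamma> s \<noteq> tzero)"

definition geodesic ::
    "('m, real^'n::finite) mfd \<Rightarrow> ('m, real^'n) tb_fun \<Rightarrow> real set \<Rightarrow> (real \<Rightarrow> 'm) \<Rightarrow> bool" where
  "geodesic M F J \<gamma> \<longleftrightarrow> regular_curve M J \<gamma> \<and>
     (\<forall>s\<in>J. has_covariant_derivative M F J \<gamma> (velocity M \<gamma>)
        (\<lambda>s. tscale (1 / F (\<gamma> s) (velocity M \<gamma> s)) (velocity M \<gamma> s)) s tzero)"

definition affine_geodesic ::
    "('m, real^'n::finite) mfd \<Rightarrow> ('m, real^'n) tb_fun \<Rightarrow> real set \<Rightarrow> (real \<Rightarrow> 'm) \<Rightarrow> bool" where
  "affine_geodesic M F J \<gamma> \<longleftrightarrow> geodesic M F J \<gamma> \<and>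
     (\<exists>\<kappa>. \<forall>s\<in>J. F (\<gamma> s) (velocity M \<gamma> s) = \<kappa>)"


section \<open>Lie groups and homogeneous geodesics\<close>

definition lie_group :: "'g monoid \<Rightarrow> ('g, 'e::euclidean_space) mfd \<Rightarrow> bool" where
  "lie_group G L \<longleftrightarrow> group G \<and> smooth_manifold L \<and> carrier G = points L \<and>
     smooth_map (prod_mfd L L) L (\<lambda>(g, h). g \<otimes>\<^bsub>G\<^esub> h) \<and>
     smooth_map L L (\<lambda>g. inv\<^bsub>G\<^esub> g)"

text \<open>Only the vector space underlying the Lie algebra is needed.\<close>

definition lie_algebra :: "'g monoid \<Rightarrow> ('g, 'e::euclidean_space) mfd \<Rightarrow> ('g, 'e) tvec set" where
  "lie_algebra G L = tangent_space L \<one>\<^bsub>G\<^esub>"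

definition one_parameter_subgroup ::
    "'g monoid \<Rightarrow> ('g, 'e::euclidean_space) mfd \<Rightarrow> (real \<Rightarrow> 'g) \<Rightarrow> bool" where
  "one_parameter_subgroup G L \<alpha> \<longleftrightarrow> smooth_map (open_mfd UNIV) L \<alpha> \<and>
     (\<forall>s t. \<alpha> (s + t) = \<alpha> s \<otimes>\<^bsub>G\<^esub> \<alpha> t)"

definition lie_exp ::
    "'g monoid \<Rightarrow> ('g, 'e::euclidean_space) mfd \<Rightarrow> ('g, 'e) tvec \<Rightarrow> 'g" where
  "lie_exp G L X = (THE \<alpha>. one_parameter_subgroup G L \<alpha> \<and> velocity L \<alpha> 0 = X) 1"

definition smooth_transitive_action ::
    "'g monoid \<Rightarrow> ('g, 'e::euclidean_space) mfd \<Rightarrow> ('m, 'a::euclidean_space) mfd \<Rightarrow>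
     ('g \<Rightarrow> 'm \<Rightarrow> 'm) \<Rightarrow> bool" where
  "smooth_transitive_action G L M act \<longleftrightarrow> transitive_action G (points M) act \<and>
     smooth_map (prod_mfd L M) M (\<lambda>(g, x). act g x)"

definition homogeneous_geodesic ::
    "'g monoid \<Rightarrow> ('g, 'e::euclidean_space) mfd \<Rightarrow> ('m, real^'n::finite) mfd \<Rightarrow>
     ('m, real^'n) tb_fun \<Rightarrow> ('g \<Rightarrow> 'm \<Rightarrow> 'm) \<Rightarrow> 'm \<Rightarrow> real set \<Rightarrow> (real \<Rightarrow> 'm) \<Rightarrow> bool" where
  "homogeneous_geodesic G L M F act p J \<gamma> \<longleftrightarrow>
     affine_geodesic M F J \<gamma> \<and> p \<in> \<gamma> ` J \<and>
     (\<exists>\<phi> X. diffeo (open_mfd UNIV) (open_mfd J) \<phi> \<and>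
        X \<in> lie_algebra G L \<and> X \<noteq> tzero \<and>
        (\<forall>t. \<gamma> (\<phi> t) = act (lie_exp G L (tscale t X)) p))"

end

theory Submission
  imports Defs "HOL-Homology.Brouwer_Degree"
begin

text \<open>The geodesic is an orbit of a one-parameter subgroup, found as a zero of a tangent vector field on
  an even-dimensional sphere.

  Let \<open>E = F\<^sup>2/2\<close>. In a chart, a curve with position \<open>x\<close>, velocity \<open>y\<close> and acceleration \<open>a\<close> has the
  Euler--Lagrange covector with components
  \<open>EL\<^sub>l = d/dt E\<^bsub>y\<^sup>l\<^esub> - E\<^bsub>x\<^sup>l\<^esub> = g\<^sub>l\<^sub>i (a\<^sup>i + \<Gamma>\<^sup>i\<^sub>j\<^sub>k(x, y) y\<^sup>j y\<^sup>k)\<close>. Homogeneity of \<open>F\<close> makes the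
  contractions of the Cartan tensor with \<open>y\<close> vanish, so that on \<open>y\<^sup>j y\<^sup>k\<close> the Chern symbols reduce to
  the formal Christoffel symbols (\<open>chern_contract\<close>), and a curve of constant speed is a geodesic as
  soon as \<open>EL\<close> vanishes along it (\<open>euler_lagrange_imp_geodesic_equation\<close>). The covector is natural under
  coordinate maps that preserve \<open>E\<close> (\<open>euler_lagrange_covariant\<close>). Hence along an orbit
  \<open>t \<mapsto> exp(tX)(p)\<close> of isometries it is enough that \<open>EL\<close> vanishes at \<open>p\<close>
  (\<open>euler_lagrange_along_orbit\<close>).

  For a transitive action the linear map \<open>X \<mapsto> d/dt exp(tX)(p)\<close> is onto \<open>T\<^sub>pM\<close>: otherwise the orbit
  map has constant rank below the dimension of \<open>M\<close>, and by second countability of the group its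
  image is a null set (\<open>constant_rank_image_negligible\<close>, \<open>orbit_map_submersion\<close>). Choose a linear
  right inverse \<open>\<sigma>\<close>. For \<open>y \<noteq> 0\<close> in \<open>T\<^sub>pM\<close> let \<open>\<omega>(y)\<close> be the covector \<open>EL\<close> at \<open>p\<close> of the orbit of
  \<open>exp(t\<sigma>(y))\<close>, whose velocity at \<open>p\<close> is \<open>y\<close>. It depends continuously on \<open>y\<close>, and
  \<open>\<omega>(y) y = dE/dt = 0\<close>, because isometries keep the speed of the orbit constant. So \<open>\<omega>\<close> is a
  continuous tangent field on the unit sphere of \<open>\<real>\<^sup>n\<close>, and as \<open>n\<close> is odd it has a zero \<open>y\<close>
  (\<open>hairy_ball\<close>, by comparing the Brouwer degrees of the identity and of the antipodal map). The orbit
  of \<open>exp(t\<sigma>(y))\<close> is the geodesic; it has constant speed, so its group parameter is already affine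
  and no reparametrization occurs.

  The exponential map is defined through one-parameter subgroups, so their existence and uniqueness
  are proved from the Picard--Lindeloef theorem (\<open>one_ps_exists\<close>, \<open>one_ps_unique\<close>).\<close>

section \<open>Calculus of smooth maps\<close>

lemma has_derivative_frechet:
  "f differentiable (at x) \<Longrightarrow> (f has_derivative frechet_derivative f (at x)) (at x)"
  by (simp add: frechet_derivative_works)

lemma Ck_on_cong:
  assumes "open S" "\<And>x. x \<in> S \<Longrightarrow> f x = g x"
  shows "Ck_on k f S \<longleftrightarrow> Ck_on k g S"
  using assms
proof (induction k arbitrary: f g)
  case 0
  then show ?case by (auto cong: continuous_on_cong)
next
  case (Suc k)
  have der: "(f has_derivative D) (at x) \<longleftrightarrow> (g has_derivative D) (at x)" if "x \<in> S" for x D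
    using has_derivative_transform_within_open[of f D x UNIV S g]
      has_derivative_transform_within_open[of g D x UNIV S f] Suc.prems that by auto
  have fd: "frechet_derivative f (at x) = frechet_derivative g (at x)" if "x \<in> S" for x
    unfolding frechet_derivative_def using der[OF that] by simp
  have "Ck_on k (\<lambda>x. frechet_derivative f (at x) v) S \<longleftrightarrow> Ck_on k (\<lambda>x. frechet_derivative g (at x) v) S" for v
    by (rule Suc.IH) (use Suc.prems fd in auto)
  then show ?case
    using der by (auto simp: differentiable_def)
qed

lemma frechet_derivative_cong_open:
  assumes "open S" "x \<in> S" "\<And>x. x \<in> S \<Longrightarrow> f x = g x"
  shows "frechet_derivative f (at x) = frechet_derivative g (at x)"
proof -
  have "(f has_derivative D) (at x) \<longleftrightarrow> (g has_derivative D) (at x)" for D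
    using has_derivative_transform_within_open[of f D x UNIV S g]
      has_derivative_transform_within_open[of g D x UNIV S f] assms by auto
  then show ?thesis unfolding frechet_derivative_def by simp
qed

lemma Ck_on_subset: "Ck_on k f S \<Longrightarrow> T \<subseteq> S \<Longrightarrow> Ck_on k f T"
  by (induction k arbitrary: f) (auto intro: continuous_on_subset)

lemma Ck_on_SucD: "Ck_on (Suc k) f S \<Longrightarrow> Ck_on k f S"
proof (induction k arbitrary: f)
  case 0
  then show ?case
    by (auto intro!: continuous_at_imp_continuous_on differentiable_imp_continuous_within)
qed auto

text \<open>Allows the derivative to be given explicitly, so that differentiability classes of concrete
  functions can be computed by induction on the order.\<close>

lemma Ck_on_SucI:
  assumes "open S" "\<And>x. x \<in> S \<Longrightarrow> (f has_derivative f' x) (at x)"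
    "\<And>v. Ck_on k (\<lambda>x. f' x v) S"
  shows "Ck_on (Suc k) f S"
proof -
  have fd: "frechet_derivative f (at x) = f' x" if "x \<in> S" for x
    using frechet_derivative_at[OF assms(2)[OF that]] by simp
  have "Ck_on k (\<lambda>x. frechet_derivative f (at x) v) S" for v
    using Ck_on_cong[OF assms(1), of "\<lambda>x. frechet_derivative f (at x) v" "\<lambda>x. f' x v"] fd assms(3)
    by simp
  then show ?thesis using assms(2) by (auto simp: differentiable_def)
qed

lemma Ck_on_Suc_has_derivative:
  "Ck_on (Suc k) f S \<Longrightarrow> x \<in> S \<Longrightarrow> (f has_derivative frechet_derivative f (at x)) (at x)"
  by (simp add: has_derivative_frechet)

lemma Ck_on_const: "open S \<Longrightarrow> Ck_on k (\<lambda>x. c) S"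
proof (induction k arbitrary: c)
  case (Suc k)
  show ?case by (rule Ck_on_SucI[where f' = "\<lambda>x v. 0"]) (use Suc in auto)
qed auto

lemma Ck_on_linear:
  assumes "open S" "bounded_linear h" "Ck_on k f S"
  shows "Ck_on k (\<lambda>x. h (f x)) S"
  using assms(3)
proof (induction k arbitrary: f)
  case 0
  then show ?case using assms(2) by (auto intro: bounded_linear.continuous_on)
next
  case (Suc k)
  show ?case
  proof (rule Ck_on_SucI[OF assms(1)])
    show "((\<lambda>x. h (f x)) has_derivative (\<lambda>v. h (frechet_derivative f (at x) v))) (at x)" if "x \<in> S" for x
      using bounded_linear.has_derivative[OF assms(2) Ck_on_Suc_has_derivative[OF Suc.prems that]] .
    show "Ck_on k (\<lambda>x. h (frechet_derivative f (at x) v)) S" for v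
      by (rule Suc.IH) (use Suc.prems in simp)
  qed
qed

lemma Ck_on_add:
  assumes "open S" "Ck_on k f S" "Ck_on k g S"
  shows "Ck_on k (\<lambda>x. f x + g x) S"
  using assms(2,3)
proof (induction k arbitrary: f g)
  case 0
  then show ?case by (auto intro: continuous_on_add)
next
  case (Suc k)
  show ?case
  proof (rule Ck_on_SucI[OF assms(1)])
    show "((\<lambda>x. f x + g x) has_derivative (\<lambda>v. frechet_derivative f (at x) v + frechet_derivative g (at x) v)) (at x)"
      if "x \<in> S" for x
      using Suc.prems that by (intro has_derivative_add Ck_on_Suc_has_derivative)
    show "Ck_on k (\<lambda>x. frechet_derivative f (at x) v + frechet_derivative g (at x) v) S" for v
      by (rule Suc.IH) (use Suc.prems in simp_all)
  qed
qed

lemma Ck_on_sum: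
  assumes "open S" "\<And>i. i \<in> I \<Longrightarrow> Ck_on k (f i) S"
  shows "Ck_on k (\<lambda>x. \<Sum>i\<in>I. f i x) S"
  using assms(2)
  by (induction I rule: infinite_finite_induct) (auto intro!: Ck_on_add Ck_on_const assms(1))

lemma Ck_on_bilinear:
  fixes p :: "'b::euclidean_space \<Rightarrow> 'c::euclidean_space \<Rightarrow> 'd::euclidean_space"
  assumes "open S" "bounded_bilinear p" "Ck_on k f S" "Ck_on k g S"
  shows "Ck_on k (\<lambda>x. p (f x) (g x)) S"
  using assms(3,4)
proof (induction k arbitrary: f g)
  case 0
  then show ?case using assms(2) by (auto intro: bounded_bilinear.continuous_on)
next
  case (Suc k)
  show ?case
  proof (rule Ck_on_SucI[OF assms(1)])
    show "((\<lambda>x. p (f x) (g x)) has_derivative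
        (\<lambda>v. p (f x) (frechet_derivative g (at x) v) + p (frechet_derivative f (at x) v) (g x))) (at x)"
      if "x \<in> S" for x
      using Suc.prems that
      by (intro bounded_bilinear.FDERIV[OF assms(2)] Ck_on_Suc_has_derivative)
    show "Ck_on k (\<lambda>x. p (f x) (frechet_derivative g (at x) v) + p (frechet_derivative f (at x) v) (g x)) S" for v
      by (intro Ck_on_add[OF assms(1)] Suc.IH) (use Suc.prems Ck_on_SucD in auto)
  qed
qed

lemma linear_expand_Basis:
  fixes v :: "'a::euclidean_space"
  assumes "linear D"
  shows "D v = (\<Sum>b\<in>Basis. (v \<bullet> b) *\<^sub>R D b)"
  by (metis (no_types, lifting) assms euclidean_representation linear_scale linear_sum sum.cong)

text \<open>By the chain rule the derivative of the composition in a fixed direction is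
  \<open>\<Sum>\<^sub>b (Dg(x)v \<bullet> b) Df(g x)b\<close>, a combination of functions to which the induction hypothesis and the
  product rule apply. Expanding in the basis is needed because only derivatives in fixed directions
  occur in the definition of \<open>Ck_on\<close>.\<close>

lemma Ck_on_compose:
  fixes g :: "'a::euclidean_space \<Rightarrow> 'b::euclidean_space"
    and f :: "'b \<Rightarrow> 'c::euclidean_space"
  assumes "open S" "open T" "g ` S \<subseteq> T" "Ck_on k g S" "Ck_on k f T"
  shows "Ck_on k (\<lambda>x. f (g x)) S"
  using assms(4,5)
proof (induction k arbitrary: f)
  case 0
  then show ?case using assms(3) by (auto intro: continuous_on_compose2)
next
  case (Suc k)
  let ?Df = "\<lambda>x. frechet_derivative f (at x)" and ?Dg = "\<lambda>x. frechet_derivative g (at x)"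
  show ?case
  proof (rule Ck_on_SucI[OF assms(1)])
    show "((\<lambda>x. f (g x)) has_derivative (\<lambda>v. \<Sum>b\<in>Basis. (?Dg x v \<bullet> b) *\<^sub>R ?Df (g x) b)) (at x)"
      if "x \<in> S" for x
    proof -
      have g: "(g has_derivative ?Dg x) (at x)" and f: "(f has_derivative ?Df (g x)) (at (g x))"
        using Suc.prems that assms(3) by (auto intro!: Ck_on_Suc_has_derivative)
      have "((\<lambda>x. f (g x)) has_derivative (\<lambda>v. ?Df (g x) (?Dg x v))) (at x)"
        using diff_chain_at[OF g f] by (simp add: o_def)
      then show ?thesis
        by (subst (asm) linear_expand_Basis[OF has_derivative_linear[OF f]])
    qed
    show "Ck_on k (\<lambda>x. \<Sum>b\<in>Basis. (?Dg x v \<bullet> b) *\<^sub>R ?Df (g x) b) S" for v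
    proof (intro Ck_on_sum[OF assms(1)] Ck_on_bilinear[OF assms(1) bounded_bilinear_scaleR])
      fix b :: 'b
      show "Ck_on k (\<lambda>x. ?Dg x v \<bullet> b) S"
        by (rule Ck_on_linear[OF assms(1) bounded_linear_inner_left]) (use Suc.prems in simp)
      show "Ck_on k (\<lambda>x. ?Df (g x) b) S"
        using Suc.IH[of "\<lambda>y. ?Df y b"] Suc.prems(2) Ck_on_SucD[OF Suc.prems(1)] by simp
    qed
  qed
qed

lemma Ck_on_local:
  assumes "\<And>x. x \<in> S \<Longrightarrow> \<exists>T. open T \<and> x \<in> T \<and> Ck_on k f T"
  shows "Ck_on k f S"
  using assms
proof (induction k arbitrary: f)
  case 0
  have "continuous (at x) f" if "x \<in> S" for x
    using 0[OF that] by (auto simp: continuous_on_eq_continuous_at)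
  then show ?case by (simp add: continuous_at_imp_continuous_on)
next
  case (Suc k)
  have "Ck_on k (\<lambda>x. frechet_derivative f (at x) v) S" for v
    by (rule Suc.IH) (use Suc.prems in fastforce)
  moreover have "f differentiable (at x)" if "x \<in> S" for x
    using Suc.prems[OF that] by auto
  ultimately show ?case by simp
qed

lemma smooth_on_cong:
  "open S \<Longrightarrow> (\<And>x. x \<in> S \<Longrightarrow> f x = g x) \<Longrightarrow> smooth_on S f \<longleftrightarrow> smooth_on S g"
  unfolding smooth_on_def by (simp add: Ck_on_cong[of S f g])

lemma smooth_on_subset: "smooth_on S f \<Longrightarrow> T \<subseteq> S \<Longrightarrow> smooth_on T f"
  unfolding smooth_on_def using Ck_on_subset by blast

lemma smooth_on_const [simp]: "open S \<Longrightarrow> smooth_on S (\<lambda>x. c)"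
  unfolding smooth_on_def using Ck_on_const by blast

lemma smooth_on_linear: "open S \<Longrightarrow> bounded_linear h \<Longrightarrow> smooth_on S f \<Longrightarrow> smooth_on S (\<lambda>x. h (f x))"
  unfolding smooth_on_def using Ck_on_linear by blast

lemma smooth_on_add: "open S \<Longrightarrow> smooth_on S f \<Longrightarrow> smooth_on S g \<Longrightarrow> smooth_on S (\<lambda>x. f x + g x)"
  unfolding smooth_on_def using Ck_on_add by blast

lemma smooth_on_sum: "open S \<Longrightarrow> (\<And>i. i \<in> I \<Longrightarrow> smooth_on S (f i)) \<Longrightarrow> smooth_on S (\<lambda>x. \<Sum>i\<in>I. f i x)"
  unfolding smooth_on_def by (simp add: Ck_on_sum)

lemma smooth_on_bilinear:
  "open S \<Longrightarrow> bounded_bilinear p \<Longrightarrow> smooth_on S f \<Longrightarrow> smooth_on S g \<Longrightarrow> smooth_on S (\<lambda>x. p (f x) (g x))"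
  unfolding smooth_on_def using Ck_on_bilinear by blast

lemmas smooth_on_scaleR = smooth_on_bilinear[OF _ bounded_bilinear_scaleR]
lemmas smooth_on_mult = smooth_on_bilinear[OF _ bounded_bilinear_mult]

lemma smooth_on_compose:
  "open S \<Longrightarrow> open T \<Longrightarrow> g ` S \<subseteq> T \<Longrightarrow> smooth_on S g \<Longrightarrow> smooth_on T f \<Longrightarrow> smooth_on S (\<lambda>x. f (g x))"
  unfolding smooth_on_def using Ck_on_compose by blast

lemma smooth_on_local:
  "(\<And>x. x \<in> S \<Longrightarrow> \<exists>T. open T \<and> x \<in> T \<and> smooth_on T f) \<Longrightarrow> smooth_on S f"
  unfolding smooth_on_def by (meson Ck_on_local)

lemma smooth_on_frechet_derivative: "smooth_on S f \<Longrightarrow> smooth_on S (\<lambda>x. frechet_derivative f (at x) v)"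
  unfolding smooth_on_def by (metis Ck_on.simps(2))

lemma smooth_on_has_derivative:
  "smooth_on S f \<Longrightarrow> x \<in> S \<Longrightarrow> (f has_derivative frechet_derivative f (at x)) (at x)"
  unfolding smooth_on_def using Ck_on_Suc_has_derivative by blast

lemma smooth_on_linear_derivative:
  "smooth_on S f \<Longrightarrow> x \<in> S \<Longrightarrow> linear (frechet_derivative f (at x))"
  using smooth_on_has_derivative has_derivative_linear by blast

lemma smooth_on_imp_continuous_on: "smooth_on S f \<Longrightarrow> continuous_on S f"
  unfolding smooth_on_def by (metis Ck_on.simps(1))

lemma smooth_on_id: "open S \<Longrightarrow> smooth_on S (\<lambda>x. x)"
proof -
  assume S: "open S"
  have "Ck_on k (\<lambda>x. x) S" for k
  proof (cases k)
    case (Suc j)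
    show ?thesis unfolding Suc
      by (rule Ck_on_SucI[OF S, where f' = "\<lambda>x v. v"]) (auto intro: Ck_on_const S)
  qed auto
  then show ?thesis by (simp add: smooth_on_def)
qed

lemma smooth_on_Pair:
  assumes S: "open S" and f: "smooth_on S f" and g: "smooth_on S g"
  shows "smooth_on S (\<lambda>x. (f x, g x))"
proof -
  have "bounded_linear (\<lambda>x::'b. (x, 0::'c))" "bounded_linear (\<lambda>x::'c. (0::'b, x))"
    by (auto intro!: bounded_linear_intros)
  from smooth_on_add[OF S smooth_on_linear[OF S this(1) f] smooth_on_linear[OF S this(2) g]]
  show ?thesis by simp
qed

lemma smooth_on_inverse:
  fixes f :: "'a::euclidean_space \<Rightarrow> real"
  assumes S: "open S" and f: "smooth_on S f" and nz: "\<And>x. x \<in> S \<Longrightarrow> f x \<noteq> 0"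
  shows "smooth_on S (\<lambda>x. inverse (f x))"
proof -
  have op: "open (UNIV - {0::real})" by auto
  have "Ck_on k (inverse :: real \<Rightarrow> real) (UNIV - {0})" for k
  proof (induction k)
    case 0
    then show ?case by (auto intro!: continuous_intros)
  next
    case (Suc k)
    show ?case
    proof (rule Ck_on_SucI[OF op])
      show "(inverse has_derivative (\<lambda>h. - (inverse x * h * inverse x))) (at x)" if "x \<in> UNIV - {0::real}" for x
        using that by (auto intro!: has_derivative_inverse')
      show "Ck_on k (\<lambda>x. - (inverse x * v * inverse x)) (UNIV - {0})" for v :: real
        by (intro Ck_on_linear[OF op, where h = uminus] Ck_on_bilinear[OF op bounded_bilinear_mult] Suc Ck_on_const op)
          (auto intro!: bounded_linear_minus bounded_linear_ident)
    qed
  qed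
  then have "smooth_on (UNIV - {0}) (inverse :: real \<Rightarrow> real)" by (simp add: smooth_on_def)
  moreover have "f ` S \<subseteq> UNIV - {0}" using nz by auto
  ultimately show ?thesis using smooth_on_compose[OF S op _ f] by blast
qed

text \<open>The mean value theorem, applied first along \<open>u\<close> and then along \<open>v\<close>, turns the second
  difference over a parallelogram into a mixed second derivative. The second difference is symmetric
  in \<open>u\<close> and \<open>v\<close>, which gives Schwarz's theorem when \<open>h\<close> tends to \<open>0\<close>.\<close>

lemma mixed_difference_quotient:
  fixes f :: "'a::euclidean_space \<Rightarrow> real"
  assumes h: "h > 0"
    and sub: "\<And>s t. 0 \<le> s \<Longrightarrow> s \<le> h \<Longrightarrow> 0 \<le> t \<Longrightarrow> t \<le> h \<Longrightarrow> x + s *\<^sub>R u + t *\<^sub>R v \<in> S"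
    and S: "open S" and f: "Ck_on 2 f S"
  obtains s t where "0 \<le> s" "s \<le> h" "0 \<le> t" "t \<le> h"
    "f (x + h *\<^sub>R u + h *\<^sub>R v) - f (x + h *\<^sub>R u) - f (x + h *\<^sub>R v) + f x =
     h * h * frechet_derivative (\<lambda>z. frechet_derivative f (at z) u) (at (x + s *\<^sub>R u + t *\<^sub>R v)) v"
proof -
  let ?D = "\<lambda>z. frechet_derivative f (at z)"
  have f1: "(f has_derivative ?D z) (at z)" if "z \<in> S" for z
    using f that by (auto simp: numeral_2_eq_2 intro: has_derivative_frechet)
  have f2: "((\<lambda>z. ?D z u) has_derivative frechet_derivative (\<lambda>z. ?D z u) (at z)) (at z)" if "z \<in> S" for z
    using f that by (auto simp: numeral_2_eq_2 intro: has_derivative_frechet)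
  have along: "((\<lambda>s. g (a + s *\<^sub>R w)) has_real_derivative g' w) (at s)"
    if "(g has_derivative g') (at (a + s *\<^sub>R w))" for g :: "'a \<Rightarrow> real" and g' a w s
  proof -
    have "((\<lambda>s. a + s *\<^sub>R w) has_derivative (\<lambda>h. h *\<^sub>R w)) (at s)"
      by (auto intro!: derivative_eq_intros)
    from diff_chain_at[OF this that]
    have "((\<lambda>s. g (a + s *\<^sub>R w)) has_derivative (\<lambda>h. h * g' w)) (at s)"
      using linear_cmul[OF has_derivative_linear[OF that]] by (simp add: o_def)
    moreover have "(\<lambda>h. h * g' w) = (*) (g' w)" by (simp add: fun_eq_iff)
    ultimately show ?thesis by (simp add: has_field_derivative_def)
  qed
  let ?g = "\<lambda>s. f ((x + h *\<^sub>R v) + s *\<^sub>R u) - f (x + s *\<^sub>R u)"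
  have "\<exists>s. 0 < s \<and> s < h \<and> ?g h - ?g 0 = (h - 0) * (?D ((x + h *\<^sub>R v) + s *\<^sub>R u) u - ?D (x + s *\<^sub>R u) u)"
  proof (rule MVT2[OF h])
    fix s assume "0 \<le> s" "s \<le> h"
    then have "x + h *\<^sub>R v + s *\<^sub>R u \<in> S" "x + s *\<^sub>R u \<in> S"
      using sub[of s h] sub[of s 0] h by (auto simp: algebra_simps)
    then show "(?g has_real_derivative ?D ((x + h *\<^sub>R v) + s *\<^sub>R u) u - ?D (x + s *\<^sub>R u) u) (at s)"
      by (intro DERIV_diff along f1)
  qed
  then obtain s where s: "0 < s" "s < h"
    "?g h - ?g 0 = h * (?D ((x + h *\<^sub>R v) + s *\<^sub>R u) u - ?D (x + s *\<^sub>R u) u)" by auto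
  let ?k = "\<lambda>t. ?D ((x + s *\<^sub>R u) + t *\<^sub>R v) u"
  have "\<exists>t. 0 < t \<and> t < h \<and> ?k h - ?k 0 =
      (h - 0) * frechet_derivative (\<lambda>z. ?D z u) (at ((x + s *\<^sub>R u) + t *\<^sub>R v)) v"
  proof (rule MVT2[OF h])
    fix t assume "0 \<le> t" "t \<le> h"
    then have "x + s *\<^sub>R u + t *\<^sub>R v \<in> S" using sub s by auto
    then show "(?k has_real_derivative frechet_derivative (\<lambda>z. ?D z u) (at ((x + s *\<^sub>R u) + t *\<^sub>R v)) v) (at t)"
      by (intro along f2)
  qed
  then obtain t where t: "0 < t" "t < h"
    "?k h - ?k 0 = h * frechet_derivative (\<lambda>z. ?D z u) (at ((x + s *\<^sub>R u) + t *\<^sub>R v)) v" by auto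
  show ?thesis
    by (rule that[of s t]) (use s t in \<open>auto simp: algebra_simps\<close>)
qed

lemma second_derivative_symmetric_real:
  fixes f :: "'a::euclidean_space \<Rightarrow> real"
  assumes S: "open S" "x \<in> S" and f: "Ck_on 2 f S"
  shows "frechet_derivative (\<lambda>z. frechet_derivative f (at z) u) (at x) v =
         frechet_derivative (\<lambda>z. frechet_derivative f (at z) v) (at x) u"
proof -
  define A where "A = (\<lambda>u v z. frechet_derivative (\<lambda>z. frechet_derivative f (at z) u) (at z) v)"
  have cont: "continuous_on S (A u v)" for u v
    using f by (auto simp: numeral_2_eq_2 A_def)
  have approx: "\<bar>A u v x - A v u x\<bar> \<le> 2 * e" if "e > 0" for e
  proof -
    have "\<exists>d>0. \<forall>z\<in>S. dist z x < d \<longrightarrow> dist (A u v z) (A u v x) < e"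
      "\<exists>d>0. \<forall>z\<in>S. dist z x < d \<longrightarrow> dist (A v u z) (A v u x) < e"
      using cont[unfolded continuous_on_iff] S(2) that by blast+
    then obtain d1 d2 where d: "d1 > 0" "\<And>z. z \<in> S \<Longrightarrow> dist z x < d1 \<Longrightarrow> dist (A u v z) (A u v x) < e"
      "d2 > 0" "\<And>z. z \<in> S \<Longrightarrow> dist z x < d2 \<Longrightarrow> dist (A v u z) (A v u x) < e" by metis
    obtain r where r: "r > 0" "ball x r \<subseteq> S" using S open_contains_ball by blast
    define m where "m = Min {d1, d2, r}"
    \<comment> \<open>This size keeps the parallelogram spanned by \<open>h u\<close> and \<open>h v\<close> within distance \<open>m\<close> of \<open>x\<close>.\<close>
    define h where "h = m / (2 * (norm u + norm v + 1))"
    have m: "m > 0" using d r by (auto simp: m_def)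
    have h: "h > 0" using m by (auto simp: h_def intro!: divide_pos_pos add_nonneg_pos)
    have near: "dist (x + s *\<^sub>R u + t *\<^sub>R v) x < m" if "0 \<le> s" "s \<le> h" "0 \<le> t" "t \<le> h" for s t
    proof -
      have "dist (x + s *\<^sub>R u + t *\<^sub>R v) x = norm (s *\<^sub>R u + t *\<^sub>R v)" by (simp add: dist_norm)
      also have "\<dots> \<le> s * norm u + t * norm v"
        using norm_triangle_ineq[of "s *\<^sub>R u" "t *\<^sub>R v"] that by simp
      also have "\<dots> \<le> h * norm u + h * norm v" using that by (intro add_mono mult_right_mono) auto
      also have "\<dots> < h * (2 * (norm u + norm v + 1))"
        using h by (simp add: algebra_simps add_strict_increasing2)
      also have "\<dots> = m" by (simp add: h_def) (smt (verit) norm_ge_zero)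
      finally show ?thesis .
    qed
    have inS: "x + s *\<^sub>R u + t *\<^sub>R v \<in> S" if "0 \<le> s" "s \<le> h" "0 \<le> t" "t \<le> h" for s t
      using near[OF that] r by (auto simp: m_def dist_commute)
    obtain s t where st: "0 \<le> s" "s \<le> h" "0 \<le> t" "t \<le> h"
      "f (x + h *\<^sub>R u + h *\<^sub>R v) - f (x + h *\<^sub>R u) - f (x + h *\<^sub>R v) + f x = h * h * A u v (x + s *\<^sub>R u + t *\<^sub>R v)"
      using mixed_difference_quotient[OF h inS S(1) f] unfolding A_def by blast
    have inS': "x + s *\<^sub>R v + t *\<^sub>R u \<in> S" if "0 \<le> s" "s \<le> h" "0 \<le> t" "t \<le> h" for s t
      using inS[of t s] that by (simp add: algebra_simps)
    obtain s' t' where st': "0 \<le> s'" "s' \<le> h" "0 \<le> t'" "t' \<le> h"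
      "f (x + h *\<^sub>R v + h *\<^sub>R u) - f (x + h *\<^sub>R v) - f (x + h *\<^sub>R u) + f x = h * h * A v u (x + s' *\<^sub>R v + t' *\<^sub>R u)"
      using mixed_difference_quotient[OF h inS' S(1) f] unfolding A_def by blast
    have "h * h * A u v (x + s *\<^sub>R u + t *\<^sub>R v) = h * h * A v u (x + s' *\<^sub>R v + t' *\<^sub>R u)"
      using st(5) st'(5) by (simp add: algebra_simps)
    then have eq: "A u v (x + s *\<^sub>R u + t *\<^sub>R v) = A v u (x + t' *\<^sub>R u + s' *\<^sub>R v)"
      using h by (simp add: algebra_simps)
    have "dist (A u v (x + s *\<^sub>R u + t *\<^sub>R v)) (A u v x) < e"
      using d(2) near[OF st(1-4)] inS[OF st(1-4)] by (auto simp: m_def)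
    moreover have "dist (A v u (x + t' *\<^sub>R u + s' *\<^sub>R v)) (A v u x) < e"
      using d(4) near[OF st'(3,4,1,2)] inS[OF st'(3,4,1,2)] by (auto simp: m_def)
    ultimately show ?thesis using eq by (auto simp: dist_real_def)
  qed
  have "\<bar>A u v x - A v u x\<bar> \<le> 0 + e" if "e > 0" for e
    using approx[of "e / 2"] that by simp
  then have "\<bar>A u v x - A v u x\<bar> \<le> 0" by (rule field_le_epsilon)
  then show ?thesis by (simp add: A_def)
qed

lemma frechet_derivative_inner:
  assumes "f differentiable (at x)"
  shows "frechet_derivative (\<lambda>x. f x \<bullet> b) (at x) v = frechet_derivative f (at x) v \<bullet> b"
  using frechet_derivative_at[OF has_derivative_inner_left[OF has_derivative_frechet[OF assms]], of b]
  by metis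

lemma smooth_on_derivative_symmetric:
  fixes f :: "'a::euclidean_space \<Rightarrow> 'b::euclidean_space"
  assumes S: "open S" "x \<in> S" and f: "smooth_on S f"
  shows "frechet_derivative (\<lambda>z. frechet_derivative f (at z) u) (at x) v =
         frechet_derivative (\<lambda>z. frechet_derivative f (at z) v) (at x) u"
proof (rule euclidean_eqI)
  fix b :: 'b
  assume "b \<in> Basis"
  have fb: "smooth_on S (\<lambda>x. f x \<bullet> b)"
    using smooth_on_linear[OF S(1) bounded_linear_inner_left f] .
  have *: "frechet_derivative (\<lambda>z. frechet_derivative (\<lambda>x. f x \<bullet> b) (at z) u) (at x) v =
    frechet_derivative (\<lambda>z. frechet_derivative f (at z) u) (at x) v \<bullet> b" for u v
  proof -
    have "frechet_derivative (\<lambda>z. frechet_derivative (\<lambda>x. f x \<bullet> b) (at z) u) (at x) =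
      frechet_derivative (\<lambda>z. frechet_derivative f (at z) u \<bullet> b) (at x)"
      by (rule frechet_derivative_cong_open[OF S])
        (use smooth_on_has_derivative[OF f] in \<open>auto intro!: frechet_derivative_inner differentiableI\<close>)
    moreover have "frechet_derivative (\<lambda>z. frechet_derivative f (at z) u \<bullet> b) (at x) v =
        frechet_derivative (\<lambda>z. frechet_derivative f (at z) u) (at x) v \<bullet> b"
      using smooth_on_has_derivative[OF smooth_on_frechet_derivative[OF f] S(2)]
      by (intro frechet_derivative_inner differentiableI)
    ultimately show ?thesis by simp
  qed
  have "Ck_on 2 (\<lambda>x. f x \<bullet> b) S" using fb by (simp add: smooth_on_def)
  from second_derivative_symmetric_real[OF S this, of u v]
  show "frechet_derivative (\<lambda>z. frechet_derivative f (at z) u) (at x) v \<bullet> b =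
         frechet_derivative (\<lambda>z. frechet_derivative f (at z) v) (at x) u \<bullet> b"
    by (simp add: *)
qed

section \<open>Ordinary differential equations\<close>

text \<open>The Picard operator is a contraction on bounded continuous functions on the whole line; the
  upper limit of integration is clamped to \<open>[-e, e]\<close> to stay in that space.\<close>

lemma picard_lindelof_global:
  fixes W :: "'a::euclidean_space \<Rightarrow> 'a"
  assumes L: "L \<ge> 0" and lip: "\<And>x y. norm (W x - W y) \<le> L * norm (x - y)"
  obtains e u where "e > 0" "u 0 = x0"
    "\<And>t. \<bar>t\<bar> < e \<Longrightarrow> (u has_vector_derivative W (u t)) (at t)"
proof -
  \<comment> \<open>The operator integrates from \<open>-e\<close> and subtracts the value at \<open>0\<close>, so lengths \<open>2e\<close> and \<open>e\<close> of
    integration enter the Lipschitz estimate and \<open>3eL \<le> 1/2\<close> is what is needed.\<close>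
  define e where "e = 1 / (6 * (L + 1))"
  have e: "e > 0" "3 * e * L \<le> 1 / 2" using L by (auto simp: e_def field_simps)
  define cl where "cl = (\<lambda>t::real. max (- e) (min e t))"
  have cl: "cl t \<in> {-e..e}" for t using e by (auto simp: cl_def)
  have contW: "continuous_on T W" for T
  proof (rule continuous_on_subset)
    have "L-lipschitz_on UNIV W"
      using L lip by (intro lipschitz_onI) (auto simp: dist_norm)
    then show "continuous_on UNIV W" by (rule lipschitz_on_continuous_on)
  qed auto
  define I where "I = (\<lambda>v t. x0 + (integral {-e..t} (\<lambda>s. W (v s)) - integral {-e..0} (\<lambda>s. W (v s))))"
  have Wv: "continuous_on T (\<lambda>s. W (apply_bcontfun v s))" for v :: "real \<Rightarrow>\<^sub>C 'a" and T
    by (rule continuous_on_compose2[OF contW[of UNIV]]) (auto intro!: continuous_intros)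
  have contI: "continuous_on {-e..e} (I (apply_bcontfun v))" for v :: "real \<Rightarrow>\<^sub>C 'a"
    unfolding I_def by (intro continuous_intros indefinite_integral_continuous_1 integrable_continuous_real Wv)
  have bc: "(\<lambda>t. I (apply_bcontfun v) (cl t)) \<in> bcontfun" for v :: "real \<Rightarrow>\<^sub>C 'a"
  proof -
    have "continuous_on UNIV (\<lambda>t. I (apply_bcontfun v) (cl t))"
      by (rule continuous_on_compose2[OF contI]) (use cl in \<open>auto simp: cl_def intro!: continuous_intros\<close>)
    moreover have "bounded (I (apply_bcontfun v) ` {-e..e})"
      by (intro compact_imp_bounded compact_continuous_image contI compact_Icc)
    then obtain B where "\<And>s. s \<in> {-e..e} \<Longrightarrow> norm (I (apply_bcontfun v) s) \<le> B"
      unfolding bounded_iff by blast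
    then have "bounded (range (\<lambda>t. I (apply_bcontfun v) (cl t)))"
      unfolding bounded_iff using cl by blast
    ultimately show ?thesis by (simp add: bcontfun_def)
  qed
  define \<Phi> where "\<Phi> = (\<lambda>v. Bcontfun (\<lambda>t. I (apply_bcontfun v) (cl t)))"
  have \<Phi>: "apply_bcontfun (\<Phi> v) t = I (apply_bcontfun v) (cl t)" for v t
    unfolding \<Phi>_def by (simp add: Bcontfun_inverse[OF bc])
  have contr: "dist (\<Phi> v) (\<Phi> w) \<le> (1/2) * dist v w" for v w
  proof (rule dist_bound)
    fix t
    let ?g = "\<lambda>s. W (apply_bcontfun v s) - W (apply_bcontfun w s)"
    have g: "norm (?g s) \<le> L * dist v w" for s
      using lip[of "v s" "w s"] dist_bounded[of v s w] L
      by (smt (verit) dist_norm mult_left_mono)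
    have int: "(\<lambda>s. W (apply_bcontfun v s)) integrable_on {a..b}" for v and a b :: real
      by (intro integrable_continuous_real Wv)
    have bnd: "norm (integral {-e..b} ?g) \<le> (L * dist v w) * (b + e)" if "b \<ge> -e" for b
    proof -
      have "continuous_on {-e..b} ?g" by (intro continuous_on_diff Wv)
      from integral_bound[OF that this, of "L * dist v w"] g show ?thesis by simp
    qed
    have "I (apply_bcontfun v) (cl t) - I (apply_bcontfun w) (cl t) = integral {-e..cl t} ?g - integral {-e..0} ?g"
      unfolding I_def by (subst (1 2) integral_diff) (auto intro: int)
    then have "dist (\<Phi> v t) (\<Phi> w t) \<le> norm (integral {-e..cl t} ?g) + norm (integral {-e..0} ?g)"
      unfolding \<Phi> dist_norm by (metis norm_triangle_ineq4)
    also have "\<dots> \<le> (L * dist v w) * (cl t + e) + (L * dist v w) * (0 + e)"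
      using cl[of t] e by (intro add_mono bnd) auto
    also have "\<dots> \<le> (L * dist v w) * (e + e) + (L * dist v w) * (0 + e)"
      using cl[of t] L by (intro add_mono mult_left_mono) auto
    also have "\<dots> = (3 * e * L) * dist v w" by (simp add: algebra_simps)
    also have "\<dots> \<le> (1/2) * dist v w" using e by (intro mult_right_mono) auto
    finally show "dist (\<Phi> v t) (\<Phi> w t) \<le> (1/2) * dist v w" .
  qed
  have "\<exists>!u. \<Phi> u = u" by (rule banach_fix_type[of "1/2"]) (use contr in auto)
  then obtain u where u: "\<Phi> u = u" by blast
  have ut: "u t = I u t" if "t \<in> {-e..e}" for t
    using \<Phi>[of u t] that by (simp add: u cl_def)
  show ?thesis
  proof (rule that[OF e(1)])
    show "u 0 = x0" using ut[of 0] e by (simp add: I_def)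
    fix t :: real assume t: "\<bar>t\<bar> < e"
    have "((\<lambda>t. integral {-e..t} (\<lambda>s. W (u s))) has_vector_derivative W (u t)) (at t within {-e..e})"
      by (rule integral_has_vector_derivative[OF Wv]) (use t in auto)
    then have "((\<lambda>t. integral {-e..t} (\<lambda>s. W (u s))) has_vector_derivative W (u t)) (at t)"
      using t by (simp add: at_within_Icc_at)
    then have "(I u has_vector_derivative W (u t)) (at t)"
      unfolding I_def by (auto intro!: derivative_eq_intros)
    then show "(u has_vector_derivative W (u t)) (at t)"
      by (rule has_vector_derivative_transform_within_open[where S = "{-e<..<e}"]) (use t ut in auto)
  qed
qed

text \<open>The derivative is bounded on the compact ball, which is convex.\<close>

lemma smooth_on_lipschitz_cball:
  fixes V :: "'a::euclidean_space \<Rightarrow> 'b::euclidean_space"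
  assumes S: "open S" and V: "smooth_on S V" and B: "cball x0 r \<subseteq> S"
  obtains L where "L \<ge> 0" "\<And>x y. x \<in> cball x0 r \<Longrightarrow> y \<in> cball x0 r \<Longrightarrow> norm (V x - V y) \<le> L * norm (x - y)"
proof -
  let ?D = "\<lambda>x. frechet_derivative V (at x)"
  have "\<exists>K. \<forall>x\<in>cball x0 r. norm (?D x b) \<le> K" for b
  proof -
    have "continuous_on (cball x0 r) (\<lambda>x. ?D x b)"
      using smooth_on_imp_continuous_on[OF smooth_on_frechet_derivative[OF V]] B continuous_on_subset by blast
    then have "bounded ((\<lambda>x. ?D x b) ` cball x0 r)"
      by (intro compact_imp_bounded compact_continuous_image compact_cball)
    then show ?thesis by (auto simp: bounded_iff)
  qed
  then obtain K where K: "\<And>b x. x \<in> cball x0 r \<Longrightarrow> norm (?D x b) \<le> K b" by metis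
  define L where "L = (\<Sum>b\<in>Basis. \<bar>K b\<bar>)"
  have "norm (?D x v) \<le> L * norm v" if "x \<in> cball x0 r" for x v
  proof -
    have "?D x v = (\<Sum>b\<in>Basis. (v \<bullet> b) *\<^sub>R ?D x b)"
      using that B by (intro linear_expand_Basis smooth_on_linear_derivative[OF V]) auto
    then have "norm (?D x v) \<le> (\<Sum>b\<in>Basis. norm ((v \<bullet> b) *\<^sub>R ?D x b))"
      by (simp only: norm_sum)
    also have "\<dots> \<le> (\<Sum>b\<in>Basis. norm v * \<bar>K b\<bar>)"
      using K[OF that] Basis_le_norm[of _ v]
      by (intro sum_mono) (fastforce intro!: mult_mono intro: order_trans abs_ge_self)
    finally show ?thesis by (simp add: L_def sum_distrib_right sum_distrib_left mult.commute)
  qed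
  then have "onorm (?D x) \<le> L" if "x \<in> cball x0 r" for x
    using that by (intro onorm_le) auto
  then have "norm (V x - V y) \<le> L * norm (x - y)" if "x \<in> cball x0 r" "y \<in> cball x0 r" for x y
    using that B
    by (intro differentiable_bound[where f' = ?D and S = "cball x0 r"])
      (auto intro!: has_derivative_at_withinI smooth_on_has_derivative[OF V])
  moreover have "L \<ge> 0" by (auto simp: L_def intro: sum_nonneg)
  ultimately show ?thesis using that by blast
qed

text \<open>Composing the field with the nearest-point projection onto a ball makes it globally
  Lipschitz; by continuity the solution of the modified equation stays in the ball for a short time.\<close>

lemma ode_local_existence:
  fixes V :: "'a::euclidean_space \<Rightarrow> 'a"
  assumes S: "open S" "cball x0 r \<subseteq> S" "r > 0" and V: "smooth_on S V"
  obtains e u where "e > 0" "u 0 = x0" "\<And>t. \<bar>t\<bar> < e \<Longrightarrow> u t \<in> cball x0 r"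
    "\<And>t. \<bar>t\<bar> < e \<Longrightarrow> (u has_vector_derivative V (u t)) (at t)"
proof -
  obtain L where L: "L \<ge> 0"
    "\<And>x y. x \<in> cball x0 r \<Longrightarrow> y \<in> cball x0 r \<Longrightarrow> norm (V x - V y) \<le> L * norm (x - y)"
    using smooth_on_lipschitz_cball[OF S(1) V S(2)] by blast
  let ?c = "closest_point (cball x0 r)"
  have c: "?c x \<in> cball x0 r" for x using S(3) by (intro closest_point_in_set) auto
  have "norm (V (?c x) - V (?c y)) \<le> L * norm (x - y)" for x y
  proof -
    have "dist (?c x) (?c y) \<le> dist x y"
      using S(3) by (intro closest_point_lipschitz) auto
    then show ?thesis using L(2)[OF c c, of x y] L(1)
      by (smt (verit) dist_norm mult_left_mono)
  qed
  from picard_lindelof_global[OF L(1) this, where ?x0.0 = x0] obtain e u where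
    u: "e > 0" "u 0 = x0" "\<And>t. \<bar>t\<bar> < e \<Longrightarrow> (u has_vector_derivative V (?c (u t))) (at t)" by metis
  have "isCont u 0" using u(3)[of 0] u(1) has_vector_derivative_continuous by auto
  then obtain d where d: "d > 0" "\<And>t. dist t 0 < d \<Longrightarrow> dist (u t) (u 0) < r"
    using S(3) unfolding continuous_at_eps_delta by metis
  have "u t \<in> cball x0 r" if "\<bar>t\<bar> < min d e" for t
    using d(2)[of t] that u(2) by (auto simp: dist_commute)
  moreover from this have "(u has_vector_derivative V (u t)) (at t)" if "\<bar>t\<bar> < min d e" for t
    using u(3)[of t] that closest_point_self[of "u t" "cball x0 r"] by auto
  ultimately show ?thesis using that[of "min d e" u] u d by auto
qed

text \<open>Gronwall's argument: \<open>exp(-2Lt) |u - v|\<^sup>2\<close> is nonincreasing and vanishes at \<open>0\<close>.\<close>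

lemma ode_unique_forward:
  fixes u v :: "real \<Rightarrow> 'a::euclidean_space"
  assumes lip: "\<And>x y. x \<in> B \<Longrightarrow> y \<in> B \<Longrightarrow> norm (V x - V y) \<le> L * norm (x - y)"
    and u: "\<And>s. 0 \<le> s \<Longrightarrow> s \<le> t \<Longrightarrow> (u has_vector_derivative V (u s)) (at s) \<and> u s \<in> B"
    and v: "\<And>s. 0 \<le> s \<Longrightarrow> s \<le> t \<Longrightarrow> (v has_vector_derivative V (v s)) (at s) \<and> v s \<in> B"
    and "u 0 = v 0" "0 \<le> t"
  shows "u t = v t"
proof -
  let ?w = "\<lambda>s. (u s - v s) \<bullet> (u s - v s)"
  let ?\<phi> = "\<lambda>s. exp (- (2 * L * s)) * ?w s"
  have "?\<phi> t \<le> ?\<phi> 0"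
  proof (rule DERIV_nonpos_imp_nonincreasing[OF \<open>0 \<le> t\<close>])
    fix s assume s: "0 \<le> s" "s \<le> t"
    let ?w' = "2 * ((u s - v s) \<bullet> (V (u s) - V (v s)))"
    have "((\<lambda>s. u s - v s) has_derivative (\<lambda>h. h *\<^sub>R (V (u s) - V (v s)))) (at s)"
      using u[OF s] v[OF s] unfolding has_vector_derivative_def[symmetric]
      by (intro has_vector_derivative_diff) auto
    from has_derivative_inner[OF this this]
    have "(?w has_derivative (\<lambda>h. (u s - v s) \<bullet> (h *\<^sub>R (V (u s) - V (v s))) +
        (h *\<^sub>R (V (u s) - V (v s))) \<bullet> (u s - v s))) (at s)" .
    moreover have "(\<lambda>h. (u s - v s) \<bullet> (h *\<^sub>R (V (u s) - V (v s))) +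
        (h *\<^sub>R (V (u s) - V (v s))) \<bullet> (u s - v s)) = (*) ?w'"
      by (simp add: fun_eq_iff inner_commute[of "V (u s) - V (v s)"])
    ultimately have w: "(?w has_real_derivative ?w') (at s)"
      by (simp only: has_field_derivative_def)
    have "(?\<phi> has_real_derivative exp (- (2 * L * s)) * (?w' - 2 * L * ?w s)) (at s)"
      by (rule derivative_eq_intros w refl | simp add: algebra_simps)+
    moreover have "?w' - 2 * L * ?w s \<le> 0"
    proof -
      have "(u s - v s) \<bullet> (V (u s) - V (v s)) \<le> norm (u s - v s) * norm (V (u s) - V (v s))"
        by (rule norm_cauchy_schwarz)
      also have "\<dots> \<le> norm (u s - v s) * (L * norm (u s - v s))"
        using u[OF s] v[OF s] by (intro mult_left_mono lip) auto
      also have "\<dots> = L * ?w s" by (simp add: dot_square_norm power2_eq_square)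
      finally show ?thesis by simp
    qed
    then have "exp (- (2 * L * s)) * (?w' - 2 * L * ?w s) \<le> 0"
      by (simp add: mult_nonneg_nonpos)
    ultimately show "\<exists>y. (?\<phi> has_real_derivative y) (at s) \<and> y \<le> 0" by blast
  qed
  then have "exp (- (2 * L * t)) * ?w t \<le> 0" using assms by simp
  then have "?w t \<le> 0" by (simp add: mult_le_0_iff)
  then show ?thesis by (metis inner_gt_zero_iff not_less eq_iff_diff_eq_0)
qed

lemma ode_unique:
  fixes u v :: "real \<Rightarrow> 'a::euclidean_space"
  assumes lip: "\<And>x y. x \<in> B \<Longrightarrow> y \<in> B \<Longrightarrow> norm (V x - V y) \<le> L * norm (x - y)"
    and u: "\<And>s. \<bar>s\<bar> < e \<Longrightarrow> (u has_vector_derivative V (u s)) (at s) \<and> u s \<in> B"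
    and v: "\<And>s. \<bar>s\<bar> < e \<Longrightarrow> (v has_vector_derivative V (v s)) (at s) \<and> v s \<in> B"
    and uv: "u 0 = v 0" and t: "\<bar>t\<bar> < e"
  shows "u t = v t"
proof (cases "0 \<le> t")
  case True
  show ?thesis
    by (rule ode_unique_forward[where B = B and V = V and L = L]) (use lip u v uv t True in auto)
next
  case False
  have rev: "((\<lambda>s. w (- s)) has_vector_derivative - V (w (- s))) (at s)"
    if "(w has_vector_derivative V (w (- s))) (at (- s))" for w s
  proof -
    have "(uminus has_real_derivative -1) (at s)" by (auto intro!: derivative_eq_intros)
    from vector_diff_chain_at[OF this[unfolded has_real_derivative_iff_has_vector_derivative] that]
    show ?thesis by (simp add: o_def)
  qed
  have "(\<lambda>s. u (- s)) (- t) = (\<lambda>s. v (- s)) (- t)"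
  proof (rule ode_unique_forward[where V = "\<lambda>x. - V x" and B = B and L = L
        and u = "\<lambda>s. u (- s)" and v = "\<lambda>s. v (- s)" and t = "- t"])
    show "norm (- V x - - V y) \<le> L * norm (x - y)" if "x \<in> B" "y \<in> B" for x y
      using lip[OF that] by (simp add: norm_minus_commute)
    show "((\<lambda>s. u (- s)) has_vector_derivative - V (u (- s))) (at s) \<and> u (- s) \<in> B" if "0 \<le> s" "s \<le> - t" for s
      using rev[of u s] u[of "- s"] that t by auto
    show "((\<lambda>s. v (- s)) has_vector_derivative - V (v (- s))) (at s) \<and> v (- s) \<in> B" if "0 \<le> s" "s \<le> - t" for s
      using rev[of v s] v[of "- s"] that t by auto
  qed (use uv False in auto)
  then show ?thesis by simp
qed

text \<open>A solution that is \<open>C\<^sup>k\<close> has the \<open>C\<^sup>k\<close> derivative \<open>V \<circ> u\<close>.\<close>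

lemma ode_solution_smooth:
  fixes u :: "real \<Rightarrow> 'a::euclidean_space"
  assumes I: "open I" and U: "open U" "smooth_on U V" and uU: "u ` I \<subseteq> U"
    and u: "\<And>t. t \<in> I \<Longrightarrow> (u has_vector_derivative V (u t)) (at t)"
  shows "smooth_on I u"
proof -
  have "Ck_on k u I" for k
  proof (induction k)
    case 0
    have "continuous (at t) u" if "t \<in> I" for t
      using u[OF that] by (rule has_vector_derivative_continuous)
    then show ?case by (simp add: continuous_at_imp_continuous_on)
  next
    case (Suc k)
    show ?case
    proof (rule Ck_on_SucI[OF I])
      show "(u has_derivative (\<lambda>h. h *\<^sub>R V (u t))) (at t)" if "t \<in> I" for t
        using u[OF that] by (simp add: has_vector_derivative_def)
      have "Ck_on k (\<lambda>t. V (u t)) I"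
        using U by (intro Ck_on_compose[OF I U(1) uU Suc]) (simp add: smooth_on_def)
      then show "Ck_on k (\<lambda>t. h *\<^sub>R V (u t)) I" for h
        by (rule Ck_on_linear[OF I bounded_linear_scaleR_right])
    qed
  qed
  then show ?thesis by (simp add: smooth_on_def)
qed

section \<open>Images of maps of constant rank\<close>

text \<open>The image of a basis of \<open>U\<close> spans a space of at least as many dimensions as the basis has
  elements, so \<open>h\<close> is injective on the basis and the image is independent.\<close>

lemma linear_inj_on_subspace_if_dim:
  fixes h :: "'a::euclidean_space \<Rightarrow> 'b::euclidean_space"
  assumes "linear h" "subspace U" "dim U \<le> dim (h ` U)"
  shows "inj_on h U"
proof -
  obtain B where B: "B \<subseteq> U" "independent B" "U \<subseteq> span B" "card B = dim U"
    using basis_exists by blast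
  have finB: "finite B" using B(2) finiteI_independent by blast
  have "h ` U \<subseteq> span (h ` B)"
    using B(3) linear_span_image[OF assms(1)] by blast
  then have "dim (h ` U) \<le> dim (h ` B)" by (metis dim_span dim_subset)
  then have le: "card B \<le> dim (h ` B)" using assms(3) B(4) by linarith
  have "dim (h ` B) \<le> card (h ` B)" using finB by (intro dim_le_card') auto
  then have card: "card (h ` B) = card B" using le card_image_le[OF finB, of h] by linarith
  then have inj: "inj_on h B" using finB by (simp add: eq_card_imp_inj_on)
  have "independent (h ` B)"
    using le card finB by (metis card_le_dim_spanning dim_span finite_imageI span_superset dim_eq_card_independent order_refl card_eq_dim dim_le_card' le_antisym)
  then show ?thesis
    using linear_inj_on_span_independent_image[OF assms(1) _ ] inj B(3)
    by (meson assms(1) inj_on_subset linear_inj_on_span_independent_image)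
qed

text \<open>The part of the constant rank theorem that the proof of surjectivity needs. Let \<open>A\<close> be the
  derivative at \<open>x0\<close> and \<open>B\<close> a right inverse of \<open>A\<close> on its range. The map
  \<open>\<Phi>(x) = x + B(f x) - B(A x)\<close> has derivative \<open>id\<close> at \<open>x0\<close>, hence a local inverse \<open>\<Psi>\<close>. As the rank of
  \<open>f\<close> is constant, \<open>f \<circ> \<Psi>\<close> is constant in the directions of \<open>ker A\<close>. So the image of a small ball is
  also the image under \<open>f \<circ> \<Psi>\<close> of a set parametrized by the proper subspace \<open>range A\<close>.\<close>

lemma constant_rank_image_negligible:
  fixes f :: "'a::euclidean_space \<Rightarrow> 'b::euclidean_space"
  assumes S: "open S" "x0 \<in> S" and f: "smooth_on S f"
    and rank: "\<And>x. x \<in> S \<Longrightarrow> dim (range (frechet_derivative f (at x))) = k"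
    and k: "k < DIM('b)"
  obtains N where "open N" "x0 \<in> N" "N \<subseteq> S" "negligible (f ` N)"
proof -
  define D where "D = (\<lambda>x. frechet_derivative f (at x))"
  define A where "A = D x0"
  have D: "(f has_derivative D x) (at x)" if "x \<in> S" for x
    unfolding D_def using smooth_on_has_derivative[OF f that] .
  have linD: "linear (D x)" if "x \<in> S" for x using D[OF that] has_derivative_linear by blast
  have linA: "linear A" using linD S by (simp add: A_def)
  obtain B where linB: "linear B" and AB: "\<And>y. y \<in> range A \<Longrightarrow> A (B y) = y"
    using linear_exists_right_inverse_on[OF linA subspace_UNIV] by blast
  note bl = linear_conv_bounded_linear[THEN iffD1]
  define \<Phi> where "\<Phi> = (\<lambda>x. x + B (f x) - B (A x))"
  define \<Phi>' where "\<Phi>' = (\<lambda>x. Blinfun (\<lambda>v. v + B (D x v) - B (A v)))"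
  have bl\<Phi>: "bounded_linear (\<lambda>v. v + B (D x v) - B (A v))" if "x \<in> S" for x
    by (intro bounded_linear_sub bounded_linear_add bounded_linear_ident
        bounded_linear_compose[OF bl[OF linB]] bl linD linA that)
  have \<Phi>'_app: "blinfun_apply (\<Phi>' x) v = v + B (D x v) - B (A v)" if "x \<in> S" for x v
    unfolding \<Phi>'_def using bounded_linear_Blinfun_apply[OF bl\<Phi>[OF that]] by simp
  have der\<Phi>: "(\<Phi> has_derivative blinfun_apply (\<Phi>' x)) (at x)" if "x \<in> S" for x
  proof -
    have "(\<Phi> has_derivative (\<lambda>v. v + B (D x v) - B (A v))) (at x)"
      unfolding \<Phi>_def
      by (intro has_derivative_diff has_derivative_add has_derivative_ident
          bounded_linear.has_derivative[OF bl[OF linB]] D that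
          bounded_linear.has_derivative[OF bl[OF linA]])
    moreover have "blinfun_apply (\<Phi>' x) = (\<lambda>v. v + B (D x v) - B (A v))"
      using \<Phi>'_app[OF that] by auto
    ultimately show ?thesis by simp
  qed
  have cont\<Phi>: "continuous_on S \<Phi>'"
  proof (rule continuous_on_blinfun_componentwise)
    fix i :: 'a
    have "continuous_on S (\<lambda>x. i + B (D x i) - B (A i))"
      unfolding D_def
      by (intro continuous_intros bounded_linear.continuous_on[OF bl[OF linB]]
          smooth_on_imp_continuous_on smooth_on_frechet_derivative f)
    then show "continuous_on S (\<lambda>x. blinfun_apply (\<Phi>' x) i)"
      by (rule continuous_on_eq) (simp add: \<Phi>'_app)
  qed
  have "\<Phi>' x0 = id_blinfun"
    using \<Phi>'_app[OF S(2)] by (intro blinfun_eqI) (simp add: A_def)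
  then have inv: "id_blinfun o\<^sub>L \<Phi>' x0 = id_blinfun" by (intro blinfun_eqI) simp
  obtain U V \<Psi> \<Psi>' where U: "open U" "U \<subseteq> S" "x0 \<in> U" and V: "open V" "\<Phi> x0 \<in> V"
    and hom: "homeomorphism U V \<Phi> \<Psi>"
    and der\<Psi>: "\<And>w. w \<in> V \<Longrightarrow> (\<Psi> has_derivative \<Psi>' w) (at w)"
    and \<Psi>': "\<And>w. w \<in> V \<Longrightarrow> \<Psi>' w = Hilbert_Choice.inv (blinfun_apply (\<Phi>' (\<Psi> w)))"
    and bij: "\<And>w. w \<in> V \<Longrightarrow> bij (blinfun_apply (\<Phi>' (\<Psi> w)))"
    using inverse_function_theorem[OF S(1) der\<Phi> cont\<Phi> S(2) inv] by metis
  have \<Psi>U: "\<Psi> w \<in> U" "\<Psi> w \<in> S" if "w \<in> V" for w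
    using hom that U by (auto simp: homeomorphism_def)
  \<comment> \<open>\<open>A \<circ> \<Phi>'(x) = A B Df(x)\<close> and \<open>\<Phi>'(x)\<close> is onto, so \<open>A B\<close> maps the range of \<open>Df(x)\<close> onto the range of
    \<open>A\<close>. The two have the same dimension, and therefore \<open>A B\<close> is injective on the range of \<open>Df(x)\<close>.\<close>
  have kill: "D (\<Psi> w) (\<Psi>' w z) = 0" if w: "w \<in> V" and z: "A z = 0" for w z
  proof -
    let ?x = "\<Psi> w"
    have x: "?x \<in> S" using \<Psi>U w by blast
    have A\<Phi>: "A (blinfun_apply (\<Phi>' ?x) v) = A (B (D ?x v))" for v
      by (simp add: \<Phi>'_app[OF x] linear_diff[OF linA] linear_add[OF linA] AB)
    have "range A = (\<lambda>y. A (B y)) ` range (D ?x)"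
    proof -
      have "range A = A ` range (blinfun_apply (\<Phi>' ?x))" using bij[OF w] by (simp add: bij_def)
      then show ?thesis by (auto simp: image_image A\<Phi>)
    qed
    then have "dim (range (D ?x)) \<le> dim ((\<lambda>y. A (B y)) ` range (D ?x))"
      using rank[OF x] rank[OF S(2)] by (simp add: D_def A_def)
    moreover have "linear (\<lambda>y. A (B y))" using linear_compose[OF linB linA] by (simp add: o_def)
    moreover have "subspace (range (D ?x))"
      using linear_subspace_image[OF linD[OF x] subspace_UNIV] .
    ultimately have inj: "inj_on (\<lambda>y. A (B y)) (range (D ?x))"
      using linear_inj_on_subspace_if_dim by blast
    have "blinfun_apply (\<Phi>' ?x) (\<Psi>' w z) = z"
      unfolding \<Psi>'[OF w] using bij[OF w] by (simp add: bij_is_surj surj_f_inv_f)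
    then have "A (B (D ?x (\<Psi>' w z))) = A (B (D ?x 0))"
      using A\<Phi>[of "\<Psi>' w z"] z by (simp add: linear_0[OF linD[OF x]] linear_0[OF linA] linear_0[OF linB])
    then have "D ?x (\<Psi>' w z) = D ?x 0" using inj by (auto simp: inj_on_def)
    then show ?thesis by (simp add: linear_0[OF linD[OF x]])
  qed
  have derf\<Psi>: "((\<lambda>w. f (\<Psi> w)) has_derivative (\<lambda>h. D (\<Psi> w) (\<Psi>' w h))) (at w)" if "w \<in> V" for w
    using diff_chain_at[OF der\<Psi>[OF that] D[OF \<Psi>U(2)[OF that]]] by (simp add: o_def)
  define w0 where "w0 = \<Phi> x0"
  obtain r where r: "r > 0" "ball w0 r \<subseteq> V" using V open_contains_ball unfolding w0_def by blast
  obtain K where K: "K > 0" "\<And>v. norm (B (A v)) \<le> K * norm v"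
    using linear_bounded_pos[OF linear_compose[OF linA linB]] unfolding o_def by blast
  \<comment> \<open>Replacing a point \<open>w\<close> by \<open>w0 + B A (w - w0)\<close>, its projection along \<open>ker A\<close>, must not leave the
    ball of radius \<open>r\<close>.\<close>
  define r' where "r' = r / (K + 1)"
  have r': "r' > 0" "r' \<le> r" "K * r' < r"
    using r K by (auto simp: r'_def field_simps intro!: mult_pos_pos)
  define N where "N = U \<inter> \<Phi> -` ball w0 r'"
  define T where "T = {y \<in> range A. w0 + B y \<in> ball w0 r}"
  have "f ` N \<subseteq> (\<lambda>y. f (\<Psi> (w0 + B y))) ` T"
  proof
    fix y assume "y \<in> f ` N"
    then obtain x where x: "x \<in> U" "\<Phi> x \<in> ball w0 r'" "y = f x" by (auto simp: N_def)
    let ?w = "\<Phi> x"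
    define a where "a = A (?w - w0)"
    let ?w' = "w0 + B a"
    have "norm (B a) \<le> K * norm (?w - w0)" unfolding a_def by (rule K(2))
    also have "\<dots> \<le> K * r'"
    proof (rule mult_left_mono)
      show "norm (?w - w0) \<le> r'"
        using x(2) unfolding mem_ball dist_norm by (simp only: norm_minus_commute)
    qed (use K in simp)
    finally have w': "?w' \<in> ball w0 r" using r' by (simp add: dist_norm)
    have w: "?w \<in> ball w0 r" using x(2) r'(2) by simp
    have Az: "A (?w - ?w') = 0"
    proof -
      have "A (B a) = a" by (rule AB) (simp add: a_def)
      then show ?thesis
        by (simp add: linear_diff[OF linA] linear_add[OF linA]) (simp add: a_def linear_diff[OF linA])
    qed
    let ?\<phi> = "\<lambda>t. f (\<Psi> (?w' + t *\<^sub>R (?w - ?w')))"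
    have "?\<phi> 0 = ?\<phi> 1"
    proof (rule has_derivative_zero_unique[of "{0..1}"])
      fix t :: real assume t: "t \<in> {0..1}"
      have eq: "?w' + t *\<^sub>R (?w - ?w') = (1 - t) *\<^sub>R ?w' + t *\<^sub>R ?w" by (simp add: algebra_simps)
      have "?w' + t *\<^sub>R (?w - ?w') \<in> ball w0 r"
        unfolding eq using t by (intro convexD[OF convex_ball w' w]) auto
      then have inV: "?w' + t *\<^sub>R (?w - ?w') \<in> V" using r by blast
      have "((\<lambda>t. ?w' + t *\<^sub>R (?w - ?w')) has_derivative (\<lambda>h. h *\<^sub>R (?w - ?w'))) (at t)"
        by (auto intro!: derivative_eq_intros)
      from diff_chain_at[OF this derf\<Psi>[OF inV]]
      have "(?\<phi> has_derivative (\<lambda>h. D (\<Psi> (?w' + t *\<^sub>R (?w - ?w'))) (\<Psi>' (?w' + t *\<^sub>R (?w - ?w')) (h *\<^sub>R (?w - ?w'))))) (at t)"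
        by (simp add: o_def)
      moreover have "A (h *\<^sub>R (?w - ?w')) = 0" for h
        using Az by (simp add: linear_scale[OF linA])
      ultimately show "(?\<phi> has_derivative (\<lambda>h. 0)) (at t within {0..1})"
        using kill[OF inV] by (simp add: has_derivative_at_withinI)
    qed auto
    then have "f (\<Psi> ?w') = f (\<Psi> ?w)" by simp
    moreover have "\<Psi> ?w = x" using hom x(1) by (auto simp: homeomorphism_def)
    moreover have "a \<in> T" using w' by (auto simp: T_def a_def)
    ultimately show "y \<in> (\<lambda>y. f (\<Psi> (w0 + B y))) ` T"
      using x(3) by force
  qed
  moreover have "negligible ((\<lambda>y. f (\<Psi> (w0 + B y))) ` T)"
  proof (rule negligible_differentiable_image_negligible)
    have "dim T \<le> dim (range A)" by (rule dim_subset) (auto simp: T_def)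
    then show "negligible T" using rank[OF S(2)] k by (intro negligible_lowdim) (simp add: A_def D_def)
    show "(\<lambda>y. f (\<Psi> (w0 + B y))) differentiable_on T"
      unfolding differentiable_on_def
    proof
      fix y assume "y \<in> T"
      then have "w0 + B y \<in> V" using r by (auto simp: T_def)
      moreover have "((\<lambda>y. w0 + B y) has_derivative B) (at y)"
        using bounded_linear_imp_has_derivative[OF bl[OF linB]] by (auto intro!: derivative_eq_intros)
      ultimately have "((\<lambda>y. f (\<Psi> (w0 + B y))) has_derivative (\<lambda>h. D (\<Psi> (w0 + B y)) (\<Psi>' (w0 + B y) (B h)))) (at y)"
        using diff_chain_at[OF _ derf\<Psi>] by (fastforce simp: o_def)
      then show "(\<lambda>y. f (\<Psi> (w0 + B y))) differentiable at y within T"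
        using has_derivative_at_withinI differentiableI by blast
    qed
  qed simp
  ultimately have "negligible (f ` N)" by (rule negligible_subset[rotated])
  moreover have "open N"
    unfolding N_def using hom U(1) by (intro continuous_open_preimage) (auto simp: homeomorphism_def)
  ultimately show ?thesis
    using that[of N] U r' by (auto simp: N_def w0_def)
qed

section \<open>The hairy ball theorem\<close>

lemma nsphere_eq_top_of_set:
  "nsphere p = top_of_set {x. (\<Sum>i\<le>p. x i ^ 2) = 1 \<and> (\<forall>i>p. x i = 0)}"
  by (simp add: nsphere euclidean_product_topology)

lemma continuous_map_nsphere_iff:
  "continuous_map (nsphere p) (nsphere p) f \<longleftrightarrow>
   continuous_on (topspace (nsphere p)) f \<and> f ` topspace (nsphere p) \<subseteq> topspace (nsphere p)"
  unfolding nsphere_eq_top_of_set by (auto simp: continuous_map_in_subtopology)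

text \<open>The reflection in coordinate \<open>k\<close> is conjugate to the one in coordinate \<open>0\<close> by the transposition
  of these coordinates, an involution of the sphere, whose degree squares to \<open>1\<close>.\<close>

lemma Brouwer_degree2_reflection_coordinate:
  assumes "k \<le> p"
  shows "Brouwer_degree2 p (\<lambda>x i. if i = k then - x i else x i) = -1"
proof -
  let ?r = "\<lambda>k (x::nat \<Rightarrow> real) i. if i = k then - x i else x i"
  define s where "s = (\<lambda>(x::nat \<Rightarrow> real) i. x (Transposition.transpose 0 k i))"
  have sum: "(\<Sum>i\<le>p. (x (Transposition.transpose 0 k i))\<^sup>2) = (\<Sum>i\<le>p. (x i)\<^sup>2)" for x :: "nat \<Rightarrow> real"
  proof (rule sum.reindex_bij_betw)
    show "bij_betw (Transposition.transpose 0 k) {..p} {..p}"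
      using assms by (intro bij_betw_byWitness[where f' = "Transposition.transpose 0 k"])
        (auto simp: Transposition.transpose_def)
  qed
  have s: "continuous_map (nsphere p) (nsphere p) s"
    unfolding continuous_map_nsphere_iff
  proof
    show "continuous_on (topspace (nsphere p)) s"
      unfolding s_def by (intro continuous_on_coordinatewise_then_product
          continuous_on_subset[OF continuous_on_product_coordinates] subset_UNIV)
    show "s ` topspace (nsphere p) \<subseteq> topspace (nsphere p)"
      using assms sum by (auto simp: nsphere_eq_top_of_set s_def)
  qed
  have r: "continuous_map (nsphere p) (nsphere p) (?r j)" for j
    by (rule continuous_map_nsphere_reflection)
  have ss: "s \<circ> s = id" by (auto simp: s_def fun_eq_iff)
  have rk: "?r k = s \<circ> (?r 0 \<circ> s)"
    by (auto simp: s_def fun_eq_iff Transposition.transpose_def)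
  have "Brouwer_degree2 p s * Brouwer_degree2 p s = 1"
    using Brouwer_degree2_compose[OF s s] by (simp add: ss)
  moreover have "Brouwer_degree2 p (?r k) = Brouwer_degree2 p s * (Brouwer_degree2 p (?r 0) * Brouwer_degree2 p s)"
    unfolding rk using Brouwer_degree2_compose[OF s r] Brouwer_degree2_compose[OF continuous_map_compose[OF s r] s]
    by simp
  ultimately show ?thesis using Brouwer_degree2_reflection[of p] by (simp add: algebra_simps)
qed

lemma Brouwer_degree2_antipodal: "Brouwer_degree2 p (\<lambda>x i. - x i) = (-1) ^ Suc p"
proof -
  let ?a = "\<lambda>m (x::nat \<Rightarrow> real) i. if i < m then - x i else x i"
  have "m \<le> Suc p \<Longrightarrow> continuous_map (nsphere p) (nsphere p) (?a m) \<and> Brouwer_degree2 p (?a m) = (-1) ^ m" for m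
  proof (induction m)
    case 0
    have "?a 0 = id" by auto
    then show ?case by simp
  next
    case (Suc m)
    let ?r = "\<lambda>(x::nat \<Rightarrow> real) i. if i = m then - x i else x i"
    have eq: "?a (Suc m) = ?r \<circ> ?a m" by (auto simp: fun_eq_iff)
    have IH: "continuous_map (nsphere p) (nsphere p) (?a m)" "Brouwer_degree2 p (?a m) = (-1) ^ m"
      using Suc by auto
    have r: "continuous_map (nsphere p) (nsphere p) ?r" by (rule continuous_map_nsphere_reflection)
    show ?case
      unfolding eq
      using continuous_map_compose[OF IH(1) r] Brouwer_degree2_compose[OF IH(1) r] IH(2)
        Brouwer_degree2_reflection_coordinate[of m p] Suc.prems by simp
  qed
  from this[of "Suc p"] have "Brouwer_degree2 p (?a (Suc p)) = (-1) ^ Suc p" by simp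
  moreover have "Brouwer_degree2 p (\<lambda>x i. - x i) = Brouwer_degree2 p (?a (Suc p))"
    by (rule Brouwer_degree2_eq) (auto simp: nsphere_eq_top_of_set fun_eq_iff)
  ultimately show ?thesis by simp
qed

text \<open>If \<open>w\<close> had no zero, then turning each point by half a great circle in the direction of \<open>w\<close> would
  be a homotopy from the identity to the antipodal map. The degrees of these are \<open>1\<close> and \<open>(-1)\<^sup>n\<close>, which differ for odd \<open>n\<close>.\<close>

theorem hairy_ball:
  fixes w :: "'a::euclidean_space \<Rightarrow> 'a"
  assumes odd: "odd DIM('a)" and cont: "continuous_on (sphere 0 1) w"
    and tangent: "\<And>y. y \<in> sphere 0 1 \<Longrightarrow> w y \<bullet> y = 0"
  shows "\<exists>y\<in>sphere 0 1. w y = 0"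
proof (rule ccontr)
  assume "\<not> ?thesis"
  then have nz: "w y \<noteq> 0" if "y \<in> sphere 0 1" for y using that by blast
  define p where "p = DIM('a) - 1"
  have p: "DIM('a) = Suc p" by (simp add: p_def)
  obtain b where b: "bij_betw b {..p} (Basis :: 'a set)"
    using ex_bij_betw_nat_finite[of "Basis :: 'a set"] p
    by (auto simp: atLeast0LessThan lessThan_Suc_atMost)
  define f where "f = (\<lambda>x::nat \<Rightarrow> real. \<Sum>i\<le>p. x i *\<^sub>R b i)"
  define g where "g = (\<lambda>(y::'a) i. if i \<le> p then y \<bullet> b i else 0)"
  have bB: "b i \<in> Basis" if "i \<le> p" for i using b that by (auto simp: bij_betw_def)
  have bb: "b i \<bullet> b j = (if i = j then 1 else 0)" if "i \<le> p" "j \<le> p" for i j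
    using inner_Basis[OF bB bB] that b by (auto simp: bij_betw_def inj_on_def)
  have fb: "f x \<bullet> b j = x j" if "j \<le> p" for x j
    using that by (simp add: f_def inner_sum_left bb sum.delta if_distrib cong: if_cong)
  have normf: "f x \<bullet> f x = (\<Sum>i\<le>p. (x i)\<^sup>2)" for x
  proof -
    have "f x \<bullet> f x = (\<Sum>i\<le>p. x i * (f x \<bullet> b i))" by (subst (2) f_def) (simp add: inner_sum_right)
    then show ?thesis by (simp add: fb power2_eq_square)
  qed
  have normg: "(\<Sum>i\<le>p. (g y i)\<^sup>2) = y \<bullet> y" for y
    using sum.reindex_bij_betw[OF b, of "\<lambda>c. (y \<bullet> c) * (y \<bullet> c)"]
    by (subst euclidean_inner) (simp add: g_def power2_eq_square)
  have gf: "g (f x) = x" if "\<forall>i>p. x i = 0" for x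
    using that by (auto simp: g_def fb fun_eq_iff)
  define S where "S = {x. (\<Sum>i\<le>p. (x i)\<^sup>2) = (1::real) \<and> (\<forall>i>p. x i = 0)}"
  have nS: "nsphere p = top_of_set S" by (simp add: S_def nsphere_eq_top_of_set)
  have fN: "f x \<in> sphere 0 1" if "x \<in> S" for x
    using that normf[of x] by (simp add: S_def norm_eq_sqrt_inner)
  define u where "u = (\<lambda>y. w y /\<^sub>R norm (w y))"
  have u: "u y \<bullet> u y = 1" "u y \<bullet> y = 0" if "y \<in> sphere 0 1" for y
    using nz[OF that] tangent[OF that] by (auto simp: u_def dot_square_norm power2_eq_square divide_simps)
  define H where "H = (\<lambda>(t, x). g (cos (pi * t) *\<^sub>R f x + sin (pi * t) *\<^sub>R u (f x)))"
  have contf: "continuous_on A f" for A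
    unfolding f_def
    by (intro continuous_intros continuous_on_subset[OF continuous_on_product_coordinates]) auto
  have contu: "continuous_on (sphere 0 1) u"
    unfolding u_def using nz by (intro continuous_intros cont) auto
  have contH: "continuous_on ({0..1} \<times> S) H"
    unfolding H_def g_def case_prod_beta
  proof (intro continuous_on_coordinatewise_then_product)
    fix i
    show "continuous_on ({0..1} \<times> S) (\<lambda>x. if i \<le> p
         then (cos (pi * fst x) *\<^sub>R f (snd x) + sin (pi * fst x) *\<^sub>R u (f (snd x))) \<bullet> b i else 0)"
    proof (cases "i \<le> p")
      case True
      have 1: "continuous_on ({0..1::real} \<times> S) (\<lambda>x. f (snd x))"
        by (rule continuous_on_compose2[OF contf[of UNIV] continuous_on_snd[OF continuous_on_id]]) auto
      have 2: "continuous_on ({0..1::real} \<times> S) (\<lambda>x. u (f (snd x)))"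
        by (rule continuous_on_compose2[OF contu 1]) (use fN in auto)
      show ?thesis using True by (simp) (intro continuous_intros 1 2)
    qed simp
  qed
  have HN: "H (t, x) \<in> S" if x: "x \<in> S" for t x
  proof -
    let ?y = "f x"
    have y: "?y \<bullet> ?y = 1" using x normf[of x] by (simp add: S_def)
    have "(cos (pi * t) *\<^sub>R ?y + sin (pi * t) *\<^sub>R u ?y) \<bullet> (cos (pi * t) *\<^sub>R ?y + sin (pi * t) *\<^sub>R u ?y)
      = (cos (pi * t))\<^sup>2 + (sin (pi * t))\<^sup>2"
      using y u[OF fN[OF x]] by (simp add: inner_add inner_commute power2_eq_square)
    then show ?thesis by (simp add: S_def H_def normg) (simp add: g_def)
  qed
  have "homotopic_with (\<lambda>x. True) (nsphere p) (nsphere p) id (\<lambda>x i. - x i)"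
    unfolding homotopic_with_def
  \<comment> \<open>The definition of homotopy prescribes the end values at all points of the type, so \<open>H\<close> is
    redefined off the sphere.\<close>
  proof (rule exI[of _ "\<lambda>(t, x). if x \<in> S then H (t, x) else if t = 0 then x else (\<lambda>i. - x i)"], intro conjI allI ballI)
    let ?H = "\<lambda>(t, x). if x \<in> S then H (t, x) else if t = 0 then x else (\<lambda>i. - x i)"
    have "continuous_on ({0..1} \<times> S) ?H"
      by (rule continuous_on_eq[OF contH]) auto
    moreover have "?H ` ({0..1} \<times> S) \<subseteq> S" using HN by auto
    ultimately show "continuous_map (prod_topology (top_of_set {0..1}) (nsphere p)) (nsphere p) ?H"
      unfolding nS by (simp add: continuous_map_in_subtopology image_subset_iff_funcset)
    fix x
    show "?H (0, x) = id x" using gf by (auto simp: H_def S_def)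
    have "g (- f x) = (\<lambda>i. - x i)" if "x \<in> S"
      using gf[of x] that by (auto simp: g_def S_def fun_eq_iff fb)
    then show "?H (1, x) = (\<lambda>i. - x i)" by (auto simp: H_def)
  qed auto
  from Brouwer_degree2_homotopic[OF this] have "(1::int) = (-1) ^ Suc p"
    by (simp add: Brouwer_degree2_antipodal)
  then show False using odd p by simp
qed

section \<open>Euler--Lagrange expressions\<close>

lemma frechet_derivative_eqI: "(f has_derivative D) (at x) \<Longrightarrow> frechet_derivative f (at x) = D"
  using frechet_derivative_at by metis

lemma frechet_derivative_expand:
  assumes "open S" "smooth_on S f" "x \<in> S"
  shows "frechet_derivative f (at x) v = (\<Sum>b\<in>Basis. (v \<bullet> b) *\<^sub>R frechet_derivative f (at x) b)"
  by (rule linear_expand_Basis[OF smooth_on_linear_derivative[OF assms(2,3)]])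

lemma smooth_on_compose_fst:
  fixes h :: "'a::euclidean_space \<Rightarrow> 'b::euclidean_space"
  assumes U: "open U" and h: "smooth_on U h"
  shows "smooth_on (U \<times> (UNIV :: 'c::euclidean_space set)) (\<lambda>p. h (fst p))"
proof -
  have op: "open (U \<times> (UNIV :: 'c set))" using U by (intro open_Times) auto
  have "smooth_on (U \<times> (UNIV :: 'c set)) fst"
    using smooth_on_linear[OF op bounded_linear_fst smooth_on_id[OF op]] .
  then show ?thesis
    by (rule smooth_on_compose[OF op U _ _ h, rotated]) auto
qed

lemma smooth_on_derivative_pairing:
  fixes f :: "'a::euclidean_space \<Rightarrow> 'b::euclidean_space"
  assumes U: "open U" and f: "smooth_on U f"
  shows "smooth_on (U \<times> UNIV) (\<lambda>p. frechet_derivative f (at (fst p)) (snd p))"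
proof -
  have op: "open (U \<times> (UNIV :: 'a set))" using U by (intro open_Times) auto
  have "smooth_on (U \<times> UNIV) (\<lambda>p. \<Sum>b\<in>Basis. (snd p \<bullet> b) *\<^sub>R frechet_derivative f (at (fst p)) b)"
    by (intro smooth_on_sum[OF op] smooth_on_scaleR[OF op] smooth_on_compose_fst[OF U]
        smooth_on_frechet_derivative f smooth_on_linear[OF op bounded_linear_inner_left]
        smooth_on_linear[OF op bounded_linear_snd] smooth_on_id[OF op])
  then show ?thesis
    by (rule smooth_on_cong[OF op, THEN iffD1, rotated])
      (use frechet_derivative_expand[OF U f] in auto)
qed

text \<open>The derivative of \<open>(x, y) \<mapsto> Df(x)y\<close>. This map is the action of \<open>f\<close> on tangent vectors in
  coordinates, and it also describes derivatives of derivatives along curves.\<close>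

lemma has_derivative_derivative_pairing:
  fixes f :: "'a::euclidean_space \<Rightarrow> 'b::euclidean_space"
  assumes U: "open U" "x \<in> U" and f: "smooth_on U f"
  shows "((\<lambda>p. frechet_derivative f (at (fst p)) (snd p)) has_derivative
    (\<lambda>hk. frechet_derivative (\<lambda>z. frechet_derivative f (at z) y) (at x) (fst hk)
        + frechet_derivative f (at x) (snd hk))) (at (x, y))"
proof -
  let ?D = "\<lambda>x. frechet_derivative f (at x)"
  let ?DD = "\<lambda>b. frechet_derivative (\<lambda>z. ?D z b) (at x)"
  have db: "((\<lambda>z. ?D z b) has_derivative ?DD b) (at x)" for b
    by (rule smooth_on_has_derivative[OF smooth_on_frechet_derivative[OF f] U(2)])
  have "((\<lambda>z. \<Sum>b\<in>Basis. (y \<bullet> b) *\<^sub>R ?D z b) has_derivative (\<lambda>h. \<Sum>b\<in>Basis. (y \<bullet> b) *\<^sub>R ?DD b h)) (at x)"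
    by (intro has_derivative_sum has_derivative_scaleR_right db)
  then have "((\<lambda>z. ?D z y) has_derivative (\<lambda>h. \<Sum>b\<in>Basis. (y \<bullet> b) *\<^sub>R ?DD b h)) (at x)"
    by (rule has_derivative_transform_within_open[OF _ U])
      (use frechet_derivative_expand[OF U(1) f, of _ y] in auto)
  then have DDy: "?DD y h = (\<Sum>b\<in>Basis. (y \<bullet> b) *\<^sub>R ?DD b h)" for h
    by (simp add: frechet_derivative_eqI)
  have fstb: "((\<lambda>p. ?D (fst p) b) has_derivative (\<lambda>hk. ?DD b (fst hk))) (at (x, y))" for b
  proof -
    have 1: "(fst has_derivative fst) (at (x, y))" by (rule has_derivative_fst[OF has_derivative_ident])
    have 2: "((\<lambda>z. ?D z b) has_derivative ?DD b) (at (fst (x, y)))" using db by simp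
    show ?thesis using diff_chain_at[OF 1 2] by (simp add: o_def)
  qed
  have "((\<lambda>p. \<Sum>b\<in>Basis. (snd p \<bullet> b) *\<^sub>R ?D (fst p) b) has_derivative
     (\<lambda>hk. \<Sum>b\<in>Basis. (y \<bullet> b) *\<^sub>R ?DD b (fst hk) + (snd hk \<bullet> b) *\<^sub>R ?D x b)) (at (x, y))"
    by (rule has_derivative_eq_rhs, (rule has_derivative_sum has_derivative_scaleR
        has_derivative_inner_left has_derivative_snd has_derivative_ident fstb)+) simp
  moreover have "(\<Sum>b\<in>Basis. (y \<bullet> b) *\<^sub>R ?DD b (fst hk) + (snd hk \<bullet> b) *\<^sub>R ?D x b) =
      ?DD y (fst hk) + ?D x (snd hk)" for hk
    using frechet_derivative_expand[OF U(1) f U(2), of "snd hk"] by (simp add: sum.distrib DDy)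
  ultimately have "((\<lambda>p. \<Sum>b\<in>Basis. (snd p \<bullet> b) *\<^sub>R ?D (fst p) b) has_derivative
     (\<lambda>hk. ?DD y (fst hk) + ?D x (snd hk))) (at (x, y))" by simp
  then show ?thesis
    by (rule has_derivative_transform_within_open[where s = "U \<times> UNIV"])
      (use U frechet_derivative_expand[OF U(1) f] in \<open>auto intro: open_Times\<close>)
qed

text \<open>The value on the vector \<open>w\<close> of the covector \<open>d/dt (\<partial>E/\<partial>y) - \<partial>E/\<partial>x\<close>, for a curve through \<open>x\<close> with
  velocity \<open>y\<close> and acceleration \<open>a\<close>; a point of the tangent bundle is a pair of position and velocity.\<close>

definition euler_lagrange :: "('a::euclidean_space \<times> 'a \<Rightarrow> real) \<Rightarrow> 'a \<Rightarrow> 'a \<Rightarrow> 'a \<Rightarrow> 'a \<Rightarrow> real" where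
  "euler_lagrange E w x y a =
     frechet_derivative (\<lambda>p. frechet_derivative E (at p) (0, w)) (at (x, y)) (y, a)
     - frechet_derivative E (at (x, y)) (w, 0)"

lemma frechet_derivative_split:
  assumes "smooth_on S E" "p \<in> S"
  shows "frechet_derivative E (at p) (u, v) = frechet_derivative E (at p) (u, 0) + frechet_derivative E (at p) (0, v)"
  using linear_add[OF smooth_on_linear_derivative[OF assms], of "(u, 0)" "(0, v)"] by simp

text \<open>Differentiating \<open>E = E' \<circ> Tf\<close> produces, next to the transformed expression, the terms
  \<open>E'\<^sub>y \<cdot> D\<^sup>2f(y, w)\<close> from \<open>d/dt E\<^sub>y\<close> and \<open>E'\<^sub>y \<cdot> D\<^sup>2f(w, y)\<close> from \<open>E\<^sub>x\<close>. They cancel by the symmetry of the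
  second derivative. The acceleration transforms in the way that of a curve does.\<close>

lemma euler_lagrange_covariant:
  fixes E E' :: "'a::euclidean_space \<times> 'a \<Rightarrow> real" and f :: "'a \<Rightarrow> 'a"
  assumes \<Omega>: "open \<Omega>" "smooth_on \<Omega> E" and \<Omega>': "open \<Omega>'" "smooth_on \<Omega>' E'"
    and U: "open U" "smooth_on U f" and \<Omega>U: "fst ` \<Omega> \<subseteq> U"
    and map: "\<And>x y. (x, y) \<in> \<Omega> \<Longrightarrow> (f x, frechet_derivative f (at x) y) \<in> \<Omega>'"
    and inv: "\<And>x y. (x, y) \<in> \<Omega> \<Longrightarrow> E' (f x, frechet_derivative f (at x) y) = E (x, y)"
    and xy: "(x, y) \<in> \<Omega>"
  shows "euler_lagrange E' (frechet_derivative f (at x) w) (f x) (frechet_derivative f (at x) y)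
      (frechet_derivative (\<lambda>z. frechet_derivative f (at z) y) (at x) y + frechet_derivative f (at x) a)
    = euler_lagrange E w x y a"
proof -
  let ?D = "\<lambda>x. frechet_derivative f (at x)"
  let ?DD = "\<lambda>x u. frechet_derivative (\<lambda>z. ?D z u) (at x)"
  let ?\<Phi> = "\<lambda>p. (f (fst p), ?D (fst p) (snd p))"
  let ?DE = "\<lambda>p. frechet_derivative E (at p)" and ?DE' = "\<lambda>p. frechet_derivative E' (at p)"
  have xU: "fst p \<in> U" if "p \<in> \<Omega>" for p using that \<Omega>U by auto
  have ff: "((\<lambda>p. f (fst p)) has_derivative (\<lambda>hk. ?D (fst p) (fst hk))) (at p)" if "p \<in> \<Omega>" for p
  proof -
    have 1: "(fst has_derivative fst) (at p)" by (rule has_derivative_fst[OF has_derivative_ident])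
    show ?thesis using diff_chain_at[OF 1 smooth_on_has_derivative[OF U(2) xU[OF that]]] by (simp add: o_def)
  qed
  have d\<Phi>: "(?\<Phi> has_derivative (\<lambda>hk. (?D (fst p) (fst hk), ?DD (fst p) (snd p) (fst hk) + ?D (fst p) (snd hk)))) (at p)"
    if "p \<in> \<Omega>" for p
    using has_derivative_Pair[OF ff[OF that] has_derivative_derivative_pairing[OF U(1) xU[OF that] U(2),
        of "snd p", unfolded prod.collapse]] .
  have \<Phi>\<Omega>: "?\<Phi> p \<in> \<Omega>'" if "p \<in> \<Omega>" for p using map[of "fst p" "snd p"] that by simp
  have dE: "?DE p (h, k) = ?DE' (?\<Phi> p) (?D (fst p) h, ?DD (fst p) (snd p) h + ?D (fst p) k)" if p: "p \<in> \<Omega>" for p h k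
  proof -
    have "((\<lambda>p. E' (?\<Phi> p)) has_derivative (\<lambda>hk. ?DE' (?\<Phi> p) (?D (fst p) (fst hk), ?DD (fst p) (snd p) (fst hk) + ?D (fst p) (snd hk)))) (at p)"
      using diff_chain_at[OF d\<Phi>[OF p] smooth_on_has_derivative[OF \<Omega>'(2) \<Phi>\<Omega>[OF p]]] by (simp add: o_def)
    then have "(E has_derivative (\<lambda>hk. ?DE' (?\<Phi> p) (?D (fst p) (fst hk), ?DD (fst p) (snd p) (fst hk) + ?D (fst p) (snd hk)))) (at p)"
      by (rule has_derivative_transform_within_open[OF _ \<Omega>(1) p]) (use inv in auto)
    then show ?thesis by (simp add: frechet_derivative_eqI)
  qed
  have lin0: "?D u 0 = 0" "?DD u v 0 = 0" if "u \<in> U" for u v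
    using linear_0[OF smooth_on_linear_derivative[OF U(2) that]]
      linear_0[OF smooth_on_linear_derivative[OF smooth_on_frechet_derivative[OF U(2)] that]] by auto
  let ?p = "(x, y)"
  let ?q = "?\<Phi> ?p"
  have x: "x \<in> U" using xU[OF xy] by simp
  have q: "?q \<in> \<Omega>'" using \<Phi>\<Omega>[OF xy] .
  have e: "((\<lambda>p. ?DE' (?\<Phi> p) (0, ?D (fst p) w)) has_derivative
      (\<lambda>hk. frechet_derivative (\<lambda>z. ?DE' z (0, ?D x w)) (at ?q) (?D x (fst hk), ?DD x y (fst hk) + ?D x (snd hk))
         + ?DE' ?q (0, ?DD x w (fst hk)))) (at ?p)"
  proof -
    have 1: "((\<lambda>p. ?D (fst p) w) has_derivative (\<lambda>hk. ?DD x w (fst hk))) (at ?p)"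
    proof -
      have "(fst has_derivative fst) (at ?p)" by (rule has_derivative_fst[OF has_derivative_ident])
      moreover have "((\<lambda>z. ?D z w) has_derivative ?DD x w) (at (fst ?p))"
        using smooth_on_has_derivative[OF smooth_on_frechet_derivative[OF U(2)] x] by simp
      ultimately show ?thesis using diff_chain_at[of fst fst ?p "\<lambda>z. ?D z w" "?DD x w"] by (simp add: o_def)
    qed
    have 2: "((\<lambda>p. (?\<Phi> p, (0::'a, ?D (fst p) w))) has_derivative
       (\<lambda>hk. ((?D x (fst hk), ?DD x y (fst hk) + ?D x (snd hk)), (0, ?DD x w (fst hk))))) (at ?p)"
      using has_derivative_Pair[OF d\<Phi>[OF xy] has_derivative_Pair[OF has_derivative_const 1]] by simp
    have 3: "((\<lambda>p. ?DE' (fst p) (snd p)) has_derivative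
       (\<lambda>hk. frechet_derivative (\<lambda>z. ?DE' z (0, ?D x w)) (at ?q) (fst hk) + ?DE' ?q (snd hk)))
       (at ((\<lambda>p. (?\<Phi> p, (0::'a, ?D (fst p) w))) ?p))"
      using has_derivative_derivative_pairing[OF \<Omega>'(1) q \<Omega>'(2), of "(0, ?D x w)"] by simp
    from diff_chain_at[OF 2 3] show ?thesis by (simp add: o_def)
  qed
  have "((\<lambda>p. ?DE p (0, w)) has_derivative
      (\<lambda>hk. frechet_derivative (\<lambda>z. ?DE' z (0, ?D x w)) (at ?q) (?D x (fst hk), ?DD x y (fst hk) + ?D x (snd hk))
         + ?DE' ?q (0, ?DD x w (fst hk)))) (at ?p)"
    by (rule has_derivative_transform_within_open[OF e \<Omega>(1) xy]) (simp add: dE lin0 xU)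
  then have 1: "frechet_derivative (\<lambda>p. ?DE p (0, w)) (at ?p) (y, a) =
     frechet_derivative (\<lambda>z. ?DE' z (0, ?D x w)) (at ?q) (?D x y, ?DD x y y + ?D x a) + ?DE' ?q (0, ?DD x w y)"
    by (simp add: frechet_derivative_eqI)
  have 2: "?DE ?p (w, 0) = ?DE' ?q (?D x w, 0) + ?DE' ?q (0, ?DD x y w)"
    using dE[OF xy, of w 0] frechet_derivative_split[OF \<Omega>'(2) q, of "?D x w" "?DD x y w"]
    by (simp only: lin0(1)[OF x] fst_conv snd_conv add_0_right)
  have "?DD x w y = ?DD x y w" by (rule smooth_on_derivative_symmetric[OF U(1) x U(2)])
  then show ?thesis using 1 2 by (simp add: euler_lagrange_def)
qed

lemma frechet_derivative_slice:
  fixes f :: "'a::euclidean_space \<times> 'b::euclidean_space \<Rightarrow> 'c::euclidean_space"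
  assumes "open \<Omega>" "smooth_on \<Omega> f" "(x, y) \<in> \<Omega>"
  shows "frechet_derivative (\<lambda>y. f (x, y)) (at y) v = frechet_derivative f (at (x, y)) (0, v)"
    and "frechet_derivative (\<lambda>x. f (x, y)) (at x) u = frechet_derivative f (at (x, y)) (u, 0)"
proof -
  note d = smooth_on_has_derivative[OF assms(2,3)]
  have "((\<lambda>y. (x, y)) has_derivative (\<lambda>v. (0, v))) (at y)" "((\<lambda>x. (x, y)) has_derivative (\<lambda>u. (u, 0))) (at x)"
    by (auto intro!: derivative_eq_intros)
  from diff_chain_at[OF this(1) d] diff_chain_at[OF this(2) d]
  have "((\<lambda>y. f (x, y)) has_derivative (\<lambda>v. frechet_derivative f (at (x, y)) (0, v))) (at y)"
    "((\<lambda>x. f (x, y)) has_derivative (\<lambda>u. frechet_derivative f (at (x, y)) (u, 0))) (at x)"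
    by (simp_all add: o_def)
  then show "frechet_derivative (\<lambda>y. f (x, y)) (at y) v = frechet_derivative f (at (x, y)) (0, v)"
    "frechet_derivative (\<lambda>x. f (x, y)) (at x) u = frechet_derivative f (at (x, y)) (u, 0)"
    by (simp_all add: frechet_derivative_eqI)
qed

section \<open>Finsler metrics in coordinates\<close>

lemma sum_swap_pairs:
  fixes f :: "'i \<Rightarrow> 'j \<Rightarrow> 'k \<Rightarrow> 'l \<Rightarrow> 'a::comm_monoid_add"
  shows "(\<Sum>j\<in>A. \<Sum>k\<in>B. \<Sum>i\<in>C. \<Sum>s\<in>D. f j k i s) = (\<Sum>i\<in>C. \<Sum>s\<in>D. \<Sum>j\<in>A. \<Sum>k\<in>B. f j k i s)"
proof -
  have "(\<Sum>j\<in>A. \<Sum>k\<in>B. \<Sum>i\<in>C. \<Sum>s\<in>D. f j k i s) = (\<Sum>j\<in>A. \<Sum>i\<in>C. \<Sum>k\<in>B. \<Sum>s\<in>D. f j k i s)"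
    by (rule sum.cong[OF refl], rule sum.swap)
  also have "\<dots> = (\<Sum>j\<in>A. \<Sum>i\<in>C. \<Sum>s\<in>D. \<Sum>k\<in>B. f j k i s)"
    by (rule sum.cong[OF refl], rule sum.cong[OF refl], rule sum.swap)
  also have "\<dots> = (\<Sum>i\<in>C. \<Sum>j\<in>A. \<Sum>s\<in>D. \<Sum>k\<in>B. f j k i s)"
    by (rule sum.swap)
  also have "\<dots> = (\<Sum>i\<in>C. \<Sum>s\<in>D. \<Sum>j\<in>A. \<Sum>k\<in>B. f j k i s)"
    by (rule sum.cong[OF refl], rule sum.swap)
  finally show ?thesis .
qed

lemma linear_Pair_0: "linear (\<lambda>w. (0, w))" "linear (\<lambda>w. (w, 0))"
  by (auto intro!: linearI)

text \<open>A Finsler metric in the coordinates of a chart with image \<open>S\<close>.\<close>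

locale local_finsler =
  fixes S :: "(real^'n::finite) set" and L :: "'n lmetric"
  assumes open_S: "open S"
    and smooth_L: "smooth_on (S \<times> (UNIV - {0})) (\<lambda>(x, y). L x y)"
    and minkowski: "\<And>x. x \<in> S \<Longrightarrow> minkowski_norm (L x)"
begin

definition \<Omega> :: "((real^'n) \<times> (real^'n)) set" where "\<Omega> = S \<times> (UNIV - {0})"

definition E :: "(real^'n) \<times> (real^'n) \<Rightarrow> real" where "E p = (1/2) * (L (fst p) (snd p))\<^sup>2"

abbreviation dE :: "real^'n \<Rightarrow> (real^'n) \<times> (real^'n) \<Rightarrow> real" where
  "dE w \<equiv> \<lambda>p. frechet_derivative E (at p) (0, w)"

abbreviation ddE :: "real^'n \<Rightarrow> real^'n \<Rightarrow> (real^'n) \<times> (real^'n) \<Rightarrow> real" where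
  "ddE v w \<equiv> \<lambda>p. frechet_derivative (dE v) (at p) (0, w)"

abbreviation dddE :: "real^'n \<Rightarrow> real^'n \<Rightarrow> real^'n \<Rightarrow> (real^'n) \<times> (real^'n) \<Rightarrow> real" where
  "dddE u v w \<equiv> \<lambda>p. frechet_derivative (ddE u v) (at p) (0, w)"

lemma open_\<Omega>: "open \<Omega>"
  unfolding \<Omega>_def using open_S by (intro open_Times) auto

lemma in_\<Omega> [simp]: "(x, y) \<in> \<Omega> \<longleftrightarrow> x \<in> S \<and> y \<noteq> 0"
  by (auto simp: \<Omega>_def)

lemma smooth_E: "smooth_on \<Omega> E"
proof -
  have L: "smooth_on \<Omega> (\<lambda>p. L (fst p) (snd p))" using smooth_L by (simp add: \<Omega>_def split_def)
  show ?thesis unfolding E_def power2_eq_square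
    by (intro smooth_on_mult[OF open_\<Omega>] smooth_on_const open_\<Omega> L)
qed

lemma smooth_dE: "smooth_on \<Omega> (dE v)" and smooth_ddE: "smooth_on \<Omega> (ddE v w)"
  by (intro smooth_on_frechet_derivative smooth_E)+

lemma linear_expand_axis:
  assumes "linear (h :: real^'n \<Rightarrow> real)"
  shows "h w = (\<Sum>i\<in>UNIV. w $ i * h (axis i 1))"
proof -
  have "h w = h (\<Sum>i\<in>UNIV. w $ i *\<^sub>R axis i 1)" by (simp add: basis_expansion scalar_mult_eq_scaleR[symmetric])
  then show ?thesis by (simp add: linear_sum[OF assms] linear_scale[OF assms])
qed

lemma expand_snd:
  assumes "smooth_on \<Omega> f" "p \<in> \<Omega>"
  shows "frechet_derivative f (at p) (0, w) = (\<Sum>i\<in>UNIV. w $ i * frechet_derivative f (at p) (0, axis i 1))"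
proof (rule linear_expand_axis)
  show "linear (\<lambda>w. frechet_derivative f (at p) (0, w))"
    using linear_compose[OF linear_Pair_0(1) smooth_on_linear_derivative[OF assms]] by (simp add: o_def)
qed

lemma expand_fst:
  assumes "smooth_on \<Omega> f" "p \<in> \<Omega>"
  shows "frechet_derivative f (at p) (w, 0) = (\<Sum>i\<in>UNIV. w $ i * frechet_derivative f (at p) (axis i 1, 0))"
proof (rule linear_expand_axis)
  show "linear (\<lambda>w. frechet_derivative f (at p) (w, 0))"
    using linear_compose[OF linear_Pair_0(2) smooth_on_linear_derivative[OF assms]] by (simp add: o_def)
qed

definition homogeneous :: "nat \<Rightarrow> ((real^'n) \<times> (real^'n) \<Rightarrow> real) \<Rightarrow> bool" where
  "homogeneous m f \<longleftrightarrow> (\<forall>x y r. (x, y) \<in> \<Omega> \<longrightarrow> r > 0 \<longrightarrow> f (x, r *\<^sub>R y) = r ^ m * f (x, y))"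

lemma homogeneous_E: "homogeneous 2 E"
  using minkowski by (auto simp: homogeneous_def E_def minkowski_norm_def power_mult_distrib)

lemma homogeneous_derivative:
  assumes f: "smooth_on \<Omega> f" and h: "homogeneous (Suc m) f"
  shows "homogeneous m (\<lambda>p. frechet_derivative f (at p) (0, w))"
  unfolding homogeneous_def
proof (intro allI impI)
  fix x y and r :: real assume xy: "(x, y) \<in> \<Omega>" and r: "r > 0"
  have rxy: "(x, r *\<^sub>R y) \<in> \<Omega>" using xy r by simp
  have "((\<lambda>y. (x, r *\<^sub>R y)) has_derivative (\<lambda>v. (0, r *\<^sub>R v))) (at y)"
    by (auto intro!: derivative_eq_intros)
  from diff_chain_at[OF this smooth_on_has_derivative[OF f rxy]]
  have "((\<lambda>y. f (x, r *\<^sub>R y)) has_derivative (\<lambda>v. frechet_derivative f (at (x, r *\<^sub>R y)) (0, r *\<^sub>R v))) (at y)"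
    by (simp add: o_def)
  moreover have "((\<lambda>y. (x, y)) has_derivative (\<lambda>v. (0, v))) (at y)" by (auto intro!: derivative_eq_intros)
  from diff_chain_at[OF this smooth_on_has_derivative[OF f xy]]
  have "((\<lambda>y. f (x, y)) has_derivative (\<lambda>v. frechet_derivative f (at (x, y)) (0, v))) (at y)"
    by (simp add: o_def)
  from has_derivative_mult_right[OF this, of "r ^ Suc m"]
  have "((\<lambda>y. f (x, r *\<^sub>R y)) has_derivative (\<lambda>v. r ^ Suc m * frechet_derivative f (at (x, y)) (0, v))) (at y)"
    by (rule has_derivative_transform_within_open[where s = "UNIV - {0}"])
      (use xy r h in \<open>auto simp: homogeneous_def\<close>)
  ultimately have "frechet_derivative f (at (x, r *\<^sub>R y)) (0, r *\<^sub>R w) = r ^ Suc m * frechet_derivative f (at (x, y)) (0, w)"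
    using has_derivative_unique by (metis (no_types, lifting))
  moreover have "frechet_derivative f (at (x, r *\<^sub>R y)) (0, r *\<^sub>R w) = r * frechet_derivative f (at (x, r *\<^sub>R y)) (0, w)"
    using linear_scale[OF smooth_on_linear_derivative[OF f rxy], of r "(0, w)"] by simp
  ultimately show "frechet_derivative f (at (x, r *\<^sub>R y)) (0, w) = r ^ m * frechet_derivative f (at (x, y)) (0, w)"
    using r by simp
qed

text \<open>Euler's identity, from differentiating \<open>f(x, ry) = r\<^sup>m f(x, y)\<close> in \<open>r\<close> at \<open>1\<close>.\<close>

lemma euler_homogeneous:
  assumes f: "smooth_on \<Omega> f" and h: "homogeneous m f" and xy: "(x, y) \<in> \<Omega>"
  shows "frechet_derivative f (at (x, y)) (0, y) = m * f (x, y)"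
proof -
  have "((\<lambda>r::real. (x, r *\<^sub>R y)) has_derivative (\<lambda>k. (0, k *\<^sub>R y))) (at 1)"
    by (auto intro!: derivative_eq_intros)
  moreover have "(f has_derivative frechet_derivative f (at (x, y))) (at (x, 1 *\<^sub>R y))"
    using smooth_on_has_derivative[OF f xy] by simp
  ultimately have "((\<lambda>r::real. f (x, r *\<^sub>R y)) has_derivative (\<lambda>k. frechet_derivative f (at (x, y)) (0, k *\<^sub>R y))) (at 1)"
    using diff_chain_at[of "\<lambda>r::real. (x, r *\<^sub>R y)"] by (fastforce simp: o_def)
  moreover have "((\<lambda>r::real. r ^ m * f (x, y)) has_derivative (\<lambda>k. k * (m * f (x, y)))) (at 1)"
    by (auto intro!: derivative_eq_intros)
  then have "((\<lambda>r::real. f (x, r *\<^sub>R y)) has_derivative (\<lambda>k. k * (m * f (x, y)))) (at 1)"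
    by (rule has_derivative_transform_within_open[where s = "{0<..}"])
      (use xy h in \<open>auto simp: homogeneous_def\<close>)
  ultimately have "(\<lambda>k. frechet_derivative f (at (x, y)) (0, k *\<^sub>R y)) = (\<lambda>k. k * (m * f (x, y)))"
    using has_derivative_unique by blast
  from fun_cong[OF this, of 1] show ?thesis by simp
qed

lemma homogeneous_dE: "homogeneous 1 (dE v)" and homogeneous_ddE: "homogeneous 0 (ddE v w)"
  using homogeneous_derivative[OF smooth_E, of 1] homogeneous_E
    homogeneous_derivative[OF smooth_dE, of 0] by (auto simp: numeral_2_eq_2)

lemma euler_E: "(x, y) \<in> \<Omega> \<Longrightarrow> dE y (x, y) = 2 * E (x, y)"
  and euler_dE: "(x, y) \<in> \<Omega> \<Longrightarrow> ddE v y (x, y) = dE v (x, y)"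
  and euler_ddE: "(x, y) \<in> \<Omega> \<Longrightarrow> dddE v w y (x, y) = 0"
  using euler_homogeneous[OF smooth_E homogeneous_E] euler_homogeneous[OF smooth_dE homogeneous_dE]
    euler_homogeneous[OF smooth_ddE homogeneous_ddE] by simp_all

lemma ddE_sym: "p \<in> \<Omega> \<Longrightarrow> ddE v w p = ddE w v p"
  by (rule smooth_on_derivative_symmetric[OF open_\<Omega> _ smooth_E])

lemma dddE_sym:
  assumes "p \<in> \<Omega>"
  shows "dddE u v w p = dddE u w v p" "dddE u v w p = dddE v u w p"
proof -
  show "dddE u v w p = dddE u w v p"
    by (rule smooth_on_derivative_symmetric[OF open_\<Omega> assms smooth_dE])
  have "frechet_derivative (ddE u v) (at p) = frechet_derivative (ddE v u) (at p)"
    by (rule frechet_derivative_cong_open[OF open_\<Omega> assms ddE_sym])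
  then show "dddE u v w p = dddE v u w p" by simp
qed

lemma partial_half_sq:
  assumes "x \<in> S" "y \<noteq> 0"
  shows "partial i (\<lambda>y. (1/2) * (L x y)\<^sup>2) y = dE (axis i 1) (x, y)"
  using frechet_derivative_slice(1)[OF open_\<Omega> smooth_E, of x y "axis i 1"] assms
  by (simp add: partial_def E_def)

lemma partial_slice_snd:
  assumes f: "smooth_on \<Omega> f" and eq: "\<And>z. z \<noteq> 0 \<Longrightarrow> h z = f (x, z)" and xy: "x \<in> S" "y \<noteq> 0"
  shows "partial i h y = frechet_derivative f (at (x, y)) (0, axis i 1)"
proof -
  have "frechet_derivative h (at y) = frechet_derivative (\<lambda>z. f (x, z)) (at y)"
    by (rule frechet_derivative_cong_open[where S = "UNIV - {0}"]) (use eq xy in auto)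
  then show ?thesis
    using frechet_derivative_slice(1)[OF open_\<Omega> f, of x y "axis i 1"] xy by (simp add: partial_def)
qed

lemma partial_slice_fst:
  assumes f: "smooth_on \<Omega> f" and eq: "\<And>z. z \<in> S \<Longrightarrow> h z = f (z, y)" and xy: "x \<in> S" "y \<noteq> 0"
  shows "partial i h x = frechet_derivative f (at (x, y)) (axis i 1, 0)"
proof -
  have "frechet_derivative h (at x) = frechet_derivative (\<lambda>z. f (z, y)) (at x)"
    by (rule frechet_derivative_cong_open[OF open_S]) (use eq xy in auto)
  then show ?thesis
    using frechet_derivative_slice(2)[OF open_\<Omega> f, of x y "axis i 1"] xy by (simp add: partial_def)
qed

lemma hessian_eq:
  assumes "x \<in> S" "y \<noteq> 0"
  shows "hessian_half_sq (L x) y $ i $ j = ddE (axis i 1) (axis j 1) (x, y)"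
  using partial_slice_snd[OF smooth_dE partial_half_sq[OF assms(1)] assms, of j i]
  by (simp add: hessian_half_sq_def)

lemma cartan_eq:
  assumes "x \<in> S" "y \<noteq> 0"
  shows "cartan L i j k x y = 1/2 * dddE (axis i 1) (axis j 1) (axis k 1) (x, y)"
proof -
  have smooth: "smooth_on \<Omega> (\<lambda>p. c * f p)" if "smooth_on \<Omega> f" for f :: "(real^'n) \<times> (real^'n) \<Rightarrow> real" and c
    by (rule smooth_on_mult[OF open_\<Omega> smooth_on_const[OF open_\<Omega>] that])
  have scale: "frechet_derivative (\<lambda>p. c * f p) (at p) v = c * frechet_derivative f (at p) v"
    if "smooth_on \<Omega> f" "p \<in> \<Omega>" for f :: "(real^'n) \<times> (real^'n) \<Rightarrow> real" and v c p
    using frechet_derivative_eqI[OF has_derivative_mult_right[OF smooth_on_has_derivative[OF that]]] by simp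
  have 0: "(1/4) * (L x z)\<^sup>2 = 1/2 * E (x, z)" for z by (simp add: E_def)
  have 1: "partial i (\<lambda>y. (1/4) * (L x y)\<^sup>2) z = 1/2 * dE (axis i 1) (x, z)" if "z \<noteq> 0" for z
    using trans[OF partial_slice_snd[OF smooth[OF smooth_E] 0 assms(1) that] scale[OF smooth_E]] that assms
    by simp
  have 2: "partial j (partial i (\<lambda>y. (1/4) * (L x y)\<^sup>2)) z = 1/2 * ddE (axis i 1) (axis j 1) (x, z)" if "z \<noteq> 0" for z
    using trans[OF partial_slice_snd[OF smooth[OF smooth_dE] 1 assms(1) that] scale[OF smooth_dE]] that assms
    by simp
  show ?thesis
    using trans[OF partial_slice_snd[OF smooth[OF smooth_ddE] 2 assms] scale[OF smooth_ddE]] assms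
    by (simp add: cartan_def)
qed

lemma hessian_mult_vec:
  assumes "x \<in> S" "y \<noteq> 0"
  shows "(hessian_half_sq (L x) y *v w) $ i = ddE (axis i 1) w (x, y)"
  using assms expand_snd[OF smooth_dE, of "(x, y)" "axis i 1" w]
  by (simp add: matrix_vector_mult_def hessian_eq mult.commute)

text \<open>The square of the metric is the value of its fundamental tensor, which is positive definite:
  \<open>g\<^sub>i\<^sub>j y\<^sup>i y\<^sup>j = F\<^sup>2\<close> by Euler's identity.\<close>

lemma metric_pos:
  assumes "x \<in> S" "y \<noteq> 0"
  shows "L x y > 0"
proof -
  have "0 < y \<bullet> (hessian_half_sq (L x) y *v y)"
    using minkowski[OF assms(1)] assms by (auto simp: minkowski_norm_def)
  also have "\<dots> = (\<Sum>i\<in>UNIV. y $ i * dE (axis i 1) (x, y))"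
    using assms by (simp add: inner_vec_def hessian_mult_vec euler_dE)
  also have "\<dots> = (L x y)\<^sup>2"
    using expand_snd[OF smooth_E, of "(x, y)" y] euler_E[of x y] assms by (simp add: E_def)
  finally have "L x y \<noteq> 0" by auto
  then show ?thesis using minkowski[OF assms(1)] by (auto simp: minkowski_norm_def less_le)
qed

lemma hessian_invertible:
  assumes "x \<in> S" "y \<noteq> 0"
  shows "invertible (hessian_half_sq (L x) y)"
proof -
  have "w = 0" if "hessian_half_sq (L x) y *v w = 0" for w
  proof (rule ccontr)
    assume "w \<noteq> 0"
    then have "0 < w \<bullet> (hessian_half_sq (L x) y *v w)"
      using minkowski[OF assms(1)] assms by (auto simp: minkowski_norm_def)
    then show False using that by simp
  qed
  then show ?thesis
    by (simp add: invertible_left_inverse matrix_left_invertible_ker)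
qed

lemma gf_inv_right:
  assumes "x \<in> S" "y \<noteq> 0"
  shows "(\<Sum>i\<in>UNIV. ddE (axis l 1) (axis i 1) (x, y) * gf_inv L i s x y) = (if l = s then 1 else 0)"
proof -
  have "(hessian_half_sq (L x) y ** matrix_inv (hessian_half_sq (L x) y)) $ l $ s = (mat 1 :: real^'n^'n) $ l $ s"
    using someI_ex[OF hessian_invertible[OF assms, unfolded invertible_def]] by (simp add: matrix_inv_def)
  then show ?thesis
    using assms by (simp add: matrix_matrix_mult_def mat_def gf_inv_def hessian_eq)
qed

text \<open>By Euler's identity the contractions with \<open>y\<close> of \<open>\<partial>\<^sub>k g\<^sub>s\<^sub>j\<close> and \<open>\<partial>\<^sub>s g\<^sub>j\<^sub>k\<close> can be carried out under the
  derivative in \<open>x\<close>, where \<open>g\<^sub>s\<^sub>j y\<^sup>j = E\<^bsub>y\<^sup>s\<^esub>\<close> and \<open>g\<^sub>j\<^sub>k y\<^sup>j y\<^sup>k = 2E\<close>. This leaves the spray of \<open>E\<close>.\<close>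

lemma gam_contract:
  assumes "x \<in> S" "y \<noteq> 0"
  shows "(\<Sum>j\<in>UNIV. \<Sum>k\<in>UNIV. y $ j * y $ k * gam L i j k x y) =
    (\<Sum>s\<in>UNIV. gf_inv L i s x y *
      (frechet_derivative (dE (axis s 1)) (at (x, y)) (y, 0) - frechet_derivative E (at (x, y)) (axis s 1, 0)))"
proof -
  let ?p = "(x, y)" and ?e = "\<lambda>i. axis i 1 :: real^'n"
  have p: "?p \<in> \<Omega>" using assms by simp
  let ?dx = "\<lambda>k f. frechet_derivative f (at ?p) (?e k, 0)"
  have pg: "partial k (\<lambda>x. gf L a b x y) x = ?dx k (ddE (?e a) (?e b))" for a b k
    by (rule partial_slice_fst[OF smooth_ddE]) (use assms in \<open>auto simp: gf_def hessian_eq\<close>)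
  have along: "(\<Sum>j\<in>UNIV. y $ j * ?dx k (F j)) = ?dx k f"
    if F: "\<And>j. smooth_on \<Omega> (F j)" and eq: "\<And>z. z \<in> S \<Longrightarrow> (\<Sum>j\<in>UNIV. y $ j * F j (z, y)) = f (z, y)"
      and f: "smooth_on \<Omega> f" for F f k
  proof -
    have "((\<lambda>z. \<Sum>j\<in>UNIV. y $ j * F j (z, y)) has_derivative
        (\<lambda>h. \<Sum>j\<in>UNIV. y $ j * frechet_derivative (F j) (at ?p) (h, 0))) (at x)"
    proof (intro has_derivative_sum has_derivative_mult_right)
      fix j
      have "((\<lambda>z. (z, y)) has_derivative (\<lambda>h. (h, 0))) (at x)" by (auto intro!: derivative_eq_intros)
      from diff_chain_at[OF this smooth_on_has_derivative[OF F p]]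
      show "((\<lambda>z. F j (z, y)) has_derivative (\<lambda>h. frechet_derivative (F j) (at ?p) (h, 0))) (at x)"
        by (simp add: o_def)
    qed
    then have "((\<lambda>z. f (z, y)) has_derivative
        (\<lambda>h. \<Sum>j\<in>UNIV. y $ j * frechet_derivative (F j) (at ?p) (h, 0))) (at x)"
      by (rule has_derivative_transform_within_open[OF _ open_S assms(1)]) (use eq in auto)
    then show ?thesis
      using frechet_derivative_slice(2)[OF open_\<Omega> f p, of "?e k"] by (simp add: frechet_derivative_eqI)
  qed
  have row: "(\<Sum>j\<in>UNIV. y $ j * ?dx k (ddE (?e s) (?e j))) = ?dx k (dE (?e s))" for k s
    by (rule along[OF smooth_ddE _ smooth_dE])
      (use expand_snd[OF smooth_dE, of "(_, y)" "?e s" y] euler_dE assms in auto)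
  have sym: "?dx k (ddE (?e a) (?e b)) = ?dx k (ddE (?e b) (?e a))" for k a b
    using frechet_derivative_cong_open[OF open_\<Omega> p, of "ddE (?e a) (?e b)" "ddE (?e b) (?e a)"] ddE_sym by auto
  have row': "(\<Sum>j\<in>UNIV. y $ j * ?dx k (ddE (?e j) (?e s))) = ?dx k (dE (?e s))" for k s
    unfolding row[symmetric] by (intro sum.cong refl arg_cong2[where f = "(*)"] sym)
  have quad: "(\<Sum>j\<in>UNIV. y $ j * ?dx s (dE (?e j))) = 2 * ?dx s E" for s
  proof -
    have "(\<Sum>j\<in>UNIV. y $ j * ?dx s (dE (?e j))) = ?dx s (\<lambda>p. 2 * E p)"
      by (rule along[OF smooth_dE _ smooth_on_mult[OF open_\<Omega> smooth_on_const[OF open_\<Omega>] smooth_E]])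
        (use expand_snd[OF smooth_E, of "(_, y)" y] euler_E assms in auto)
    also have "\<dots> = 2 * ?dx s E"
      using frechet_derivative_eqI[OF has_derivative_mult_right[OF smooth_on_has_derivative[OF smooth_E p]]] by simp
    finally show ?thesis .
  qed
  let ?y0 = "\<lambda>f. frechet_derivative f (at ?p) (y, 0)"
  have T: "(\<Sum>j\<in>UNIV. \<Sum>k\<in>UNIV. y $ j * y $ k *
      (?dx k (ddE (?e s) (?e j)) - ?dx s (ddE (?e j) (?e k)) + ?dx j (ddE (?e k) (?e s))))
    = 2 * (?y0 (dE (?e s)) - ?dx s E)" (is "?lhs = _") for s
  proof -
    have "?lhs = (\<Sum>j\<in>UNIV. \<Sum>k\<in>UNIV. y $ k * (y $ j * ?dx k (ddE (?e s) (?e j))))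
      - (\<Sum>j\<in>UNIV. \<Sum>k\<in>UNIV. y $ j * (y $ k * ?dx s (ddE (?e j) (?e k))))
      + (\<Sum>j\<in>UNIV. \<Sum>k\<in>UNIV. y $ j * (y $ k * ?dx j (ddE (?e k) (?e s))))"
      unfolding sum_subtractf[symmetric] sum.distrib[symmetric]
      by (intro sum.cong refl) (simp add: algebra_simps)
    also have "(\<Sum>j\<in>UNIV. \<Sum>k\<in>UNIV. y $ k * (y $ j * ?dx k (ddE (?e s) (?e j)))) = ?y0 (dE (?e s))"
      by (subst sum.swap) (simp add: sum_distrib_left[symmetric] row expand_fst[OF smooth_dE p, symmetric])
    also have "(\<Sum>j\<in>UNIV. \<Sum>k\<in>UNIV. y $ j * (y $ k * ?dx j (ddE (?e k) (?e s)))) = ?y0 (dE (?e s))"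
      by (simp add: sum_distrib_left[symmetric] row' expand_fst[OF smooth_dE p, symmetric])
    also have "(\<Sum>j\<in>UNIV. \<Sum>k\<in>UNIV. y $ j * (y $ k * ?dx s (ddE (?e j) (?e k)))) = 2 * ?dx s E"
      by (simp add: sum_distrib_left[symmetric] row quad)
    finally show ?thesis by simp
  qed
  let ?X = "\<lambda>s j k. ?dx k (ddE (?e s) (?e j)) - ?dx s (ddE (?e j) (?e k)) + ?dx j (ddE (?e k) (?e s))"
  have "(\<Sum>j\<in>UNIV. \<Sum>k\<in>UNIV. y $ j * y $ k * gam L i j k x y)
    = (\<Sum>j\<in>UNIV. \<Sum>k\<in>UNIV. \<Sum>s\<in>UNIV. (1/2) * gf_inv L i s x y * (y $ j * y $ k * ?X s j k))"
    unfolding gam_def pg sum_distrib_left by (intro sum.cong refl) (simp add: algebra_simps)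
  also have "\<dots> = (\<Sum>j\<in>UNIV. \<Sum>s\<in>UNIV. \<Sum>k\<in>UNIV. (1/2) * gf_inv L i s x y * (y $ j * y $ k * ?X s j k))"
    by (rule sum.cong[OF refl], rule sum.swap)
  also have "\<dots> = (\<Sum>s\<in>UNIV. \<Sum>j\<in>UNIV. \<Sum>k\<in>UNIV. (1/2) * gf_inv L i s x y * (y $ j * y $ k * ?X s j k))"
    by (rule sum.swap)
  also have "\<dots> = (\<Sum>s\<in>UNIV. (1/2) * gf_inv L i s x y * (\<Sum>j\<in>UNIV. \<Sum>k\<in>UNIV. y $ j * y $ k * ?X s j k))"
    by (simp only: sum_distrib_left)
  also have "\<dots> = (\<Sum>s\<in>UNIV. gf_inv L i s x y * (?y0 (dE (?e s)) - ?dx s E))"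
    unfolding T by (intro sum.cong refl) (simp add: field_simps)
  finally show ?thesis .
qed

lemma cartan_contract:
  assumes "x \<in> S" "y \<noteq> 0"
  shows "(\<Sum>k\<in>UNIV. y $ k * cartan L i j k x y) = 0"
    "(\<Sum>j\<in>UNIV. y $ j * cartan L i j k x y) = 0"
    "(\<Sum>i\<in>UNIV. y $ i * cartan L i j k x y) = 0"
proof -
  have p: "(x, y) \<in> \<Omega>" using assms by simp
  have s: "cartan L i j k x y = cartan L i k j x y" "cartan L i j k x y = cartan L j i k x y" for i j k
    using dddE_sym[OF p] assms by (simp_all add: cartan_eq)
  have *: "(\<Sum>k\<in>UNIV. y $ k * cartan L i j k x y) = 0" for i j
  proof -
    have "(\<Sum>k\<in>UNIV. y $ k * cartan L i j k x y) = 1/2 * dddE (axis i 1) (axis j 1) y (x, y)"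
      unfolding expand_snd[OF smooth_ddE p, of _ _ y] sum_distrib_left
      using assms by (intro sum.cong refl) (simp add: cartan_eq)
    then show ?thesis using euler_ddE[OF p] by simp
  qed
  from * show "(\<Sum>k\<in>UNIV. y $ k * cartan L i j k x y) = 0" .
  from *[of i k] show "(\<Sum>j\<in>UNIV. y $ j * cartan L i j k x y) = 0" by (simp add: s(1)[of i k])
  from *[of j k] show "(\<Sum>i\<in>UNIV. y $ i * cartan L i j k x y) = 0"
    by (simp add: s(1)[of j k] s(2)[of j _ k])
qed

text \<open>Each of the three Cartan terms in the Chern symbols contains one of the contracted indices, and
  \<open>C\<^sub>i\<^sub>j\<^sub>k y\<^sup>k = 0\<close> because the fundamental tensor is homogeneous of degree \<open>0\<close>.\<close>

lemma chern_contract: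
  assumes "x \<in> S" "y \<noteq> 0"
  shows "(\<Sum>j\<in>UNIV. \<Sum>k\<in>UNIV. y $ j * y $ k * chern L l j k x y) =
    (\<Sum>j\<in>UNIV. \<Sum>k\<in>UNIV. y $ j * y $ k * gam L l j k x y)"
proof -
  let ?N = "\<lambda>s k. nonlin L s k x y" and ?C = "\<lambda>i j k. cartan L i j k x y"
  let ?X = "\<lambda>i s j k. ?C i j s * ?N s k - ?C j k s * ?N s i + ?C k i s * ?N s j"
  have X0: "(\<Sum>j\<in>UNIV. \<Sum>k\<in>UNIV. y $ j * y $ k * ?X i s j k) = 0" (is "?lhs = 0") for i s
  proof -
    have "?lhs = (\<Sum>j\<in>UNIV. \<Sum>k\<in>UNIV. (y $ k * ?N s k) * (y $ j * ?C i j s))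
       - (\<Sum>j\<in>UNIV. \<Sum>k\<in>UNIV. (y $ k * ?N s i) * (y $ j * ?C j k s))
       + (\<Sum>j\<in>UNIV. \<Sum>k\<in>UNIV. (y $ j * ?N s j) * (y $ k * ?C k i s))"
      unfolding sum_subtractf[symmetric] sum.distrib[symmetric]
      by (intro sum.cong refl) (simp add: algebra_simps)
    also have "(\<Sum>j\<in>UNIV. \<Sum>k\<in>UNIV. (y $ k * ?N s k) * (y $ j * ?C i j s)) = 0"
      by (subst sum.swap) (simp add: sum_distrib_left[symmetric] cartan_contract[OF assms])
    also have "(\<Sum>j\<in>UNIV. \<Sum>k\<in>UNIV. (y $ k * ?N s i) * (y $ j * ?C j k s)) = 0"
      by (subst sum.swap) (simp add: sum_distrib_left[symmetric] cartan_contract[OF assms])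
    also have "(\<Sum>j\<in>UNIV. \<Sum>k\<in>UNIV. (y $ j * ?N s j) * (y $ k * ?C k i s)) = 0"
      by (simp add: sum_distrib_left[symmetric] cartan_contract[OF assms])
    finally show ?thesis by simp
  qed
  have "(\<Sum>j\<in>UNIV. \<Sum>k\<in>UNIV. y $ j * y $ k * (\<Sum>i\<in>UNIV. \<Sum>s\<in>UNIV. gf_inv L l i x y * ?X i s j k))
    = (\<Sum>j\<in>UNIV. \<Sum>k\<in>UNIV. \<Sum>i\<in>UNIV. \<Sum>s\<in>UNIV. gf_inv L l i x y * (y $ j * y $ k * ?X i s j k))"
    unfolding sum_distrib_left by (intro sum.cong refl) (simp add: algebra_simps)
  also have "\<dots> = (\<Sum>i\<in>UNIV. \<Sum>s\<in>UNIV. \<Sum>j\<in>UNIV. \<Sum>k\<in>UNIV. gf_inv L l i x y * (y $ j * y $ k * ?X i s j k))"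
    by (rule sum_swap_pairs)
  also have "\<dots> = 0"
    by (simp only: sum_distrib_left[symmetric] X0 mult_zero_right sum.neutral_const)
  finally show ?thesis
    unfolding chern_def by (simp add: right_diff_distrib sum_subtractf)
qed

text \<open>Lowering the index of the left-hand side with the fundamental tensor, which is invertible, gives
  the Euler--Lagrange covector: the two parts are \<open>g\<^sub>l\<^sub>i a\<^sup>i\<close> and the spray of \<open>E\<close>.\<close>

lemma euler_lagrange_imp_geodesic_equation:
  assumes "x \<in> S" "y \<noteq> 0" and EL: "\<And>w. euler_lagrange E w x y a = 0"
  shows "a $ i + (\<Sum>j\<in>UNIV. \<Sum>k\<in>UNIV. y $ j * y $ k * chern L i j k x y) = 0"
proof -
  define c where "c = (\<chi> i. \<Sum>j\<in>UNIV. \<Sum>k\<in>UNIV. y $ j * y $ k * chern L i j k x y)"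
  let ?p = "(x, y)" and ?e = "\<lambda>i. axis i 1 :: real^'n"
  have p: "?p \<in> \<Omega>" using assms by simp
  let ?R = "\<lambda>s. frechet_derivative (dE (?e s)) (at ?p) (y, 0) - frechet_derivative E (at ?p) (?e s, 0)"
  have "(hessian_half_sq (L x) y *v (a + c)) $ l = 0" for l
  proof -
    have "(hessian_half_sq (L x) y *v c) $ l = (\<Sum>i\<in>UNIV. ddE (?e l) (?e i) ?p * (\<Sum>s\<in>UNIV. gf_inv L i s x y * ?R s))"
      using assms by (simp add: matrix_vector_mult_def hessian_eq c_def chern_contract gam_contract)
    also have "\<dots> = (\<Sum>i\<in>UNIV. \<Sum>s\<in>UNIV. (ddE (?e l) (?e i) ?p * gf_inv L i s x y) * ?R s)"
      unfolding sum_distrib_left mult.assoc ..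
    also have "\<dots> = (\<Sum>s\<in>UNIV. (\<Sum>i\<in>UNIV. ddE (?e l) (?e i) ?p * gf_inv L i s x y) * ?R s)"
      by (subst sum.swap) (simp only: sum_distrib_right)
    also have "\<dots> = ?R l" using assms by (simp add: gf_inv_right if_distrib[of "\<lambda>t. t * _"] cong: if_cong)
    finally have "(hessian_half_sq (L x) y *v (a + c)) $ l = ddE (?e l) a ?p + ?R l"
      using assms by (simp add: matrix_vector_right_distrib hessian_mult_vec)
    then show ?thesis
      using EL[of "?e l"] frechet_derivative_split[OF smooth_dE p, of "?e l" y a]
      by (simp add: euler_lagrange_def)
  qed
  then have "hessian_half_sq (L x) y *v (a + c) = 0" by (simp add: vec_eq_iff)
  then have "a + c = 0"
    using hessian_invertible[OF assms(1,2)] by (simp add: invertible_left_inverse matrix_left_invertible_ker)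
  then show ?thesis by (simp add: c_def vec_eq_iff)
qed

lemma euler_lagrange_alt:
  assumes "x \<in> S" "y \<noteq> 0"
  shows "euler_lagrange E w x y a =
    frechet_derivative (\<lambda>p. frechet_derivative E (at p) (y, a)) (at (x, y)) (0, w)
     - frechet_derivative E (at (x, y)) (w, 0)"
  unfolding euler_lagrange_def
  using smooth_on_derivative_symmetric[OF open_\<Omega> _ smooth_E, of "(x, y)" "(0, w)" "(y, a)"] assms by simp

lemma linear_euler_lagrange:
  assumes "x \<in> S" "y \<noteq> 0"
  shows "linear (\<lambda>w. euler_lagrange E w x y a)"
proof -
  have p: "(x, y) \<in> \<Omega>" using assms by simp
  note l = smooth_on_linear_derivative[OF smooth_on_frechet_derivative[OF smooth_E] p, of "(y, a)"]
    smooth_on_linear_derivative[OF smooth_E p]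
  show ?thesis
    unfolding euler_lagrange_alt[OF assms]
    using linear_add[OF l(1), of "(0, _)" "(0, _)"] linear_scale[OF l(1), of _ "(0, _)"]
      linear_add[OF l(2), of "(_, 0)" "(_, 0)"] linear_scale[OF l(2), of _ "(_, 0)"]
    by (intro linearI) (auto simp: algebra_simps)
qed

text \<open>Conservation of energy: on the velocity itself the Euler--Lagrange covector is \<open>dE/dt\<close>. It
  follows from differentiating Euler's identity \<open>E\<^sub>y \<cdot> y = 2E\<close> along the curve.\<close>

lemma euler_lagrange_along_velocity:
  assumes "x \<in> S" "y \<noteq> 0"
  shows "euler_lagrange E y x y a = frechet_derivative E (at (x, y)) (y, a)"
proof -
  let ?p = "(x, y)" and ?e = "\<lambda>i. axis i 1 :: real^'n"
  have p: "?p \<in> \<Omega>" using assms by simp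
  have "((\<lambda>q. frechet_derivative E (at (fst q)) (snd q)) has_derivative
     (\<lambda>hk. frechet_derivative (dE y) (at ?p) (fst hk) + frechet_derivative E (at ?p) (snd hk))) (at (?p, (0, y)))"
    by (rule has_derivative_derivative_pairing[OF open_\<Omega> p smooth_E])
  moreover have "((\<lambda>q::(real^'n) \<times> (real^'n). (q, (0 :: real^'n, snd q))) has_derivative (\<lambda>h. (h, (0, snd h)))) (at ?p)"
    by (auto intro!: derivative_eq_intros)
  ultimately have "((\<lambda>q. frechet_derivative E (at q) (0, snd q)) has_derivative
     (\<lambda>h. frechet_derivative (dE y) (at ?p) h + frechet_derivative E (at ?p) (0, snd h))) (at ?p)"
    using diff_chain_at[of "\<lambda>q::(real^'n) \<times> (real^'n). (q, (0 :: real^'n, snd q))"] by (fastforce simp: o_def)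
  then have "((\<lambda>q. 2 * E q) has_derivative
     (\<lambda>h. frechet_derivative (dE y) (at ?p) h + frechet_derivative E (at ?p) (0, snd h))) (at ?p)"
    by (rule has_derivative_transform_within_open[OF _ open_\<Omega> p]) (use euler_E in auto)
  moreover have "((\<lambda>q. 2 * E q) has_derivative (\<lambda>h. 2 * frechet_derivative E (at ?p) h)) (at ?p)"
    by (rule has_derivative_mult_right[OF smooth_on_has_derivative[OF smooth_E p]])
  ultimately have "(\<lambda>h. frechet_derivative (dE y) (at ?p) h + frechet_derivative E (at ?p) (0, snd h)) = (\<lambda>h. 2 * frechet_derivative E (at ?p) h)"
    by (rule has_derivative_unique)
  from fun_cong[OF this, of "(y, a)"] show ?thesis
    using frechet_derivative_split[OF smooth_E p, of y a] by (simp add: euler_lagrange_def)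
qed

lemma continuous_on_euler_lagrange:
  assumes "x \<in> S" and a: "continuous_on (UNIV - {0}) a"
  shows "continuous_on (UNIV - {0}) (\<lambda>y. euler_lagrange E w x y (a y))"
proof -
  have g: "continuous_on (UNIV - {0}) (\<lambda>y. ((x, y), (y, a y)))" "continuous_on (UNIV - {0}) (\<lambda>y. (x, y))"
    by (intro continuous_intros a)+
  have sub: "(\<lambda>y. ((x, y), (y, a y))) ` (UNIV - {0}) \<subseteq> \<Omega> \<times> UNIV" "(\<lambda>y. (x, y)) ` (UNIV - {0}) \<subseteq> \<Omega>"
    using assms by auto
  have 1: "continuous_on (UNIV - {0}) (\<lambda>y. frechet_derivative (dE w) (at (x, y)) (y, a y))"
    using continuous_on_compose2[OF smooth_on_imp_continuous_on[OF smooth_on_derivative_pairing[OF open_\<Omega> smooth_dE]] g(1) sub(1)]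
    by simp
  have 2: "continuous_on (UNIV - {0}) (\<lambda>y. frechet_derivative E (at (x, y)) (w, 0))"
    using continuous_on_compose2[OF smooth_on_imp_continuous_on[OF smooth_on_frechet_derivative[OF smooth_E]] g(2) sub(2)] .
  show ?thesis unfolding euler_lagrange_def by (intro continuous_on_diff 1 2)
qed

end

section \<open>Manifolds and smooth maps in charts\<close>

text \<open>What the calculus in charts needs from an atlas. Separation, countability and transition maps
  are left out, so that the property passes easily to products.\<close>

definition charted :: "('m, 'a::euclidean_space) mfd \<Rightarrow> bool" where
  "charted M \<longleftrightarrow> (\<Union>c\<in>atlas M. dom_of c) = points M \<and>
     (\<forall>c\<in>atlas M. inj_on (crd c) (dom_of c) \<and> openin (mtop M) (dom_of c) \<and>
        (\<forall>V\<subseteq>dom_of c. openin (mtop M) V \<longleftrightarrow> open (crd c ` V)))"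

lemma charted_smooth_manifold:
  assumes "smooth_manifold M"
  shows "charted M"
proof -
  have "inj_on (crd c) (dom_of c) \<and> openin (mtop M) (dom_of c) \<and>
        (\<forall>V\<subseteq>dom_of c. openin (mtop M) V \<longleftrightarrow> open (crd c ` V))" if c: "c \<in> atlas M" for c
  proof -
    have 1: "openin (mtop M) (dom_of c)" "open (crd c ` dom_of c)"
      "homeomorphic_map (subtopology (mtop M) (dom_of c)) (top_of_set (crd c ` dom_of c)) (crd c)"
      using assms c by (auto simp: smooth_manifold_def)
    have top: "topspace (subtopology (mtop M) (dom_of c)) = dom_of c"
      using openin_subset[OF 1(1)] by (auto simp: topspace_subtopology)
    have "inj_on (crd c) (dom_of c)" using homeomorphic_imp_injective_map[OF 1(3)] top by simp
    moreover have "openin (mtop M) V \<longleftrightarrow> open (crd c ` V)" if "V \<subseteq> dom_of c" for V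
      using homeomorphic_map_openness[OF 1(3), of V] that top
        openin_open_subtopology[OF 1(1), of V] openin_open_eq[OF 1(2), of "crd c ` V"] by auto
    ultimately show ?thesis using 1 by blast
  qed
  then show ?thesis using assms by (auto simp: charted_def smooth_manifold_def)
qed

lemma charted_open_mfd: "open S \<Longrightarrow> charted (open_mfd S)"
  by (auto simp: charted_def open_mfd_def openin_open_eq)

lemma chart_at_exists: "charted M \<Longrightarrow> x \<in> points M \<Longrightarrow> \<exists>c. c \<in> charts_at M x"
  unfolding charted_def charts_at_def by blast

lemma charts_atD: "c \<in> charts_at M x \<Longrightarrow> c \<in> atlas M" "c \<in> charts_at M x \<Longrightarrow> x \<in> dom_of c"
  by (auto simp: charts_at_def)

lemma chart_inj: "charted M \<Longrightarrow> c \<in> atlas M \<Longrightarrow> inj_on (crd c) (dom_of c)"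
  and chart_openin: "charted M \<Longrightarrow> c \<in> atlas M \<Longrightarrow> openin (mtop M) (dom_of c)"
  and chart_openin_iff: "charted M \<Longrightarrow> c \<in> atlas M \<Longrightarrow> V \<subseteq> dom_of c \<Longrightarrow> openin (mtop M) V \<longleftrightarrow> open (crd c ` V)"
  by (auto simp: charted_def)

lemma chart_subset_points: "charted M \<Longrightarrow> c \<in> atlas M \<Longrightarrow> dom_of c \<subseteq> points M"
  using openin_subset[OF chart_openin] .

lemma chart_inv: "charted M \<Longrightarrow> c \<in> atlas M \<Longrightarrow> x \<in> dom_of c \<Longrightarrow> crd_inv c (crd c x) = x"
  using chart_inj by (intro inv_into_f_f)

lemma chart_image_open: "charted M \<Longrightarrow> c \<in> atlas M \<Longrightarrow> open (crd c ` dom_of c)"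
  using chart_openin_iff[of M c "dom_of c"] chart_openin by blast

lemma chart_vimage_openin:
  assumes "charted M" "c \<in> atlas M" "open W"
  shows "openin (mtop M) {x \<in> dom_of c. crd c x \<in> W}"
proof -
  have "crd c ` {x \<in> dom_of c. crd c x \<in> W} = crd c ` dom_of c \<inter> W" by auto
  then show ?thesis
    using chart_openin_iff[OF assms(1,2), of "{x \<in> dom_of c. crd c x \<in> W}"]
      chart_image_open[OF assms(1,2)] assms(3) by auto
qed

lemma charted_prod:
  assumes M: "charted M" and N: "charted N"
  shows "charted (prod_mfd M N)"
proof -
  have key: "inj_on (map_prod (crd c) (crd d)) (dom_of c \<times> dom_of d) \<and>
      openin (prod_topology (mtop M) (mtop N)) (dom_of c \<times> dom_of d) \<and>
      (\<forall>V\<subseteq>dom_of c \<times> dom_of d. openin (prod_topology (mtop M) (mtop N)) V \<longleftrightarrow> open (map_prod (crd c) (crd d) ` V))"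
    if c: "c \<in> atlas M" and d: "d \<in> atlas N" for c d
  proof (intro conjI allI impI iffI)
    show "inj_on (map_prod (crd c) (crd d)) (dom_of c \<times> dom_of d)"
      using chart_inj[OF M c] chart_inj[OF N d] by (rule map_prod_inj_on)
    show "openin (prod_topology (mtop M) (mtop N)) (dom_of c \<times> dom_of d)"
      using chart_openin[OF M c] chart_openin[OF N d] by (simp add: openin_prod_Times_iff)
    fix V assume V: "V \<subseteq> dom_of c \<times> dom_of d"
    {
      assume op: "openin (prod_topology (mtop M) (mtop N)) V"
      show "open (map_prod (crd c) (crd d) ` V)"
        unfolding open_prod_def
      proof
        fix z assume "z \<in> map_prod (crd c) (crd d) ` V"
        then obtain x y where xy: "(x, y) \<in> V" "z = (crd c x, crd d y)" by auto
        then obtain A B where AB: "openin (mtop M) A" "openin (mtop N) B" "x \<in> A" "y \<in> B" "A \<times> B \<subseteq> V"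
          using op unfolding openin_prod_topology_alt by meson
        then have sub: "A \<subseteq> dom_of c" "B \<subseteq> dom_of d" using V by auto
        then have "open (crd c ` A)" "open (crd d ` B)"
          using AB chart_openin_iff[OF M c] chart_openin_iff[OF N d] by blast+
        moreover have "z \<in> crd c ` A \<times> crd d ` B" using xy AB by auto
        moreover have "crd c ` A \<times> crd d ` B \<subseteq> map_prod (crd c) (crd d) ` V"
        proof
          fix w assume "w \<in> crd c ` A \<times> crd d ` B"
          then obtain a b where "a \<in> A" "b \<in> B" "w = (crd c a, crd d b)" by auto
          then show "w \<in> map_prod (crd c) (crd d) ` V" using AB(5) by (intro image_eqI[of _ _ "(a, b)"]) auto
        qed
        ultimately show "\<exists>A B. open A \<and> open B \<and> z \<in> A \<times> B \<and> A \<times> B \<subseteq> map_prod (crd c) (crd d) ` V"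
          by blast
      qed
    }
    {
      assume op: "open (map_prod (crd c) (crd d) ` V)"
      show "openin (prod_topology (mtop M) (mtop N)) V"
        unfolding openin_prod_topology_alt
      proof (intro allI impI)
        fix x y assume xy: "(x, y) \<in> V"
        then have "(crd c x, crd d y) \<in> map_prod (crd c) (crd d) ` V" by force
        then obtain A B where AB: "open A" "open B" "crd c x \<in> A" "crd d y \<in> B"
          "A \<times> B \<subseteq> map_prod (crd c) (crd d) ` V"
          using op unfolding open_prod_def by (metis mem_Sigma_iff)
        let ?A = "{x \<in> dom_of c. crd c x \<in> A}" and ?B = "{y \<in> dom_of d. crd d y \<in> B}"
        have "openin (mtop M) ?A" "openin (mtop N) ?B"
          using chart_vimage_openin[OF M c AB(1)] chart_vimage_openin[OF N d AB(2)] by auto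
        moreover have "x \<in> ?A" "y \<in> ?B" using xy V AB by auto
        moreover have "?A \<times> ?B \<subseteq> V"
        proof
          fix w assume "w \<in> ?A \<times> ?B"
          then obtain a b where w: "w = (a, b)" "a \<in> dom_of c" "b \<in> dom_of d" "crd c a \<in> A" "crd d b \<in> B" by auto
          then have "(crd c a, crd d b) \<in> map_prod (crd c) (crd d) ` V" using AB(5) by blast
          then obtain a' b' where ab': "(a', b') \<in> V" "crd c a' = crd c a" "crd d b' = crd d b" by auto
          then have "a' = a" "b' = b"
            using V w chart_inj[OF M c] chart_inj[OF N d] by (auto simp: inj_on_def)
          then show "w \<in> V" using ab' w by simp
        qed
        ultimately show "\<exists>U W. openin (mtop M) U \<and> openin (mtop N) W \<and> x \<in> U \<and> y \<in> W \<and> U \<times> W \<subseteq> V"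
          by blast
      qed
    }
  qed
  have atl: "atlas (prod_mfd M N) = (\<lambda>cd. (dom_of (fst cd) \<times> dom_of (snd cd), map_prod (crd (fst cd)) (crd (snd cd)))) ` (atlas M \<times> atlas N)"
    by (simp add: prod_mfd_def set_eq_iff image_iff Bex_def) blast
  have "(\<Union>c\<in>atlas (prod_mfd M N). dom_of c) = (\<Union>c\<in>atlas M. dom_of c) \<times> (\<Union>d\<in>atlas N. dom_of d)"
    unfolding atl by auto
  then have "(\<Union>c\<in>atlas (prod_mfd M N). dom_of c) = points M \<times> points N"
    using M N unfolding charted_def by simp
  moreover have "points (prod_mfd M N) = points M \<times> points N" by (simp add: prod_mfd_def)
  moreover have "inj_on (crd cd) (dom_of cd) \<and> openin (mtop (prod_mfd M N)) (dom_of cd) \<and>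
      (\<forall>V\<subseteq>dom_of cd. openin (mtop (prod_mfd M N)) V \<longleftrightarrow> open (crd cd ` V))"
    if cd: "cd \<in> atlas (prod_mfd M N)" for cd
  proof -
    obtain c d where "c \<in> atlas M" "d \<in> atlas N" "cd = (dom_of c \<times> dom_of d, map_prod (crd c) (crd d))"
      using cd by (auto simp: prod_mfd_def)
    then show ?thesis using key[of c d] by (simp add: prod_mfd_def)
  qed
  ultimately show ?thesis unfolding charted_def by blast
qed

lemma smooth_map_continuous: "smooth_map M N f \<Longrightarrow> continuous_map (mtop M) (mtop N) f"
  by (simp add: smooth_map_def)

lemma smooth_map_points: "smooth_map M N f \<Longrightarrow> x \<in> points M \<Longrightarrow> f x \<in> points N"
  using continuous_map_funspace[OF smooth_map_continuous] by blast

lemma smooth_map_domain_openin: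
  assumes "charted M" "charted N" "continuous_map (mtop M) (mtop N) f" "c \<in> atlas M" "d \<in> atlas N"
  shows "openin (mtop M) {x \<in> dom_of c. f x \<in> dom_of d}"
proof -
  have "{x \<in> dom_of c. f x \<in> dom_of d} = dom_of c \<inter> {x \<in> points M. f x \<in> dom_of d}"
    using chart_subset_points[OF assms(1,4)] by auto
  then show ?thesis
    using openin_continuous_map_preimage[OF assms(3) chart_openin[OF assms(2,5)]]
      chart_openin[OF assms(1,4)] by auto
qed

lemma smooth_map_domain_open:
  assumes "charted M" "charted N" "continuous_map (mtop M) (mtop N) f" "c \<in> atlas M" "d \<in> atlas N"
  shows "open (crd c ` {x \<in> dom_of c. f x \<in> dom_of d})"
  using smooth_map_domain_openin[OF assms] chart_openin_iff[OF assms(1,4), of "{x \<in> dom_of c. f x \<in> dom_of d}"]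
  by auto

lemma smooth_map_rep:
  "smooth_map M N f \<Longrightarrow> c \<in> atlas M \<Longrightarrow> d \<in> atlas N \<Longrightarrow>
   smooth_on (crd c ` {x \<in> dom_of c. f x \<in> dom_of d}) (crd d \<circ> f \<circ> crd_inv c)"
  by (auto simp: smooth_map_def)

lemma smooth_map_compose:
  assumes M: "charted M" and N: "charted N" and P: "charted P"
    and f: "smooth_map M N f" and g: "smooth_map N P g"
  shows "smooth_map M P (g \<circ> f)"
  unfolding smooth_map_def
proof (intro conjI ballI)
  show cgf: "continuous_map (mtop M) (mtop P) (g \<circ> f)"
    using continuous_map_compose[OF smooth_map_continuous[OF f] smooth_map_continuous[OF g]] .
  fix c e assume c: "c \<in> atlas M" and e: "e \<in> atlas P"
  show "smooth_on (crd c ` {x \<in> dom_of c. (g \<circ> f) x \<in> dom_of e}) (crd e \<circ> (g \<circ> f) \<circ> crd_inv c)"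
  proof (rule smooth_on_local)
    fix \<xi> assume "\<xi> \<in> crd c ` {x \<in> dom_of c. (g \<circ> f) x \<in> dom_of e}"
    then obtain x where x: "x \<in> dom_of c" "g (f x) \<in> dom_of e" "\<xi> = crd c x" by auto
    have "f x \<in> points N"
      using smooth_map_points[OF f] chart_subset_points[OF M c] x by blast
    then obtain d where d: "d \<in> atlas N" "f x \<in> dom_of d"
      using chart_at_exists[OF N] charts_atD by metis
    let ?D = "{x \<in> dom_of c. f x \<in> dom_of d} \<inter> {x \<in> dom_of c. (g \<circ> f) x \<in> dom_of e}"
    let ?T = "crd c ` ?D"
    have "openin (mtop M) ?D"
      using smooth_map_domain_openin[OF M N smooth_map_continuous[OF f] c d(1)]
        smooth_map_domain_openin[OF M P cgf c e] by blast
    then have T: "open ?T" using chart_openin_iff[OF M c, of ?D] by auto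
    have inv: "crd_inv c (crd c z) = z" if "z \<in> dom_of c" for z using chart_inv[OF M c that] .
    have "smooth_on ?T (\<lambda>\<xi>. (crd e \<circ> g \<circ> crd_inv d) ((crd d \<circ> f \<circ> crd_inv c) \<xi>))"
    proof (rule smooth_on_compose[OF T, where g = "crd d \<circ> f \<circ> crd_inv c" and f = "crd e \<circ> g \<circ> crd_inv d"])
      show "open (crd d ` {y \<in> dom_of d. g y \<in> dom_of e})"
        by (rule smooth_map_domain_open[OF N P smooth_map_continuous[OF g] d(1) e])
      show "(crd d \<circ> f \<circ> crd_inv c) ` ?T \<subseteq> crd d ` {y \<in> dom_of d. g y \<in> dom_of e}"
        using inv by auto
      show "smooth_on ?T (crd d \<circ> f \<circ> crd_inv c)"
        by (rule smooth_on_subset[OF smooth_map_rep[OF f c d(1)]]) auto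
      show "smooth_on (crd d ` {y \<in> dom_of d. g y \<in> dom_of e}) (crd e \<circ> g \<circ> crd_inv d)"
        by (rule smooth_map_rep[OF g d(1) e])
    qed
    then have "smooth_on ?T (crd e \<circ> (g \<circ> f) \<circ> crd_inv c)"
      by (rule smooth_on_cong[OF T, THEN iffD1, rotated])
        (use inv chart_inv[OF N d(1)] in auto)
    moreover have "\<xi> \<in> ?T" using x d by auto
    ultimately show "\<exists>T. open T \<and> \<xi> \<in> T \<and> smooth_on T (crd e \<circ> (g \<circ> f) \<circ> crd_inv c)"
      using T by (intro exI[of _ ?T] conjI)
  qed
qed

lemma atlas_prod_mfd: "cd \<in> atlas (prod_mfd M N) \<longleftrightarrow>
    (\<exists>c d. c \<in> atlas M \<and> d \<in> atlas N \<and> cd = (dom_of c \<times> dom_of d, map_prod (crd c) (crd d)))"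
  by (auto simp: prod_mfd_def)

abbreviation prod_chart :: "('m, 'a) chart \<Rightarrow> ('k, 'b) chart \<Rightarrow> ('m \<times> 'k, 'a \<times> 'b) chart" where
  "prod_chart c d \<equiv> (dom_of c \<times> dom_of d, map_prod (crd c) (crd d))"

lemma prod_chart_at:
  "c \<in> charts_at M x \<Longrightarrow> d \<in> charts_at N y \<Longrightarrow> prod_chart c d \<in> charts_at (prod_mfd M N) (x, y)"
  unfolding charts_at_def mem_Collect_eq atlas_prod_mfd
  by (intro conjI exI[of _ c] exI[of _ d]) auto

lemma smooth_map_Pair:
  assumes M: "charted M" and N: "charted N" and P: "charted P"
    and f: "smooth_map M N f" and g: "smooth_map M P g"
  shows "smooth_map M (prod_mfd N P) (\<lambda>x. (f x, g x))"
  unfolding smooth_map_def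
proof (intro conjI ballI)
  show "continuous_map (mtop M) (mtop (prod_mfd N P)) (\<lambda>x. (f x, g x))"
    using smooth_map_continuous[OF f] smooth_map_continuous[OF g]
    by (simp add: prod_mfd_def continuous_map_paired)
  fix c e assume c: "c \<in> atlas M" and "e \<in> atlas (prod_mfd N P)"
  then obtain d d' where d: "d \<in> atlas N" "d' \<in> atlas P" and e: "e = prod_chart d d'"
    unfolding atlas_prod_mfd by auto
  let ?D = "{x \<in> dom_of c. f x \<in> dom_of d} \<inter> {x \<in> dom_of c. g x \<in> dom_of d'}"
  have "openin (mtop M) ?D"
    using smooth_map_domain_openin[OF M N smooth_map_continuous[OF f] c d(1)]
      smooth_map_domain_openin[OF M P smooth_map_continuous[OF g] c d(2)] by blast
  then have T: "open (crd c ` ?D)" using chart_openin_iff[OF M c, of ?D] by auto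
  have "smooth_on (crd c ` ?D) (\<lambda>\<xi>. ((crd d \<circ> f \<circ> crd_inv c) \<xi>, (crd d' \<circ> g \<circ> crd_inv c) \<xi>))"
    by (intro smooth_on_Pair T smooth_on_subset[OF smooth_map_rep[OF f c d(1)]]
        smooth_on_subset[OF smooth_map_rep[OF g c d(2)]]) auto
  moreover have "{x \<in> dom_of c. (f x, g x) \<in> dom_of e} = ?D" by (auto simp: e)
  moreover have "(\<lambda>\<xi>. ((crd d \<circ> f \<circ> crd_inv c) \<xi>, (crd d' \<circ> g \<circ> crd_inv c) \<xi>)) = crd e \<circ> (\<lambda>x. (f x, g x)) \<circ> crd_inv c"
    by (auto simp: e)
  ultimately show "smooth_on (crd c ` {x \<in> dom_of c. (f x, g x) \<in> dom_of e}) (crd e \<circ> (\<lambda>x. (f x, g x)) \<circ> crd_inv c)"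
    by simp
qed

lemma smooth_map_const:
  assumes "charted M" "charted N" "y \<in> points N"
  shows "smooth_map M N (\<lambda>x. y)"
  unfolding smooth_map_def
proof (intro conjI ballI)
  show c: "continuous_map (mtop M) (mtop N) (\<lambda>x. y)" using assms(3) by simp
  fix c d assume cd: "c \<in> atlas M" "d \<in> atlas N"
  have "(crd d \<circ> (\<lambda>x. y) \<circ> crd_inv c) = (\<lambda>_. crd d y)" by auto
  then show "smooth_on (crd c ` {x \<in> dom_of c. y \<in> dom_of d}) (crd d \<circ> (\<lambda>x. y) \<circ> crd_inv c)"
    using smooth_map_domain_open[OF assms(1,2) c cd] by simp
qed

lemma smooth_map_id: "smooth_manifold M \<Longrightarrow> smooth_map M M (\<lambda>x. x)"
  unfolding smooth_map_def
proof (intro conjI ballI)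
  fix c d assume M: "smooth_manifold M" and c: "c \<in> atlas M" and d: "d \<in> atlas M"
  have "smooth_on (crd c ` (dom_of c \<inter> dom_of d)) (crd d \<circ> crd_inv c)"
    using M c d by (auto simp: smooth_manifold_def)
  moreover have "{x \<in> dom_of c. x \<in> dom_of d} = dom_of c \<inter> dom_of d" by auto
  moreover have "crd d \<circ> (\<lambda>x. x) \<circ> crd_inv c = crd d \<circ> crd_inv c" by auto
  ultimately show "smooth_on (crd c ` {x \<in> dom_of c. x \<in> dom_of d}) (crd d \<circ> (\<lambda>x. x) \<circ> crd_inv c)" by simp
qed simp

text \<open>The tangent map of \<open>f\<close> at \<open>x\<close> as a linear map between the coordinates of two charts.\<close>

definition tmap :: "('m, 'a::euclidean_space) chart \<Rightarrow> ('k, 'b::euclidean_space) chart \<Rightarrow> ('m \<Rightarrow> 'k) \<Rightarrow> 'm \<Rightarrow> 'a \<Rightarrow> 'b" where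
  "tmap c d f x = frechet_derivative (crd d \<circ> f \<circ> crd_inv c) (at (crd c x))"

lemma tmap_has_derivative:
  assumes f: "smooth_map M N f" and c: "c \<in> charts_at M x" and d: "d \<in> charts_at N (f x)"
  shows "((crd d \<circ> f \<circ> crd_inv c) has_derivative tmap c d f x) (at (crd c x))"
  unfolding tmap_def
  by (rule smooth_on_has_derivative[OF smooth_map_rep[OF f charts_atD(1)[OF c] charts_atD(1)[OF d]]])
    (use charts_atD[OF c] charts_atD[OF d] in auto)

lemma linear_tmap:
  assumes "smooth_map M N f" "c \<in> charts_at M x" "d \<in> charts_at N (f x)"
  shows "linear (tmap c d f x)"
  using has_derivative_linear[OF tmap_has_derivative[OF assms]] .

lemma tmap_compose:
  assumes M: "charted M" and N: "charted N"
    and f: "smooth_map M N f" and g: "smooth_map N P g"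
    and c: "c \<in> charts_at M x" and d: "d \<in> charts_at N (f x)" and e: "e \<in> charts_at P (g (f x))"
  shows "tmap c e (\<lambda>x. g (f x)) x v = tmap d e g (f x) (tmap c d f x v)"
proof -
  note c' = charts_atD[OF c] and d' = charts_atD[OF d]
  let ?D = "{x \<in> dom_of c. f x \<in> dom_of d}"
  have T: "open (crd c ` ?D)" by (rule smooth_map_domain_open[OF M N smooth_map_continuous[OF f] c'(1) d'(1)])
  have x: "crd c x \<in> crd c ` ?D" using c' d' by auto
  have inv: "crd_inv c (crd c z) = z" if "z \<in> dom_of c" for z using chart_inv[OF M c'(1) that] .
  have "(crd e \<circ> g \<circ> crd_inv d has_derivative tmap d e g (f x)) (at ((crd d \<circ> f \<circ> crd_inv c) (crd c x)))"
    using tmap_has_derivative[OF g d e] c' inv by simp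
  from diff_chain_at[OF tmap_has_derivative[OF f c d] this]
  have "((crd e \<circ> g \<circ> crd_inv d) \<circ> (crd d \<circ> f \<circ> crd_inv c) has_derivative tmap d e g (f x) \<circ> tmap c d f x) (at (crd c x))" .
  then have "((crd e \<circ> (\<lambda>x. g (f x)) \<circ> crd_inv c) has_derivative tmap d e g (f x) \<circ> tmap c d f x) (at (crd c x))"
    by (rule has_derivative_transform_within_open[OF _ T x]) (use inv chart_inv[OF N d'(1)] in auto)
  then show ?thesis unfolding tmap_def[of c e] by (simp add: frechet_derivative_eqI)
qed

lemma tmap_id:
  assumes "charted M" "c \<in> charts_at M x"
  shows "tmap c c (\<lambda>x. x) x = id"
proof -
  note c' = charts_atD[OF assms(2)]
  have "((\<lambda>\<xi>. \<xi>) has_derivative (\<lambda>h. h)) (at (crd c x))" by (rule has_derivative_ident)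
  then have "((crd c \<circ> (\<lambda>x. x) \<circ> crd_inv c) has_derivative (\<lambda>h. h)) (at (crd c x))"
    by (rule has_derivative_transform_within_open[OF _ chart_image_open[OF assms(1) c'(1)]])
      (use c' chart_inv[OF assms(1) c'(1)] in auto)
  then show ?thesis by (simp add: tmap_def frechet_derivative_eqI id_def)
qed

lemma tmap_cong:
  assumes M: "charted M" and c: "c \<in> charts_at M x" and U: "openin (mtop M) U" "x \<in> U"
    and eq: "\<And>z. z \<in> U \<Longrightarrow> f z = g z"
  shows "tmap c d f x = tmap c d g x"
proof -
  note c' = charts_atD[OF c]
  have "openin (mtop M) (U \<inter> dom_of c)" using U chart_openin[OF M c'(1)] by blast
  then have "open (crd c ` (U \<inter> dom_of c))" using chart_openin_iff[OF M c'(1), of "U \<inter> dom_of c"] by auto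
  then show ?thesis
    unfolding tmap_def
    by (rule frechet_derivative_cong_open) (use c' U eq chart_inv[OF M c'(1)] in auto)
qed

lemma tmap_cong_points:
  assumes "charted M" "c \<in> charts_at M x" "\<And>z. z \<in> points M \<Longrightarrow> f z = g z"
  shows "tmap c d f x = tmap c d g x"
proof -
  have "x \<in> points M"
    using chart_subset_points[OF assms(1) charts_atD(1)[OF assms(2)]] charts_atD(2)[OF assms(2)] by blast
  from tmap_cong[OF assms(1,2) openin_topspace this assms(3)] show ?thesis .
qed

lemma tmap_diffeo_bij:
  assumes M: "smooth_manifold M" and N: "smooth_manifold N"
    and f: "smooth_map M N f" and g: "smooth_map N M g"
    and gf: "\<And>z. z \<in> points M \<Longrightarrow> g (f z) = z" and fg: "\<And>z. z \<in> points N \<Longrightarrow> f (g z) = z"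
    and c: "c \<in> charts_at M x" and d: "d \<in> charts_at N (f x)"
  shows "bij (tmap c d f x)"
proof -
  note cM = charted_smooth_manifold[OF M] and cN = charted_smooth_manifold[OF N]
  have x: "x \<in> points M" using chart_subset_points[OF cM] charts_atD[OF c] by blast
  have c': "c \<in> charts_at M (g (f x))" using c gf[OF x] by simp
  have d': "d \<in> charts_at N (f (g (f x)))" using d gf[OF x] by simp
  have "tmap d c g (f x) (tmap c d f x v) = v" for v
    using tmap_compose[OF cM cN f g c d c', of v] tmap_cong_points[OF cM c, of "\<lambda>x. g (f x)" "\<lambda>x. x" c] gf
      tmap_id[OF cM c] by simp
  moreover have "tmap c d f x (tmap d c g (f x) v) = v" for v
    using tmap_compose[OF cN cM g f d c' d', of v] tmap_cong_points[OF cN d, of "\<lambda>x. f (g x)" "\<lambda>x. x" d] fg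
      tmap_id[OF cN d] gf[OF x] by simp
  ultimately show ?thesis by (intro o_bij[of "tmap d c g (f x)"]) (simp_all add: fun_eq_iff)
qed

lemma tmap_Pair:
  assumes f: "smooth_map M N f" and g: "smooth_map M P g"
    and c: "c \<in> charts_at M x" and d: "d \<in> charts_at N (f x)" and e: "e \<in> charts_at P (g x)"
  shows "tmap c (prod_chart d e) (\<lambda>x. (f x, g x)) x v = (tmap c d f x v, tmap c e g x v)"
proof -
  have "(crd (prod_chart d e) \<circ> (\<lambda>x. (f x, g x)) \<circ> crd_inv c) =
    (\<lambda>\<xi>. ((crd d \<circ> f \<circ> crd_inv c) \<xi>, (crd e \<circ> g \<circ> crd_inv c) \<xi>))" by auto
  then show ?thesis
    using has_derivative_Pair[OF tmap_has_derivative[OF f c d] tmap_has_derivative[OF g c e]]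
    unfolding tmap_def[of c "prod_chart d e"] by (simp add: frechet_derivative_eqI)
qed

lemma tmap_const: "tmap c d (\<lambda>x. y) x v = 0"
proof -
  have "(crd d \<circ> (\<lambda>x. y) \<circ> crd_inv c) = (\<lambda>_. crd d y)" by auto
  then show ?thesis by (simp add: tmap_def frechet_derivative_eqI[OF has_derivative_const])
qed

section \<open>Curves and tangent vectors\<close>

abbreviation line :: "(real, real) mfd" where "line \<equiv> open_mfd UNIV"

abbreviation line_chart :: "(real, real) chart" where "line_chart \<equiv> (UNIV, id)"

lemma charted_line: "charted line"
  by (rule charted_open_mfd) simp

lemma line_chart: "line_chart \<in> charts_at line t" "line_chart \<in> atlas line"
  by (auto simp: charts_at_def open_mfd_def)

lemma smooth_map_line_iff:
  "smooth_map line M \<gamma> \<longleftrightarrow> continuous_map euclidean (mtop M) \<gamma> \<and>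
     (\<forall>d\<in>atlas M. smooth_on {t. \<gamma> t \<in> dom_of d} (crd d \<circ> \<gamma>))"
  by (simp add: smooth_map_def open_mfd_def comp_def)

lemma velocity_has_vector_derivative:
  assumes "smooth_map line M \<gamma>" "c \<in> charts_at M (\<gamma> t)"
  shows "((crd c \<circ> \<gamma>) has_vector_derivative velocity M \<gamma> t c) (at t)"
proof -
  have "smooth_on {t. \<gamma> t \<in> dom_of c} (crd c \<circ> \<gamma>)"
    using assms charts_atD[OF assms(2)] by (auto simp: smooth_map_line_iff)
  from smooth_on_has_derivative[OF this, of t] have "(crd c \<circ> \<gamma>) differentiable (at t)"
    using charts_atD[OF assms(2)] differentiableI by blast
  then show ?thesis using assms(2) by (simp add: velocity_def vector_derivative_works)
qed

lemma velocity_eq_tmap: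
  assumes "smooth_map line M \<gamma>" "c \<in> charts_at M (\<gamma> t)"
  shows "velocity M \<gamma> t c = tmap line_chart c \<gamma> t 1"
proof -
  have eq: "crd c \<circ> \<gamma> \<circ> crd_inv line_chart = crd c \<circ> \<gamma>" by (auto simp: comp_def)
  have d: "((crd c \<circ> \<gamma>) has_derivative tmap line_chart c \<gamma> t) (at t)"
    using tmap_has_derivative[OF assms(1) line_chart(1) assms(2)] unfolding eq by simp
  from has_derivative_unique[OF d velocity_has_vector_derivative[OF assms, unfolded has_vector_derivative_def]]
  show ?thesis by simp
qed

lemma velocity_outside: "c \<notin> charts_at M (\<gamma> t) \<Longrightarrow> velocity M \<gamma> t c = 0"
  by (simp add: velocity_def)

lemma velocity_compose:
  assumes M: "charted M" and f: "smooth_map M N f" and \<gamma>: "smooth_map line M \<gamma>"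
    and N: "charted N" and c: "c \<in> charts_at M (\<gamma> t)" and d: "d \<in> charts_at N (f (\<gamma> t))"
  shows "velocity N (\<lambda>t. f (\<gamma> t)) t d = tmap c d f (\<gamma> t) (velocity M \<gamma> t c)"
proof -
  have "smooth_map line N (\<lambda>t. f (\<gamma> t))"
    using smooth_map_compose[OF charted_line M N \<gamma> f] by (simp add: comp_def)
  then show ?thesis
    using velocity_eq_tmap[of N "\<lambda>t. f (\<gamma> t)" d t] d velocity_eq_tmap[OF \<gamma> c] tmap_compose[OF charted_line M \<gamma> f line_chart(1) c d] by simp
qed

lemma velocity_in_tangent_space:
  assumes M: "smooth_manifold M" and \<gamma>: "smooth_map line M \<gamma>"
  shows "velocity M \<gamma> t \<in> tangent_space M (\<gamma> t)"
proof -
  note cM = charted_smooth_manifold[OF M]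
  have "velocity M \<gamma> t d = frechet_derivative (crd d \<circ> crd_inv c) (at (crd c (\<gamma> t))) (velocity M \<gamma> t c)"
    if "c \<in> charts_at M (\<gamma> t)" "d \<in> charts_at M (\<gamma> t)" for c d
    using velocity_compose[OF cM smooth_map_id[OF M] \<gamma> cM that] by (simp add: tmap_def comp_def)
  then show ?thesis
    unfolding tangent_space_def mem_Collect_eq using velocity_outside[of _ M \<gamma> t] by blast
qed

lemma tangent_space_tmap:
  "v \<in> tangent_space M x \<Longrightarrow> c \<in> charts_at M x \<Longrightarrow> d \<in> charts_at M x \<Longrightarrow> v d = tmap c d (\<lambda>x. x) x (v c)"
  unfolding tangent_space_def tmap_def comp_def by blast

lemma tangent_space_outside: "v \<in> tangent_space M x \<Longrightarrow> c \<notin> charts_at M x \<Longrightarrow> v c = 0"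
  unfolding tangent_space_def by blast

text \<open>A tangent vector is determined by its components in a single chart.\<close>

lemma tangent_vector_eqI:
  assumes "v \<in> tangent_space M x" "w \<in> tangent_space M x" "c \<in> charts_at M x" "v c = w c"
  shows "v = w"
proof
  fix d
  show "v d = w d"
    using tangent_space_tmap[OF assms(1) assms(3), of d] tangent_space_tmap[OF assms(2) assms(3), of d]
      tangent_space_outside[OF assms(1), of d] tangent_space_outside[OF assms(2), of d] assms(4)
    by (cases "d \<in> charts_at M x") simp_all
qed

lemma tvec_of_tmap: "d \<in> charts_at M x \<Longrightarrow> tvec_of M c x y d = tmap c d (\<lambda>x. x) x y"
  by (simp add: tvec_of_def tmap_def comp_def)

lemma tvec_of_self:
  assumes "smooth_manifold M" "c \<in> charts_at M x"
  shows "tvec_of M c x y c = y"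
  using tvec_of_tmap[OF assms(2)] tmap_id[OF charted_smooth_manifold[OF assms(1)] assms(2)] by simp

lemma tvec_of_in_tangent_space:
  assumes M: "smooth_manifold M" and c: "c \<in> charts_at M x"
  shows "tvec_of M c x y \<in> tangent_space M x"
proof -
  note cM = charted_smooth_manifold[OF M]
  have "tvec_of M c x y d' = frechet_derivative (crd d' \<circ> crd_inv d) (at (crd d x)) (tvec_of M c x y d)"
    if d: "d \<in> charts_at M x" "d' \<in> charts_at M x" for d d'
    using tmap_compose[OF cM cM smooth_map_id[OF M] smooth_map_id[OF M] c d, of y]
    by (simp add: tvec_of_tmap d) (simp add: tmap_def comp_def)
  moreover have "tvec_of M c x y d = 0" if "d \<notin> charts_at M x" for d
    using that by (simp add: tvec_of_def)
  ultimately show ?thesis unfolding tangent_space_def mem_Collect_eq by blast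
qed

lemma tvec_of_component:
  assumes "smooth_manifold M" "c \<in> charts_at M x" "v \<in> tangent_space M x"
  shows "tvec_of M c x (v c) = v"
  by (rule tangent_vector_eqI[OF tvec_of_in_tangent_space[OF assms(1,2)] assms(3,2) tvec_of_self[OF assms(1,2)]])

lemma pushforward_eq_tmap:
  assumes M: "smooth_manifold M" and N: "charted N" and f: "smooth_map M N f"
    and v: "v \<in> tangent_space M x" and c: "c \<in> charts_at M x" and d: "d \<in> charts_at N (f x)"
  shows "pushforward M N f x v d = tmap c d f x (v c)"
proof -
  note cM = charted_smooth_manifold[OF M]
  define c' where "c' = (SOME c. c \<in> charts_at M x)"
  have c': "c' \<in> charts_at M x" unfolding c'_def using c by (rule someI)
  have "pushforward M N f x v d = tmap c' d f x (v c')"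
    using d by (simp add: pushforward_def c'_def tmap_def Let_def)
  also have "v c' = tmap c c' (\<lambda>x. x) x (v c)" by (rule tangent_space_tmap[OF v c c'])
  finally show ?thesis
    using tmap_compose[OF cM cM smooth_map_id[OF M] f c c' d] by simp
qed

lemma pushforward_eqI:
  assumes M: "smooth_manifold M" and N: "smooth_manifold N" and f: "smooth_map M N f"
    and v: "v \<in> tangent_space M x" and c: "c \<in> charts_at M x"
    and d: "d \<in> charts_at N (f x)" and w: "w \<in> tangent_space N (f x)" "w d = tmap c d f x (v c)"
  shows "pushforward M N f x v = w"
proof
  fix e
  note cM = charted_smooth_manifold[OF M] and cN = charted_smooth_manifold[OF N]
  show "pushforward M N f x v e = w e"
  proof (cases "e \<in> charts_at N (f x)")
    case True
    then show ?thesis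
      using pushforward_eq_tmap[OF M cN f v c True] tangent_space_tmap[OF w(1) d True] w(2)
        tmap_compose[OF cM cN f smooth_map_id[OF N] c d True] by simp
  qed (use tangent_space_outside[OF w(1)] in \<open>simp add: pushforward_def\<close>)
qed

lemma has_vector_derivative_shift:
  assumes "(g has_vector_derivative D) (at (t + s))"
  shows "((\<lambda>s. g (t + s)) has_vector_derivative D) (at s)"
proof -
  have "((\<lambda>s. t + s) has_vector_derivative 1) (at s)" by (auto intro!: derivative_eq_intros)
  from vector_diff_chain_at[OF this, of g D] assms show ?thesis by (simp add: o_def)
qed

lemma velocity_shift:
  assumes \<gamma>: "smooth_map line M \<gamma>"
  shows "velocity M (\<lambda>s. \<gamma> (t + s)) 0 = velocity M \<gamma> t"
proof
  fix c
  show "velocity M (\<lambda>s. \<gamma> (t + s)) 0 c = velocity M \<gamma> t c"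
  proof (cases "c \<in> charts_at M (\<gamma> t)")
    case True
    then have "((\<lambda>s. (crd c \<circ> \<gamma>) (t + s)) has_vector_derivative velocity M \<gamma> t c) (at 0)"
      using velocity_has_vector_derivative[OF \<gamma>, of c t] by (intro has_vector_derivative_shift) (simp add: comp_def)
    then show ?thesis using True by (simp add: velocity_def comp_def vector_derivative_at)
  qed (simp add: velocity_def)
qed

lemma tangent_space_tscale:
  assumes "smooth_manifold M" "v \<in> tangent_space M x"
  shows "tscale r v \<in> tangent_space M x"
proof -
  have "tscale r v d = frechet_derivative (crd d \<circ> crd_inv c) (at (crd c x)) (tscale r v c)"
    if c: "c \<in> charts_at M x" and d: "d \<in> charts_at M x" for c d
    using tangent_space_tmap[OF assms(2) c d] linear_scale[OF linear_tmap[OF smooth_map_id[OF assms(1)] c d], of r "v c"]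
    by (simp add: tscale_def) (simp add: tmap_def comp_def)
  moreover have "tscale r v c = 0" if "c \<notin> charts_at M x" for c
    using tangent_space_outside[OF assms(2) that] by (simp add: tscale_def)
  ultimately show ?thesis unfolding tangent_space_def mem_Collect_eq by blast
qed

lemma tangent_vector_eq_0_iff:
  assumes M: "smooth_manifold M" and v: "v \<in> tangent_space M x" and c: "c \<in> charts_at M x"
  shows "v = tzero \<longleftrightarrow> v c = 0"
proof
  assume "v c = 0"
  moreover have "tzero \<in> tangent_space M x"
    using tangent_space_tscale[OF M v, of 0] by (simp add: tscale_def tzero_def)
  ultimately show "v = tzero" using tangent_vector_eqI[OF v _ c, of tzero] by (simp add: tzero_def)
qed (simp add: tzero_def)

section \<open>Lie groups and their actions\<close>

lemma abs_divide_less: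
  fixes t \<epsilon> :: real
  assumes "\<epsilon> > 0" "n \<ge> Suc (nat \<lceil>\<bar>t\<bar> / \<epsilon>\<rceil>)"
  shows "\<bar>t / real n\<bar> < \<epsilon>"
proof -
  have "\<bar>t\<bar> / \<epsilon> < real n" using assms(2) by linarith
  moreover have "real n > 0" using assms(2) by simp
  ultimately show ?thesis using assms(1) by (simp add: field_simps)
qed

context group
begin

text \<open>A local homomorphism from the line is extended by \<open>\<alpha>(t) = a(t/n)\<^sup>n\<close> for large \<open>n\<close>. Comparing two
  values of \<open>n\<close> with their product shows that the choice is immaterial.\<close>

lemma local_hom_extends:
  assumes \<epsilon>: "\<epsilon> > 0" and a: "\<And>t. \<bar>t\<bar> < \<epsilon> \<Longrightarrow> a t \<in> carrier G"
    and add: "\<And>s t. \<bar>s\<bar> < \<epsilon> \<Longrightarrow> \<bar>t\<bar> < \<epsilon> \<Longrightarrow> \<bar>s + t\<bar> < \<epsilon> \<Longrightarrow> a (s + t) = a s \<otimes> a t"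
  obtains \<alpha> :: "real \<Rightarrow> 'a" where "\<And>t. \<alpha> t \<in> carrier G" "\<And>s t. \<alpha> (s + t) = \<alpha> s \<otimes> \<alpha> t"
    "\<And>t. \<bar>t\<bar> < \<epsilon> \<Longrightarrow> \<alpha> t = a t"
proof -
  have pow: "a (real j * s) = a s [^] j" if "\<bar>real j * s\<bar> < \<epsilon>" "\<bar>s\<bar> < \<epsilon>" for j s
    using that(1)
  proof (induction j)
    case 0
    have "a 0 \<otimes> a 0 = a 0" using add[of 0 0] \<epsilon> by simp
    then have "a 0 = \<one>" using a[of 0] \<epsilon> by (simp add: l_cancel_one)
    then show ?case by simp
  next
    case (Suc j)
    have "\<bar>real j * s\<bar> \<le> \<bar>real (Suc j) * s\<bar>" by (simp add: abs_mult mult_right_mono)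
    then have j: "\<bar>real j * s\<bar> < \<epsilon>" using Suc.prems by linarith
    have "real (Suc j) * s = real j * s + s" by (simp add: algebra_simps)
    then show ?case using add[OF j that(2)] Suc.prems Suc.IH[OF j] by simp
  qed
  have wd: "a (t / real N) [^] N = a (t / real M) [^] M"
    if "N > 0" "M > 0" "\<bar>t / real N\<bar> < \<epsilon>" "\<bar>t / real M\<bar> < \<epsilon>" for N M :: nat and t
  proof -
    have small: "\<bar>t / (real N * real M)\<bar> < \<epsilon>"
    proof -
      have "\<bar>t / real N\<bar> / real M \<le> \<bar>t / real N\<bar> / 1"
        using that(1,2) by (intro divide_left_mono) auto
      then have "\<bar>t / (real N * real M)\<bar> \<le> \<bar>t / real N\<bar>"
        by (simp add: abs_mult)
      then show ?thesis using that by linarith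
    qed
    have "a (t / real N) = a (t / (real N * real M)) [^] M"
      using pow[of M "t / (real N * real M)"] that small by simp
    moreover have "a (t / real M) = a (t / (real N * real M)) [^] N"
      using pow[of N "t / (real N * real M)"] that small by simp
    ultimately show ?thesis using a[OF small] by (simp add: nat_pow_pow mult.commute)
  qed
  define N where "N = (\<lambda>t. Suc (nat \<lceil>\<bar>t\<bar> / \<epsilon>\<rceil>))"
  have N: "\<bar>t / real n\<bar> < \<epsilon>" if "n \<ge> N t" for t n
    using abs_divide_less[OF \<epsilon>] that by (simp add: N_def)
  define \<alpha> where "\<alpha> = (\<lambda>t. a (t / real (N t)) [^] N t)"
  have \<alpha>: "\<alpha> t = a (t / real n) [^] n" if "n > 0" "\<bar>t / real n\<bar> < \<epsilon>" for t n
    unfolding \<alpha>_def by (rule wd) (use that N[of t "N t"] in \<open>auto simp: N_def\<close>)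
  show ?thesis
  proof (rule that)
    show "\<alpha> t \<in> carrier G" for t unfolding \<alpha>_def by (intro nat_pow_closed a N) simp
    show "\<alpha> t = a t" if "\<bar>t\<bar> < \<epsilon>" for t using \<alpha>[of 1 t] that a by simp
    fix s t
    define n where "n = max (N s) (max (N t) (N (s + t)))"
    have n: "n > 0" "\<bar>s / real n\<bar> < \<epsilon>" "\<bar>t / real n\<bar> < \<epsilon>" "\<bar>(s + t) / real n\<bar> < \<epsilon>"
      by (simp add: n_def N_def, (rule N, simp add: n_def)+)
    have sum: "(s + t) / real n = s / real n + t / real n" "(s + t) / real n = t / real n + s / real n"
      by (simp_all add: add_divide_distrib)
    have ab: "a ((s + t) / real n) = a (s / real n) \<otimes> a (t / real n)"
      using add[OF n(2,3)] n(4) unfolding sum by simp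
    have ba: "a ((s + t) / real n) = a (t / real n) \<otimes> a (s / real n)"
      using add[OF n(3,2)] n(4) unfolding sum(2) by simp
    show "\<alpha> (s + t) = \<alpha> s \<otimes> \<alpha> t"
      unfolding \<alpha>[OF n(1,2)] \<alpha>[OF n(1,3)] \<alpha>[OF n(1,4)] ab
      using ab ba by (intro pow_mult_distrib a n) simp
  qed
qed

end

locale lie_grp = group G for G :: "'g monoid" (structure) +
  fixes L :: "('g, 'e::euclidean_space) mfd"
  assumes lie: "lie_group G L"
begin

lemma L_smooth_manifold: "smooth_manifold L" and carrier_L: "carrier G = points L"
  and mult_smooth: "smooth_map (prod_mfd L L) L (\<lambda>(g, h). g \<otimes> h)"
  using lie by (auto simp: lie_group_def)

lemma charted_L: "charted L"
  by (rule charted_smooth_manifold[OF L_smooth_manifold])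

lemma one_ps_closed: "one_parameter_subgroup G L \<alpha> \<Longrightarrow> \<alpha> t \<in> carrier G"
  using smooth_map_points[of line L \<alpha> t] by (simp add: one_parameter_subgroup_def carrier_L open_mfd_def)

lemma one_ps_add: "one_parameter_subgroup G L \<alpha> \<Longrightarrow> \<alpha> (s + t) = \<alpha> s \<otimes> \<alpha> t"
  and one_ps_smooth: "one_parameter_subgroup G L \<alpha> \<Longrightarrow> smooth_map line L \<alpha>"
  by (auto simp: one_parameter_subgroup_def)

lemma one_ps_0: "one_parameter_subgroup G L \<alpha> \<Longrightarrow> \<alpha> 0 = \<one>"
  using one_ps_add[of \<alpha> 0 0] one_ps_closed[of \<alpha> 0] by (simp add: l_cancel_one')

lemma one_ps_pow: "one_parameter_subgroup G L \<alpha> \<Longrightarrow> \<alpha> (real n * t) = \<alpha> t [^] n"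
proof (induction n)
  case (Suc n)
  have "real (Suc n) * t = real n * t + t" by (simp add: algebra_simps)
  then show ?case using Suc one_ps_add[of \<alpha> "real n * t" t] by simp
qed (simp add: one_ps_0)

end

locale lie_action = lie_grp G L
  for G :: "'g monoid" (structure) and L :: "('g, 'e::euclidean_space) mfd" +
  fixes N :: "('m, 'b::euclidean_space) mfd" and act :: "'g \<Rightarrow> 'm \<Rightarrow> 'm"
  assumes N_smooth_manifold: "smooth_manifold N"
    and act_one: "x \<in> points N \<Longrightarrow> act \<one> x = x"
    and act_mult: "g \<in> carrier G \<Longrightarrow> h \<in> carrier G \<Longrightarrow> x \<in> points N \<Longrightarrow> act (g \<otimes> h) x = act g (act h x)"
    and act_smooth: "smooth_map (prod_mfd L N) N (\<lambda>(g, x). act g x)"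
begin

lemma charted_N: "charted N"
  by (rule charted_smooth_manifold[OF N_smooth_manifold])

lemma act_closed: "g \<in> carrier G \<Longrightarrow> x \<in> points N \<Longrightarrow> act g x \<in> points N"
  using smooth_map_points[OF act_smooth, of "(g, x)"] by (simp add: carrier_L prod_mfd_def)

lemma smooth_map_orbit: "x \<in> points N \<Longrightarrow> smooth_map L N (\<lambda>g. act g x)"
  using smooth_map_compose[OF charted_L charted_prod[OF charted_L charted_N] charted_N
      smooth_map_Pair[OF charted_L charted_L charted_N smooth_map_id[OF L_smooth_manifold]
        smooth_map_const[OF charted_L charted_N]] act_smooth, of x] by (simp add: comp_def)

lemma smooth_map_act: "g \<in> carrier G \<Longrightarrow> smooth_map N N (act g)"
  using smooth_map_compose[OF charted_N charted_prod[OF charted_L charted_N] charted_N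
      smooth_map_Pair[OF charted_N charted_L charted_N smooth_map_const[OF charted_N charted_L]
        smooth_map_id[OF N_smooth_manifold]] act_smooth, of g] by (simp add: comp_def carrier_L)

lemma tmap_act_bij:
  assumes g: "g \<in> carrier G" and c: "c \<in> charts_at N x" and d: "d \<in> charts_at N (act g x)"
  shows "bij (tmap c d (act g) x)"
proof (rule tmap_diffeo_bij[OF N_smooth_manifold N_smooth_manifold smooth_map_act[OF g] smooth_map_act[OF inv_closed[OF g]] _ _ c d])
  show "act (inv g) (act g z) = z" if "z \<in> points N" for z
    using act_mult[OF inv_closed[OF g] g that] act_one[OF that] g by simp
  show "act g (act (inv g) z) = z" if "z \<in> points N" for z
    using act_mult[OF g inv_closed[OF g] that] act_one[OF that] g by simp
qed

text \<open>The vector field on \<open>N\<close> induced by the Lie algebra element with components \<open>X\<close> in the chart \<open>c\<close>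
  at the unit, in the coordinates \<open>d\<close>. It is written as a partial derivative of the coordinate
  expression of the action, which makes it smooth in the point and linear in \<open>X\<close>.\<close>

definition fundamental_field :: "('g, 'e) chart \<Rightarrow> ('m, 'b) chart \<Rightarrow> 'e \<Rightarrow> 'b \<Rightarrow> 'b" where
  "fundamental_field c d X \<xi> = frechet_derivative (crd d \<circ> (\<lambda>(g, x). act g x) \<circ> crd_inv (prod_chart c d)) (at (crd c \<one>, \<xi>)) (X, 0)"

lemma fundamental_field_eq:
  assumes c: "c \<in> charts_at L \<one>" and d: "d \<in> charts_at N x"
  shows "fundamental_field c d X (crd d x) = tmap c d (\<lambda>g. act g x) \<one> X"
proof -
  have x: "x \<in> points N" using chart_subset_points[OF charted_N] charts_atD[OF d] by blast
  have pair: "smooth_map L (prod_mfd L N) (\<lambda>g. (g, x))"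
    by (rule smooth_map_Pair[OF charted_L charted_L charted_N smooth_map_id[OF L_smooth_manifold]
        smooth_map_const[OF charted_L charted_N x]])
  have d': "d \<in> charts_at N (case (\<one>, x) of (g, x) \<Rightarrow> act g x)" using act_one[OF x] d by simp
  have "tmap c d (\<lambda>g. case (g, x) of (g, x) \<Rightarrow> act g x) \<one> X =
     tmap (prod_chart c d) d (\<lambda>(g, x). act g x) (\<one>, x) (tmap c (prod_chart c d) (\<lambda>g. (g, x)) \<one> X)"
    by (rule tmap_compose[OF charted_L charted_prod[OF charted_L charted_N] pair act_smooth c
          prod_chart_at[OF c d] d'])
  also have "tmap c (prod_chart c d) (\<lambda>g. (g, x)) \<one> X = (X, 0)"
    using tmap_Pair[OF smooth_map_id[OF L_smooth_manifold] smooth_map_const[OF charted_L charted_N x] c c d]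
    by (simp add: tmap_id[OF charted_L c] tmap_const)
  finally show ?thesis by (simp add: fundamental_field_def tmap_def)
qed

lemma act_rep_smooth:
  assumes c: "c \<in> charts_at L \<one>" and d: "d \<in> atlas N"
  obtains W where "open W" "smooth_on W (crd d \<circ> (\<lambda>(g, x). act g x) \<circ> crd_inv (prod_chart c d))"
    "\<And>\<xi>. \<xi> \<in> crd d ` dom_of d \<Longrightarrow> (crd c \<one>, \<xi>) \<in> W"
proof (rule that)
  have pc: "prod_chart c d \<in> atlas (prod_mfd L N)"
    unfolding atlas_prod_mfd using charts_atD(1)[OF c] d by blast
  let ?W = "crd (prod_chart c d) ` {z \<in> dom_of (prod_chart c d). (\<lambda>(g, x). act g x) z \<in> dom_of d}"
  show "open ?W"
    by (rule smooth_map_domain_open[OF charted_prod[OF charted_L charted_N] charted_N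
        smooth_map_continuous[OF act_smooth] pc d])
  show "smooth_on ?W (crd d \<circ> (\<lambda>(g, x). act g x) \<circ> crd_inv (prod_chart c d))"
    by (rule smooth_map_rep[OF act_smooth pc d])
  fix \<xi> assume "\<xi> \<in> crd d ` dom_of d"
  then obtain x where x: "x \<in> dom_of d" "\<xi> = crd d x" by auto
  then have "act \<one> x = x" using act_one chart_subset_points[OF charted_N d] by blast
  then show "(crd c \<one>, \<xi>) \<in> ?W" using x charts_atD(2)[OF c] by (intro image_eqI[of _ _ "(\<one>, x)"]) auto
qed

lemma fundamental_field_smooth:
  assumes c: "c \<in> charts_at L \<one>" and d: "d \<in> atlas N"
  shows "smooth_on (crd d ` dom_of d) (fundamental_field c d X)"
proof -
  obtain W where W: "open W" "smooth_on W (crd d \<circ> (\<lambda>(g, x). act g x) \<circ> crd_inv (prod_chart c d))"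
    "\<And>\<xi>. \<xi> \<in> crd d ` dom_of d \<Longrightarrow> (crd c \<one>, \<xi>) \<in> W"
    using act_rep_smooth[OF assms] by blast
  have op: "open (crd d ` dom_of d)" by (rule chart_image_open[OF charted_N d])
  have "smooth_on (crd d ` dom_of d) (\<lambda>\<xi>. (crd c \<one>, \<xi>))"
    by (intro smooth_on_Pair op smooth_on_const smooth_on_id)
  moreover have "(\<lambda>\<xi>. (crd c \<one>, \<xi>)) ` (crd d ` dom_of d) \<subseteq> W" using W(3) by blast
  ultimately show ?thesis
    unfolding fundamental_field_def
    using smooth_on_compose[OF op W(1) _ _ smooth_on_frechet_derivative[OF W(2)]] by blast
qed

lemma linear_fundamental_field:
  assumes c: "c \<in> charts_at L \<one>" and d: "d \<in> atlas N" and \<xi>: "\<xi> \<in> crd d ` dom_of d"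
  shows "linear (\<lambda>X. fundamental_field c d X \<xi>)"
proof -
  obtain W where W: "open W" "smooth_on W (crd d \<circ> (\<lambda>(g, x). act g x) \<circ> crd_inv (prod_chart c d))"
    "\<And>\<xi>. \<xi> \<in> crd d ` dom_of d \<Longrightarrow> (crd c \<one>, \<xi>) \<in> W"
    using act_rep_smooth[OF assms(1,2)] by blast
  show ?thesis
    using linear_compose[OF linear_Pair_0(2) smooth_on_linear_derivative[OF W(2) W(3)[OF \<xi>]]]
    by (simp add: fundamental_field_def o_def)
qed

lemma smooth_map_act_curve:
  "smooth_map line L \<alpha> \<Longrightarrow> x \<in> points N \<Longrightarrow> smooth_map line N (\<lambda>t. act (\<alpha> t) x)"
  using smooth_map_compose[OF charted_line charted_L charted_N _ smooth_map_orbit] by (simp add: comp_def)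

text \<open>Orbits of one-parameter subgroups are integral curves of fundamental fields, as
  \<open>\<alpha>(t + s) x = \<alpha>(s) (\<alpha>(t) x)\<close>.\<close>

lemma velocity_one_ps_action:
  assumes \<alpha>: "one_parameter_subgroup G L \<alpha>" and x: "x \<in> points N"
    and c: "c \<in> charts_at L \<one>" and d: "d \<in> charts_at N (act (\<alpha> t) x)"
  shows "velocity N (\<lambda>t. act (\<alpha> t) x) t d = fundamental_field c d (velocity L \<alpha> 0 c) (crd d (act (\<alpha> t) x))"
proof -
  let ?y = "act (\<alpha> t) x"
  have y: "?y \<in> points N" using act_closed one_ps_closed[OF \<alpha>] x by blast
  have shift: "act (\<alpha> (t + s)) x = act (\<alpha> s) ?y" for s
    using one_ps_add[OF \<alpha>, of s t] act_mult one_ps_closed[OF \<alpha>] x by (simp add: add.commute)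
  have "velocity N (\<lambda>t. act (\<alpha> t) x) t = velocity N (\<lambda>s. act (\<alpha> s) ?y) 0"
    using velocity_shift[OF smooth_map_act_curve[OF one_ps_smooth[OF \<alpha>] x], of t] by (simp add: shift)
  moreover have "velocity N (\<lambda>s. act (\<alpha> s) ?y) 0 d = tmap c d (\<lambda>g. act g ?y) (\<alpha> 0) (velocity L \<alpha> 0 c)"
    by (rule velocity_compose[OF charted_L smooth_map_orbit[OF y] one_ps_smooth[OF \<alpha>] charted_N])
      (use c d act_one[OF y] one_ps_0[OF \<alpha>] in auto)
  ultimately show ?thesis using fundamental_field_eq[OF c d] by (simp add: one_ps_0[OF \<alpha>])
qed

end

section \<open>One-parameter subgroups\<close>

context lie_grp
begin

text \<open>For left multiplication the fundamental fields are the right-invariant fields, and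
  one-parameter subgroups are their integral curves through the unit.\<close>

lemma lie_action_mult: "lie_action G L L (\<otimes>)"
  by unfold_locales (use L_smooth_manifold mult_smooth carrier_L in \<open>auto simp: m_assoc\<close>)

interpretation left: lie_action G L L "(\<otimes>)"
  by (rule lie_action_mult)

abbreviation right_field :: "('g, 'e) chart \<Rightarrow> 'e \<Rightarrow> 'e \<Rightarrow> 'e" where
  "right_field c \<equiv> left.fundamental_field c c"

lemma one_ps_ode:
  assumes \<alpha>: "one_parameter_subgroup G L \<alpha>" and c: "c \<in> charts_at L \<one>" and t: "\<alpha> t \<in> dom_of c"
  shows "((crd c \<circ> \<alpha>) has_vector_derivative right_field c (velocity L \<alpha> 0 c) ((crd c \<circ> \<alpha>) t)) (at t)"
proof -
  have one: "\<one> \<in> points L" using carrier_L one_closed by blast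
  have ct: "c \<in> charts_at L (\<alpha> t)" using t charts_atD(1)[OF c] by (simp add: charts_at_def)
  have "velocity L (\<lambda>t. \<alpha> t \<otimes> \<one>) t c = right_field c (velocity L \<alpha> 0 c) (crd c (\<alpha> t \<otimes> \<one>))"
    by (rule left.velocity_one_ps_action[OF \<alpha> one c]) (use ct one_ps_closed[OF \<alpha>] in simp)
  then show ?thesis
    using velocity_has_vector_derivative[OF one_ps_smooth[OF \<alpha>] ct] one_ps_closed[OF \<alpha>] by simp
qed

lemma curve_near:
  assumes "continuous_map euclidean (mtop L) \<alpha>" "c \<in> charts_at L (\<alpha> 0)" "open B" "crd c (\<alpha> 0) \<in> B"
  obtains \<epsilon> :: real where "\<epsilon> > 0" "\<And>t. \<bar>t\<bar> < \<epsilon> \<Longrightarrow> \<alpha> t \<in> dom_of c \<and> crd c (\<alpha> t) \<in> B"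
proof -
  have "openin (mtop L) {x \<in> dom_of c. crd c x \<in> B}"
    by (rule chart_vimage_openin[OF charted_L charts_atD(1)[OF assms(2)] assms(3)])
  from openin_continuous_map_preimage[OF assms(1) this]
  have "open {t. \<alpha> t \<in> dom_of c \<and> crd c (\<alpha> t) \<in> B}" by simp
  moreover have "0 \<in> {t. \<alpha> t \<in> dom_of c \<and> crd c (\<alpha> t) \<in> B}"
    using assms charts_atD(2)[OF assms(2)] by simp
  ultimately obtain e where "e > 0" "ball 0 e \<subseteq> {t. \<alpha> t \<in> dom_of c \<and> crd c (\<alpha> t) \<in> B}"
    using open_contains_ball by blast
  then show ?thesis using that[of e] by (simp add: subset_iff)
qed

text \<open>Both subgroups solve the same differential equation near \<open>0\<close>, and the values near \<open>0\<close> determine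
  all others by \<open>\<alpha>(t) = \<alpha>(t/n)\<^sup>n\<close>.\<close>

lemma one_ps_unique:
  assumes \<alpha>: "one_parameter_subgroup G L \<alpha>" and \<beta>: "one_parameter_subgroup G L \<beta>"
    and eq: "velocity L \<alpha> 0 = velocity L \<beta> 0"
  shows "\<alpha> = \<beta>"
proof
  fix t
  obtain c where c: "c \<in> charts_at L \<one>" using chart_at_exists[OF charted_L] carrier_L one_closed by blast
  note c' = charts_atD[OF c]
  let ?U = "crd c ` dom_of c" and ?V = "right_field c (velocity L \<alpha> 0 c)"
  have U: "open ?U" by (rule chart_image_open[OF charted_L c'(1)])
  moreover have "crd c \<one> \<in> ?U" using c' by auto
  ultimately obtain r where r: "r > 0" "cball (crd c \<one>) r \<subseteq> ?U" using open_contains_cball by blast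
  obtain K where K: "\<And>x y. x \<in> cball (crd c \<one>) r \<Longrightarrow> y \<in> cball (crd c \<one>) r \<Longrightarrow> norm (?V x - ?V y) \<le> K * norm (x - y)"
    using smooth_on_lipschitz_cball[OF U left.fundamental_field_smooth[OF c c'(1)] r(2)] by blast
  have near: "\<exists>\<epsilon>>0. \<forall>t. \<bar>t\<bar> < \<epsilon> \<longrightarrow> \<gamma> t \<in> dom_of c \<and> crd c (\<gamma> t) \<in> cball (crd c \<one>) r"
    if \<gamma>: "one_parameter_subgroup G L \<gamma>" for \<gamma>
  proof -
    have "continuous_map euclidean (mtop L) \<gamma>"
      using one_ps_smooth[OF \<gamma>] by (simp add: smooth_map_line_iff)
    then obtain e where "e > 0" "\<And>t. \<bar>t\<bar> < e \<Longrightarrow> \<gamma> t \<in> dom_of c \<and> crd c (\<gamma> t) \<in> ball (crd c \<one>) r"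
      using curve_near[of \<gamma> c "ball (crd c \<one>) r"] c r one_ps_0[OF \<gamma>] by (metis centre_in_ball open_ball)
    then show ?thesis by (intro exI[of _ e]) (auto intro: less_imp_le)
  qed
  obtain e1 e2 where e: "e1 > 0" "e2 > 0"
    "\<And>t. \<bar>t\<bar> < e1 \<Longrightarrow> \<alpha> t \<in> dom_of c \<and> crd c (\<alpha> t) \<in> cball (crd c \<one>) r"
    "\<And>t. \<bar>t\<bar> < e2 \<Longrightarrow> \<beta> t \<in> dom_of c \<and> crd c (\<beta> t) \<in> cball (crd c \<one>) r"
    using near[OF \<alpha>] near[OF \<beta>] by metis
  define e where "e = min e1 e2"
  have small: "\<alpha> s = \<beta> s" if "\<bar>s\<bar> < e" for s
  proof -
    have "(crd c \<circ> \<alpha>) s = (crd c \<circ> \<beta>) s"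
    proof (rule ode_unique[where B = "cball (crd c \<one>) r" and V = ?V and L = K and e = e])
      show "((crd c \<circ> \<alpha>) has_vector_derivative ?V ((crd c \<circ> \<alpha>) s)) (at s) \<and> (crd c \<circ> \<alpha>) s \<in> cball (crd c \<one>) r"
        if "\<bar>s\<bar> < e" for s using e(3)[of s] that one_ps_ode[OF \<alpha> c, of s] by (auto simp: e_def)
      show "((crd c \<circ> \<beta>) has_vector_derivative ?V ((crd c \<circ> \<beta>) s)) (at s) \<and> (crd c \<circ> \<beta>) s \<in> cball (crd c \<one>) r"
        if "\<bar>s\<bar> < e" for s using e(4)[of s] that one_ps_ode[OF \<beta> c, of s] eq by (auto simp: e_def)
    qed (use K that one_ps_0[OF \<alpha>] one_ps_0[OF \<beta>] in auto)
    then show ?thesis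
      using e(3)[of s] e(4)[of s] that chart_inj[OF charted_L c'(1)] by (auto simp: e_def inj_on_def)
  qed
  define n where "n = Suc (nat \<lceil>\<bar>t\<bar> / e\<rceil>)"
  have e0: "e > 0" using e by (simp add: e_def)
  have "\<bar>t / real n\<bar> < e" by (rule abs_divide_less[OF e0]) (simp add: n_def)
  then have "\<alpha> (real n * (t / real n)) = \<beta> (real n * (t / real n))"
    unfolding one_ps_pow[OF \<alpha>] one_ps_pow[OF \<beta>] by (simp add: small)
  then show "\<alpha> t = \<beta> t" by (simp add: n_def)
qed

lemma smooth_map_right_mult: "h \<in> carrier G \<Longrightarrow> smooth_map L L (\<lambda>g. g \<otimes> h)"
  using left.smooth_map_orbit carrier_L by blast

text \<open>Differentiates the associative law \<open>(zg)h = z(gh)\<close> in \<open>z\<close> at the unit.\<close>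

lemma right_field_invariant:
  assumes c: "c \<in> charts_at L \<one>" and g: "g \<in> dom_of c" and h: "h \<in> carrier G" and gh: "g \<otimes> h \<in> dom_of c"
  shows "tmap c c (\<lambda>g. g \<otimes> h) g (right_field c X (crd c g)) = right_field c X (crd c (g \<otimes> h))"
proof -
  note c' = charts_atD[OF c]
  have gG: "g \<in> carrier G" using chart_subset_points[OF charted_L c'(1)] g carrier_L by blast
  have cg: "c \<in> charts_at L g" "c \<in> charts_at L (g \<otimes> h)" using c' g gh by (auto simp: charts_at_def)
  have "tmap c c (\<lambda>z. (z \<otimes> g) \<otimes> h) \<one> X = tmap c c (\<lambda>g. g \<otimes> h) (\<one> \<otimes> g) (tmap c c (\<lambda>z. z \<otimes> g) \<one> X)"
    by (rule tmap_compose[OF charted_L charted_L smooth_map_right_mult[OF gG] smooth_map_right_mult[OF h] c])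
      (use cg gG in auto)
  moreover have "tmap c c (\<lambda>z. (z \<otimes> g) \<otimes> h) \<one> = tmap c c (\<lambda>z. z \<otimes> (g \<otimes> h)) \<one>"
    by (rule tmap_cong_points[OF charted_L c]) (use gG h carrier_L m_assoc in auto)
  ultimately show ?thesis
    using left.fundamental_field_eq[OF c cg(1)] left.fundamental_field_eq[OF c cg(2)] gG by simp
qed

text \<open>A short integral curve \<open>a\<close> of the right-invariant field through the unit is a local homomorphism:
  both \<open>s \<mapsto> a(s)a(t)\<close> and \<open>s \<mapsto> a(s + t)\<close> are integral curves through \<open>a(t)\<close>, the first by
  right invariance. It extends to a homomorphism \<open>\<alpha>\<close>, which near \<open>t0\<close> is the smooth curve
  \<open>t \<mapsto> a(t - t0)\<alpha>(t0)\<close>.\<close>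

lemma one_ps_exists:
  assumes X: "X \<in> tangent_space L \<one>"
  obtains \<alpha> where "one_parameter_subgroup G L \<alpha>" "velocity L \<alpha> 0 = X"
proof -
  have one: "\<one> \<in> points L" using carrier_L one_closed by blast
  obtain c where c: "c \<in> charts_at L \<one>" using chart_at_exists[OF charted_L one] by blast
  note c' = charts_atD[OF c]
  define U where "U = crd c ` dom_of c"
  define u0 where "u0 = crd c \<one>"
  define V where "V = right_field c (X c)"
  have U: "open U" "u0 \<in> U" using chart_image_open[OF charted_L c'(1)] c'(2) by (auto simp: U_def u0_def)
  have V: "smooth_on U V" unfolding U_def V_def by (rule left.fundamental_field_smooth[OF c c'(1)])
  have V0: "V u0 = X c"
  proof -
    have "tmap c c (\<lambda>g. g \<otimes> \<one>) \<one> = tmap c c (\<lambda>g. g) \<one>"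
      by (rule tmap_cong_points[OF charted_L c]) (use carrier_L in auto)
    then show ?thesis
      using left.fundamental_field_eq[OF c c, of "X c"] tmap_id[OF charted_L c] by (simp add: V_def u0_def)
  qed
  obtain r where r: "r > 0" "cball u0 r \<subseteq> U" using U open_contains_cball by blast
  obtain K where K: "\<And>x y. x \<in> cball u0 r \<Longrightarrow> y \<in> cball u0 r \<Longrightarrow> norm (V x - V y) \<le> K * norm (x - y)"
    using smooth_on_lipschitz_cball[OF U(1) V r(2)] by metis
  obtain e u where e: "e > 0" and u0: "u 0 = u0" and ub: "\<And>t. \<bar>t\<bar> < e \<Longrightarrow> u t \<in> cball u0 r"
    and u': "\<And>t. \<bar>t\<bar> < e \<Longrightarrow> (u has_vector_derivative V (u t)) (at t)"
    using ode_local_existence[OF U(1) r(2,1) V] by metis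
  define a where "a = (\<lambda>t. crd_inv c (u t))"
  have a: "a t \<in> dom_of c" "crd c (a t) = u t" if "\<bar>t\<bar> < e" for t
    using ub[OF that] r by (auto simp: a_def U_def inv_into_into f_inv_into_f subset_iff)
  have aG: "a t \<in> carrier G" if "\<bar>t\<bar> < e" for t
    using a(1)[OF that] chart_subset_points[OF charted_L c'(1)] carrier_L by blast
  have a0: "a 0 = \<one>" using chart_inv[OF charted_L c'] by (simp add: a_def u0 u0_def)
  \<comment> \<open>By continuity of the multiplication, products of elements close to the unit stay in the part of
    the chart where the field is Lipschitz.\<close>
  obtain \<delta> where \<delta>: "\<delta> > 0" and prod: "\<And>g h. g \<in> dom_of c \<Longrightarrow> h \<in> dom_of c \<Longrightarrow> crd c g \<in> ball u0 \<delta> \<Longrightarrow>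
      crd c h \<in> ball u0 \<delta> \<Longrightarrow> g \<otimes> h \<in> dom_of c \<and> crd c (g \<otimes> h) \<in> ball u0 r"
  proof -
    let ?B = "{x \<in> dom_of c. crd c x \<in> ball u0 r}"
    let ?P = "dom_of (prod_chart c c) \<inter> {z \<in> points (prod_mfd L L). (\<lambda>(g, h). g \<otimes> h) z \<in> ?B}"
    have pc: "prod_chart c c \<in> atlas (prod_mfd L L)" unfolding atlas_prod_mfd using c'(1) by blast
    note cp = charted_prod[OF charted_L charted_L]
    have "openin (mtop (prod_mfd L L)) ?P"
      by (intro openin_Int chart_openin[OF cp pc]
          openin_continuous_map_preimage[OF smooth_map_continuous[OF mult_smooth]]
          chart_vimage_openin[OF charted_L c'(1)]) simp
    then have "open (crd (prod_chart c c) ` ?P)" using chart_openin_iff[OF cp pc, of ?P] by blast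
    moreover have "(u0, u0) \<in> crd (prod_chart c c) ` ?P"
      using c' one r by (intro image_eqI[of _ _ "(\<one>, \<one>)"]) (auto simp: u0_def prod_mfd_def)
    ultimately obtain A B where AB: "open A" "open B" "(u0, u0) \<in> A \<times> B" "A \<times> B \<subseteq> crd (prod_chart c c) ` ?P"
      by (rule open_prod_elim)
    have "open (A \<inter> B)" "u0 \<in> A \<inter> B" using AB by auto
    then obtain \<delta> where \<delta>: "\<delta> > 0" "ball u0 \<delta> \<subseteq> A \<inter> B" using open_contains_ball by blast
    show ?thesis
    proof (rule that[OF \<delta>(1)])
      fix g h assume gh: "g \<in> dom_of c" "h \<in> dom_of c" "crd c g \<in> ball u0 \<delta>" "crd c h \<in> ball u0 \<delta>"
      then have "(crd c g, crd c h) \<in> crd (prod_chart c c) ` ?P" using \<delta>(2) AB(4) by blast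
      then obtain g' h' where gh': "(g', h') \<in> ?P" "crd c g' = crd c g" "crd c h' = crd c h" by auto
      have "g' = g" "h' = h"
        using gh' gh chart_inj[OF charted_L c'(1)] by (auto simp: inj_on_def)
      then show "g \<otimes> h \<in> dom_of c \<and> crd c (g \<otimes> h) \<in> ball u0 r" using gh'(1) by auto
    qed
  qed
  have "isCont u 0" using u'[of 0] e has_vector_derivative_continuous by auto
  then obtain \<epsilon>0 where \<epsilon>0: "\<epsilon>0 > 0" "\<And>t. \<bar>t\<bar> < \<epsilon>0 \<Longrightarrow> dist (u t) (u 0) < \<delta>"
    using \<delta> unfolding continuous_at_eps_delta by (metis diff_zero dist_real_def)
  define \<epsilon> where "\<epsilon> = min (e / 2) \<epsilon>0"
  have \<epsilon>: "\<epsilon> > 0" "\<epsilon> \<le> e / 2" "\<epsilon> \<le> \<epsilon>0" "\<epsilon> < e" using e \<epsilon>0 by (auto simp: \<epsilon>_def)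
  have aa: "a s \<otimes> a t \<in> dom_of c" "crd c (a s \<otimes> a t) \<in> cball u0 r" if "\<bar>s\<bar> < \<epsilon>" "\<bar>t\<bar> < \<epsilon>" for s t
  proof -
    have "a s \<otimes> a t \<in> dom_of c \<and> crd c (a s \<otimes> a t) \<in> ball u0 r"
      by (rule prod) (use a \<epsilon>0(2)[of s] \<epsilon>0(2)[of t] \<epsilon> that in \<open>auto simp: u0 dist_commute\<close>)
    then show "a s \<otimes> a t \<in> dom_of c" "crd c (a s \<otimes> a t) \<in> cball u0 r" by auto
  qed
  have add: "a (s + t) = a s \<otimes> a t" if s: "\<bar>s\<bar> < \<epsilon>" and t: "\<bar>t\<bar> < \<epsilon>" for s t
  proof -
    let ?h = "a t"
    have h: "?h \<in> carrier G" using aG t \<epsilon> by simp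
    have "crd c (a s \<otimes> ?h) = u (t + s)"
    proof (rule ode_unique[where u = "\<lambda>s. crd c (a s \<otimes> ?h)" and v = "\<lambda>s. u (t + s)" and B = "cball u0 r" and V = V and L = K and e = \<epsilon>])
      fix s assume s: "\<bar>s\<bar> < \<epsilon>"
      have se: "\<bar>s\<bar> < e" and ts: "\<bar>t + s\<bar> < e" using s t \<epsilon> by auto
      show "((\<lambda>s. u (t + s)) has_vector_derivative V (u (t + s))) (at s) \<and> u (t + s) \<in> cball u0 r"
        using u'[OF ts] ub[OF ts] has_vector_derivative_shift by blast
      have cs: "c \<in> charts_at L (a s)" "c \<in> charts_at L (a s \<otimes> ?h)"
        using c'(1) a(1)[OF se] aa(1)[OF s t] by (auto simp: charts_at_def)
      let ?T = "tmap c c (\<lambda>g. g \<otimes> ?h) (a s)"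
      have T: "((crd c \<circ> (\<lambda>g. g \<otimes> ?h) \<circ> crd_inv c) has_derivative ?T) (at (u s))"
        using tmap_has_derivative[OF smooth_map_right_mult[OF h] cs] a(2)[OF se] by simp
      have "((\<lambda>s. crd c (a s \<otimes> ?h)) has_derivative (\<lambda>k. ?T (k *\<^sub>R V (u s)))) (at s)"
        using diff_chain_at[OF u'[OF se, unfolded has_vector_derivative_def] T] by (simp add: o_def a_def)
      then have "((\<lambda>s. crd c (a s \<otimes> ?h)) has_vector_derivative ?T (V (u s))) (at s)"
        by (simp add: has_vector_derivative_def linear_scale[OF has_derivative_linear[OF T]])
      moreover have "?T (V (u s)) = V (crd c (a s \<otimes> ?h))"
        using right_field_invariant[OF c a(1)[OF se] h aa(1)[OF s t], of "X c"] a(2)[OF se] by (simp add: V_def)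
      ultimately show "((\<lambda>s. crd c (a s \<otimes> ?h)) has_vector_derivative V (crd c (a s \<otimes> ?h))) (at s) \<and> crd c (a s \<otimes> ?h) \<in> cball u0 r"
        using aa(2)[OF s t] by simp
    next
      show "crd c (a 0 \<otimes> ?h) = u (t + 0)" using a0 h a(2)[of t] t \<epsilon> by simp
    qed (use K s in auto)
    also have "\<dots> = crd c (a (s + t))" using a(2)[of "s + t"] s t \<epsilon> by (simp add: add.commute)
    finally show ?thesis
      using chart_inj[OF charted_L c'(1)] aa(1)[OF s t] a(1)[of "s + t"] s t \<epsilon> by (auto simp: inj_on_def)
  qed
  obtain \<alpha> where \<alpha>: "\<And>t. \<alpha> t \<in> carrier G" "\<And>s t. \<alpha> (s + t) = \<alpha> s \<otimes> \<alpha> t" "\<And>t. \<bar>t\<bar> < \<epsilon> \<Longrightarrow> \<alpha> t = a t"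
  proof (rule local_hom_extends[OF \<epsilon>(1), of a])
    show "a t \<in> carrier G" if "\<bar>t\<bar> < \<epsilon>" for t using aG that \<epsilon> by simp
    show "a (s + t) = a s \<otimes> a t" if "\<bar>s\<bar> < \<epsilon>" "\<bar>t\<bar> < \<epsilon>" "\<bar>s + t\<bar> < \<epsilon>" for s t
      using add that by simp
    fix \<alpha> :: "real \<Rightarrow> 'g"
    assume "\<And>t. \<alpha> t \<in> carrier G" "\<And>s t. \<alpha> (s + t) = \<alpha> s \<otimes> \<alpha> t" "\<And>t. \<bar>t\<bar> < \<epsilon> \<Longrightarrow> \<alpha> t = a t"
    then show thesis by (rule that)
  qed
  have u_smooth: "smooth_on {-\<epsilon><..<\<epsilon>} u"
    by (rule ode_solution_smooth[OF _ U(1) V]) (use u' ub r \<epsilon> in \<open>auto simp: subset_iff\<close>)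
  let ?w = "\<lambda>t0 t. u (t - t0)"
  have w_smooth: "smooth_on (ball t0 \<epsilon>) (?w t0)" for t0 :: real
  proof (rule smooth_on_compose[OF _ _ _ _ u_smooth])
    have "smooth_on (ball t0 \<epsilon>) (\<lambda>t. t + (- t0))" by (intro smooth_on_add smooth_on_id smooth_on_const) auto
    then show "smooth_on (ball t0 \<epsilon>) (\<lambda>t. t - t0)" by simp
  qed (auto simp: dist_real_def)
  have near: "\<exists>T. open T \<and> t0 \<in> T \<and> T \<subseteq> ball t0 \<epsilon> \<and> (\<forall>t\<in>T. \<alpha> t \<in> W \<and> ?w t0 t \<in> crd c ` {g \<in> dom_of c. g \<otimes> \<alpha> t0 \<in> W})"
    if W: "openin (mtop L) W" "\<alpha> t0 \<in> W" for W t0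
  proof -
    let ?D = "dom_of c \<inter> {g \<in> points L. g \<otimes> \<alpha> t0 \<in> W}"
    have D: "?D = {g \<in> dom_of c. g \<otimes> \<alpha> t0 \<in> W}" using chart_subset_points[OF charted_L c'(1)] by auto
    have "openin (mtop L) ?D"
      by (intro openin_Int chart_openin[OF charted_L c'(1)]
          openin_continuous_map_preimage[OF smooth_map_continuous[OF smooth_map_right_mult] W(1)] \<alpha>)
    then have Q: "open (crd c ` ?D)" using chart_openin_iff[OF charted_L c'(1), of ?D] by blast
    let ?T = "ball t0 \<epsilon> \<inter> ?w t0 -` (crd c ` ?D)"
    have "open ?T"
      by (rule continuous_open_preimage[OF smooth_on_imp_continuous_on[OF w_smooth] open_ball Q])
    moreover have "t0 \<in> ?T"
      using \<epsilon>(1) c'(2) one W \<alpha>(1)[of t0] by (auto simp: u0 u0_def intro!: image_eqI[of _ _ "\<one>"])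
    moreover have "\<alpha> t \<in> W" if t: "t \<in> ?T" for t
    proof -
      obtain g where g: "g \<in> dom_of c" "g \<otimes> \<alpha> t0 \<in> W" "u (t - t0) = crd c g" using t by auto
      have "a (t - t0) = g" using chart_inv[OF charted_L c'(1) g(1)] by (simp add: a_def g)
      moreover have "\<alpha> t = \<alpha> (t - t0) \<otimes> \<alpha> t0" using \<alpha>(2)[of "t - t0" t0] by simp
      ultimately show ?thesis using \<alpha>(3)[of "t - t0"] g t by (auto simp: dist_real_def abs_minus_commute)
    qed
    ultimately show ?thesis unfolding D by (intro exI[of _ ?T]) (auto simp: D)
  qed
  have "smooth_map line L \<alpha>"
    unfolding smooth_map_line_iff
  proof (intro conjI ballI)
    show "continuous_map euclidean (mtop L) \<alpha>"
      unfolding continuous_map_def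
    proof (intro conjI allI impI)
      show "\<alpha> \<in> topspace euclidean \<rightarrow> points L" using \<alpha>(1) carrier_L by auto
      fix W assume W: "openin (mtop L) W"
      have "open {t. \<alpha> t \<in> W}"
      proof (subst open_subopen, intro ballI)
        fix t0 assume "t0 \<in> {t. \<alpha> t \<in> W}"
        then obtain T where "open T" "t0 \<in> T" "\<forall>t\<in>T. \<alpha> t \<in> W" using near[OF W, of t0] by auto
        then show "\<exists>T. open T \<and> t0 \<in> T \<and> T \<subseteq> {t. \<alpha> t \<in> W}" by (intro exI[of _ T]) auto
      qed
      then show "openin euclidean {t \<in> topspace euclidean. \<alpha> t \<in> W}" by simp
    qed
    fix d assume d: "d \<in> atlas L"
    show "smooth_on {t. \<alpha> t \<in> dom_of d} (crd d \<circ> \<alpha>)"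
    proof (rule smooth_on_local)
      fix t0 assume t0: "t0 \<in> {t. \<alpha> t \<in> dom_of d}"
      let ?Q = "crd c ` {g \<in> dom_of c. g \<otimes> \<alpha> t0 \<in> dom_of d}"
      obtain T where T: "open T" "t0 \<in> T" "T \<subseteq> ball t0 \<epsilon>" "\<And>t. t \<in> T \<Longrightarrow> ?w t0 t \<in> ?Q"
        using near[OF chart_openin[OF charted_L d], of t0] t0 by blast
      note sr = smooth_map_right_mult[OF \<alpha>(1)[of t0]]
      have "smooth_on T (\<lambda>t. (crd d \<circ> (\<lambda>g. g \<otimes> \<alpha> t0) \<circ> crd_inv c) (?w t0 t))"
      proof (rule smooth_on_compose[OF T(1) _ _ smooth_on_subset[OF w_smooth T(3)] smooth_map_rep[OF sr c'(1) d]])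
        show "open ?Q" by (rule smooth_map_domain_open[OF charted_L charted_L smooth_map_continuous[OF sr] c'(1) d])
        show "?w t0 ` T \<subseteq> ?Q" using T(4) by blast
      qed
      moreover have "(crd d \<circ> (\<lambda>g. g \<otimes> \<alpha> t0) \<circ> crd_inv c) (?w t0 t) = (crd d \<circ> \<alpha>) t" if "t \<in> T" for t
      proof -
        have "\<alpha> t = \<alpha> (t - t0) \<otimes> \<alpha> t0" using \<alpha>(2)[of "t - t0" t0] by simp
        moreover have "\<bar>t - t0\<bar> < \<epsilon>" using T(3) that by (auto simp: dist_real_def)
        ultimately show ?thesis using \<alpha>(3)[of "t - t0"] by (simp add: a_def)
      qed
      ultimately have "smooth_on T (crd d \<circ> \<alpha>)"
        by (rule smooth_on_cong[OF T(1), THEN iffD1, rotated])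
      then show "\<exists>T. open T \<and> t0 \<in> T \<and> smooth_on T (crd d \<circ> \<alpha>)" using T by blast
    qed
  qed
  then have ops: "one_parameter_subgroup G L \<alpha>" using \<alpha>(2) by (simp add: one_parameter_subgroup_def)
  have \<alpha>0: "\<alpha> 0 = \<one>" by (rule one_ps_0[OF ops])
  have "velocity L \<alpha> 0 = X"
  proof (rule tangent_vector_eqI[OF _ X c])
    show "velocity L \<alpha> 0 \<in> tangent_space L \<one>"
      using velocity_in_tangent_space[OF L_smooth_manifold one_ps_smooth[OF ops], of 0] \<alpha>0 by simp
    have "(u has_vector_derivative V (u 0)) (at 0)" by (rule u') (use e in simp)
    then have "((crd c \<circ> \<alpha>) has_vector_derivative V (u 0)) (at 0)"
      by (rule has_vector_derivative_transform_within_open[where S = "{-\<epsilon><..<\<epsilon>}"])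
        (use \<epsilon> a(2) \<alpha>(3) in auto)
    then show "velocity L \<alpha> 0 c = X c"
      using c by (simp add: velocity_def \<alpha>0 vector_derivative_at u0 V0)
  qed
  then show ?thesis by (rule that[OF ops])
qed

lemma lie_exp_one_ps:
  assumes \<alpha>: "one_parameter_subgroup G L \<alpha>"
  shows "lie_exp G L (tscale t (velocity L \<alpha> 0)) = \<alpha> t"
proof -
  let ?\<beta> = "\<lambda>s. \<alpha> (s * t)"
  have "smooth_map line line (\<lambda>s. s * t)"
    unfolding smooth_map_line_iff
    using smooth_on_linear[OF open_UNIV bounded_linear_mult_left[of t] smooth_on_id[OF open_UNIV]]
    by (auto simp: open_mfd_def comp_def id_def intro!: continuous_intros)
  from smooth_map_compose[OF charted_line charted_line charted_L this one_ps_smooth[OF \<alpha>]]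
  have sm: "smooth_map line L ?\<beta>" by (simp add: comp_def)
  have \<beta>: "one_parameter_subgroup G L ?\<beta>"
    unfolding one_parameter_subgroup_def using sm one_ps_add[OF \<alpha>] by (simp add: distrib_right)
  have vel: "velocity L ?\<beta> 0 = tscale t (velocity L \<alpha> 0)"
  proof
    fix c
    show "velocity L ?\<beta> 0 c = tscale t (velocity L \<alpha> 0) c"
    proof (cases "c \<in> charts_at L (\<alpha> 0)")
      case True
      have "((\<lambda>s. s * t) has_vector_derivative t) (at 0)" by (auto intro!: derivative_eq_intros)
      moreover have "((crd c \<circ> \<alpha>) has_vector_derivative velocity L \<alpha> 0 c) (at (0 * t))"
        using velocity_has_vector_derivative[OF one_ps_smooth[OF \<alpha>], of c 0] True by simp
      ultimately have "((crd c \<circ> \<alpha>) \<circ> (\<lambda>s. s * t) has_vector_derivative t *\<^sub>R velocity L \<alpha> 0 c) (at 0)"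
        by (rule vector_diff_chain_at)
      then show ?thesis
        using True by (simp add: velocity_def tscale_def comp_def vector_derivative_at)
    qed (simp add: velocity_def tscale_def)
  qed
  have "(THE \<alpha>'. one_parameter_subgroup G L \<alpha>' \<and> velocity L \<alpha>' 0 = tscale t (velocity L \<alpha> 0)) = ?\<beta>"
  proof (rule the_equality)
    show "one_parameter_subgroup G L ?\<beta> \<and> velocity L ?\<beta> 0 = tscale t (velocity L \<alpha> 0)"
      using \<beta> vel by (rule conjI)
    fix \<alpha>' assume "one_parameter_subgroup G L \<alpha>' \<and> velocity L \<alpha>' 0 = tscale t (velocity L \<alpha> 0)"
    then show "\<alpha>' = ?\<beta>" using one_ps_unique[of \<alpha>' ?\<beta>] \<beta> vel by metis
  qed
  then show ?thesis by (simp add: lie_exp_def)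
qed

end

section \<open>Orbit maps of transitive actions\<close>

context lie_action
begin

text \<open>The orbit map \<open>f\<close> satisfies \<open>f(gh) = g f(h)\<close>, and left translation by \<open>g\<close> is a diffeomorphism on
  both sides, so the rank at \<open>g\<close> is the rank at the unit.\<close>

lemma rank_orbit_constant:
  assumes p: "p \<in> points N" and c0: "c0 \<in> charts_at L \<one>" and d0: "d0 \<in> charts_at N p"
    and g: "g \<in> carrier G" and c: "c \<in> charts_at L g" and d: "d \<in> charts_at N (act g p)"
  shows "dim (range (tmap c d (\<lambda>g. act g p) g)) = dim (range (tmap c0 d0 (\<lambda>g. act g p) \<one>))"
proof -
  interpret left: lie_action G L L "(\<otimes>)" by (rule lie_action_mult)
  let ?f = "\<lambda>g. act g p"
  let ?A = "tmap d0 d (act g) p" and ?B = "tmap c0 c ((\<otimes>) g) \<one>"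
  note f = smooth_map_orbit[OF p]
  have d0': "d0 \<in> charts_at N (?f \<one>)" using d0 act_one[OF p] by simp
  have c': "c \<in> charts_at L (g \<otimes> \<one>)" using c g by simp
  have "tmap c0 d (\<lambda>h. ?f (g \<otimes> h)) \<one> v = tmap c d ?f (g \<otimes> \<one>) (?B v)" for v
    by (rule tmap_compose[OF charted_L charted_L left.smooth_map_act[OF g] f c0 c']) (use d g in simp)
  moreover have "tmap c0 d (\<lambda>h. act g (?f h)) \<one> v = tmap d0 d (act g) (?f \<one>) (tmap c0 d0 ?f \<one> v)" for v
    by (rule tmap_compose[OF charted_L charted_N f smooth_map_act[OF g] c0 d0']) (use d act_one[OF p] in simp)
  moreover have "tmap c0 d (\<lambda>h. ?f (g \<otimes> h)) \<one> = tmap c0 d (\<lambda>h. act g (?f h)) \<one>"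
    by (rule tmap_cong_points[OF charted_L c0]) (use act_mult[OF g _ p] carrier_L in simp)
  ultimately have eq: "tmap c d ?f g (?B v) = ?A (tmap c0 d0 ?f \<one> v)" for v
    using g act_one[OF p] by simp
  have "surj ?B" using left.tmap_act_bij[OF g c0 c'] bij_is_surj by blast
  then have "range (tmap c d ?f g) = (\<lambda>v. tmap c d ?f g (?B v)) ` UNIV" by (metis image_image)
  also have "\<dots> = ?A ` range (tmap c0 d0 ?f \<one>)" by (simp add: eq image_image)
  finally have "dim (range (tmap c d ?f g)) = dim (?A ` range (tmap c0 d0 ?f \<one>))" by simp
  also have "\<dots> = dim (range (tmap c0 d0 ?f \<one>))"
  proof (rule dim_image_eq)
    show "linear ?A" by (rule linear_tmap[OF smooth_map_act[OF g] d0 d])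
    show "inj_on ?A (span (range (tmap c0 d0 ?f \<one>)))"
      using tmap_act_bij[OF g d0 d] bij_is_inj inj_on_subset by blast
  qed
  finally show ?thesis .
qed

text \<open>If the derivative at the unit were not onto, then the rank would be smaller than the dimension
  everywhere, so locally the image is a null set. Countably many such pieces cover the preimage of a
  chart domain, whose coordinate image is a nonempty open set and not null.\<close>

lemma orbit_map_submersion:
  assumes trans: "\<And>x. x \<in> points N \<Longrightarrow> \<exists>g\<in>carrier G. act g p = x"
    and p: "p \<in> points N" and c0: "c0 \<in> charts_at L \<one>" and d0: "d0 \<in> charts_at N p"
  shows "surj (tmap c0 d0 (\<lambda>g. act g p) \<one>)"
proof (rule ccontr)
  let ?f = "\<lambda>g. act g p"
  let ?T = "tmap c0 d0 ?f \<one>"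
  note f = smooth_map_orbit[OF p] and d0' = charts_atD[OF d0]
  assume ns: "\<not> surj ?T"
  have "linear ?T" by (rule linear_tmap[OF f c0]) (use d0 act_one[OF p] in simp)
  then have "subspace (range ?T)" using linear_subspace_image subspace_UNIV by blast
  then have "dim (range ?T) \<noteq> DIM('b)"
    using ns dim_eq_full[of "range ?T"] by (metis span_eq_iff)
  then have k: "dim (range ?T) < DIM('b)" using dim_subset_UNIV[of "range ?T"] by linarith
  let ?O = "{g \<in> points L. ?f g \<in> dom_of d0}"
  have O: "openin (mtop L) ?O"
    by (rule openin_continuous_map_preimage[OF smooth_map_continuous[OF f] chart_openin[OF charted_N d0'(1)]])
  have local: "\<exists>B. openin (mtop L) B \<and> g \<in> B \<and> B \<subseteq> ?O \<and> negligible ((crd d0 \<circ> ?f) ` B)" if g: "g \<in> ?O" for g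
  proof -
    obtain c where c: "c \<in> charts_at L g" using chart_at_exists[OF charted_L] g by blast
    note c' = charts_atD[OF c]
    let ?r = "crd d0 \<circ> ?f \<circ> crd_inv c"
    let ?S = "crd c ` {h \<in> dom_of c. ?f h \<in> dom_of d0}"
    have S: "open ?S" by (rule smooth_map_domain_open[OF charted_L charted_N smooth_map_continuous[OF f] c'(1) d0'(1)])
    have gS: "crd c g \<in> ?S" using g c' by auto
    have rank: "dim (range (frechet_derivative ?r (at \<xi>))) = dim (range ?T)" if \<xi>: "\<xi> \<in> ?S" for \<xi>
    proof -
      obtain h where h: "h \<in> dom_of c" "?f h \<in> dom_of d0" "\<xi> = crd c h" using \<xi> by auto
      have "h \<in> carrier G" using chart_subset_points[OF charted_L c'(1)] h carrier_L by blast
      from rank_orbit_constant[OF p c0 d0 this, of c d0] show ?thesis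
        using h c'(1) d0'(1) by (simp add: tmap_def charts_at_def)
    qed
    obtain W where W: "open W" "crd c g \<in> W" "W \<subseteq> ?S" "negligible (?r ` W)"
      using constant_rank_image_negligible[OF S gS smooth_map_rep[OF f c'(1) d0'(1)] rank k] by blast
    let ?B = "{h \<in> dom_of c. crd c h \<in> W}"
    have B1: "openin (mtop L) ?B" by (rule chart_vimage_openin[OF charted_L c'(1) W(1)])
    have B2: "?B \<subseteq> ?O"
    proof
      fix h assume h: "h \<in> ?B"
      then obtain h' where "h' \<in> dom_of c" "?f h' \<in> dom_of d0" "crd c h = crd c h'" using W(3) by blast
      then have "?f h \<in> dom_of d0" using h chart_inj[OF charted_L c'(1)] by (auto simp: inj_on_def)
      then show "h \<in> ?O" using h chart_subset_points[OF charted_L c'(1)] by blast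
    qed
    have "(crd d0 \<circ> ?f) ` ?B \<subseteq> ?r ` W"
    proof
      fix y assume "y \<in> (crd d0 \<circ> ?f) ` ?B"
      then obtain h where "h \<in> dom_of c" "crd c h \<in> W" "y = crd d0 (?f h)" by auto
      then show "y \<in> ?r ` W" using chart_inv[OF charted_L c'(1)] by (intro image_eqI[of _ _ "crd c h"]) auto
    qed
    then have "negligible ((crd d0 \<circ> ?f) ` ?B)" by (rule negligible_subset[OF W(4)])
    moreover have "g \<in> ?B" using W(2) c'(2) by simp
    ultimately show ?thesis using B1 B2 by (intro exI[of _ ?B] conjI)
  qed
  have "second_countable_space (mtop L)" using L_smooth_manifold by (simp add: smooth_manifold_def)
  then obtain \<B> where \<B>: "countable \<B>" "\<forall>B\<in>\<B>. openin (mtop L) B"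
    "\<forall>U. openin (mtop L) U \<longrightarrow> (\<exists>\<C>\<subseteq>\<B>. U = \<Union>\<C>)"
    unfolding second_countable_space_def by (elim exE conjE) (rule that)
  let ?\<C> = "{B \<in> \<B>. B \<subseteq> ?O \<and> negligible ((crd d0 \<circ> ?f) ` B)}"
  have cover: "?O \<subseteq> \<Union>?\<C>"
  proof
    fix g assume "g \<in> ?O"
    then obtain B where B: "openin (mtop L) B" "g \<in> B" "B \<subseteq> ?O" "negligible ((crd d0 \<circ> ?f) ` B)"
      using local by blast
    then obtain \<D> where "\<D> \<subseteq> \<B>" "B = \<Union>\<D>" using \<B>(3) by blast
    then obtain B' where "B' \<in> \<B>" "g \<in> B'" "B' \<subseteq> B" using B(2) by blast
    moreover have "negligible ((crd d0 \<circ> ?f) ` B')"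
      by (rule negligible_subset[OF B(4)]) (use \<open>B' \<subseteq> B\<close> in blast)
    ultimately show "g \<in> \<Union>?\<C>" using B(3) by blast
  qed
  have "negligible (\<Union>((\<lambda>B. (crd d0 \<circ> ?f) ` B) ` ?\<C>))"
  proof (rule negligible_countable_Union)
    show "countable ((\<lambda>B. (crd d0 \<circ> ?f) ` B) ` ?\<C>)"
      by (intro countable_image countable_subset[OF _ \<B>(1)]) auto
  qed auto
  moreover have "crd d0 ` dom_of d0 \<subseteq> \<Union>((\<lambda>B. (crd d0 \<circ> ?f) ` B) ` ?\<C>)"
  proof
    fix y assume "y \<in> crd d0 ` dom_of d0"
    then obtain x where x: "x \<in> dom_of d0" "y = crd d0 x" by auto
    then obtain g where "g \<in> carrier G" "?f g = x"
      using trans chart_subset_points[OF charted_N d0'(1)] by blast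
    then have "g \<in> ?O" using x carrier_L by auto
    then obtain B where "B \<in> ?\<C>" "g \<in> B" using cover by blast
    moreover have "y = (crd d0 \<circ> ?f) g" using \<open>?f g = x\<close> x by simp
    ultimately show "y \<in> \<Union>((\<lambda>B. (crd d0 \<circ> ?f) ` B) ` ?\<C>)" by blast
  qed
  ultimately have "negligible (crd d0 ` dom_of d0)" by (rule negligible_subset)
  moreover have "open (crd d0 ` dom_of d0)" by (rule chart_image_open[OF charted_N d0'(1)])
  moreover have "crd d0 ` dom_of d0 \<noteq> {}" using d0'(2) by blast
  ultimately show False using open_not_negligible by blast
qed

end

section \<open>Flows of isometries of a Finsler space\<close>

locale finsler_action = lie_action G L M act
  for G :: "'g monoid" (structure) and L :: "('g, 'e::euclidean_space) mfd"
    and M :: "('m, real^'n::finite) mfd" and act :: "'g \<Rightarrow> 'm \<Rightarrow> 'm" +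
  fixes F :: "('m, real^'n) tb_fun"
  assumes metric: "finsler_metric M F"
    and isometry: "g \<in> carrier G \<Longrightarrow> x \<in> points M \<Longrightarrow> v \<in> tangent_space M x \<Longrightarrow>
      F (act g x) (pushforward M M (act g) x v) = F x v"
begin

lemma local_finsler_chart:
  assumes c: "c \<in> atlas M"
  shows "local_finsler (crd c ` dom_of c) (local_metric M F c)"
proof
  show "open (crd c ` dom_of c)" by (rule chart_image_open[OF charted_N c])
  show "smooth_on (crd c ` dom_of c \<times> (UNIV - {0})) (\<lambda>(x, y). local_metric M F c x y)"
    using metric c by (simp add: finsler_metric_def)
  fix \<xi> assume "\<xi> \<in> crd c ` dom_of c"
  then obtain x where x: "x \<in> dom_of c" "\<xi> = crd c x" by auto
  then have "x \<in> points M" "c \<in> charts_at M x"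
    using c chart_subset_points[OF charted_N c] by (auto simp: charts_at_def)
  then have "minkowski_norm (\<lambda>y. F x (tvec_of M c x y))"
    using metric unfolding finsler_metric_def by blast
  moreover have "local_metric M F c \<xi> = (\<lambda>y. F x (tvec_of M c x y))"
    using chart_inv[OF charted_N c x(1)] by (auto simp: local_metric_def x(2))
  ultimately show "minkowski_norm (local_metric M F c \<xi>)" by simp
qed

lemma F_in_chart:
  assumes "c \<in> charts_at M x" "v \<in> tangent_space M x"
  shows "F x v = local_metric M F c (crd c x) (v c)"
  using tvec_of_component[OF N_smooth_manifold assms] chart_inv[OF charted_N charts_atD[OF assms(1)]]
  by (simp add: local_metric_def)

lemma local_metric_isometry:
  assumes g: "g \<in> carrier G" and c: "c \<in> charts_at M x" and d: "d \<in> charts_at M (act g x)"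
  shows "local_metric M F d (crd d (act g x)) (tmap c d (act g) x y) = local_metric M F c (crd c x) y"
proof -
  let ?v = "tvec_of M c x y" and ?w = "tvec_of M d (act g x) (tmap c d (act g) x y)"
  have x: "x \<in> points M" using chart_subset_points[OF charted_N charts_atD(1)[OF c]] charts_atD(2)[OF c] by blast
  note v = tvec_of_in_tangent_space[OF N_smooth_manifold c, of y]
  note w = tvec_of_in_tangent_space[OF N_smooth_manifold d, of "tmap c d (act g) x y"]
  have "pushforward M M (act g) x ?v = ?w"
    by (rule pushforward_eqI[OF N_smooth_manifold N_smooth_manifold smooth_map_act[OF g] v c d w])
      (simp add: tvec_of_self[OF N_smooth_manifold] c d)
  then have "F (act g x) ?w = F x ?v" using isometry[OF g x v] by simp
  then show ?thesis
    using F_in_chart[OF c v] F_in_chart[OF d w] tvec_of_self[OF N_smooth_manifold c] tvec_of_self[OF N_smooth_manifold d]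
    by simp
qed

end

text \<open>The action of a one-parameter subgroup \<open>\<alpha>\<close> by isometries; the chart \<open>e\<close> at the unit serves to
  express its velocity vector.\<close>

locale killing_flow = finsler_action G L M act F
  for G :: "'g monoid" (structure) and L :: "('g, 'e::euclidean_space) mfd"
    and M :: "('m, real^'n::finite) mfd" and act :: "'g \<Rightarrow> 'm \<Rightarrow> 'm" and F :: "('m, real^'n) tb_fun" +
  fixes \<alpha> :: "real \<Rightarrow> 'g" and e :: "('g, 'e) chart"
  assumes one_ps: "one_parameter_subgroup G L \<alpha>" and e: "e \<in> charts_at L \<one>"
begin

lemma \<alpha>_closed: "\<alpha> t \<in> carrier G"
  by (rule one_ps_closed[OF one_ps])

lemma smooth_orbit: "x \<in> points M \<Longrightarrow> smooth_map line M (\<lambda>t. act (\<alpha> t) x)"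
  by (rule smooth_map_act_curve[OF one_ps_smooth[OF one_ps]])

lemma act_\<alpha>_closed: "x \<in> points M \<Longrightarrow> act (\<alpha> t) x \<in> points M"
  by (rule act_closed[OF \<alpha>_closed])

lemma act_\<alpha>_0: "x \<in> points M \<Longrightarrow> act (\<alpha> 0) x = x"
  using act_one by (simp add: one_ps_0[OF one_ps])

lemma act_\<alpha>_add: "x \<in> points M \<Longrightarrow> act (\<alpha> (s + t)) x = act (\<alpha> s) (act (\<alpha> t) x)"
  using act_mult[OF \<alpha>_closed \<alpha>_closed] by (simp add: one_ps_add[OF one_ps])

definition killing_field :: "'m \<Rightarrow> ('m, real^'n) tvec" where
  "killing_field x = velocity M (\<lambda>t. act (\<alpha> t) x) 0"

definition field_coords :: "('m, real^'n) chart \<Rightarrow> real^'n \<Rightarrow> real^'n" where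
  "field_coords d = fundamental_field e d (velocity L \<alpha> 0 e)"

lemma killing_field_tangent: "x \<in> points M \<Longrightarrow> killing_field x \<in> tangent_space M x"
  using velocity_in_tangent_space[OF N_smooth_manifold smooth_orbit, of x 0] act_\<alpha>_0 by (simp add: killing_field_def)

lemma chart_point: "d \<in> charts_at M x \<Longrightarrow> x \<in> points M"
  using chart_subset_points[OF charted_N charts_atD(1)] charts_atD(2) by (metis subsetD)

lemma killing_field_in_chart:
  assumes d: "d \<in> charts_at M x"
  shows "killing_field x d = field_coords d (crd d x)"
proof -
  have x: "x \<in> points M" by (rule chart_point[OF d])
  have "d \<in> charts_at M (act (\<alpha> 0) x)" using d act_\<alpha>_0[OF x] by simp
  from velocity_one_ps_action[OF one_ps x e this] show ?thesis
    by (simp add: killing_field_def field_coords_def act_\<alpha>_0[OF x])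
qed

lemma velocity_orbit: "x \<in> points M \<Longrightarrow> velocity M (\<lambda>t. act (\<alpha> t) x) t = killing_field (act (\<alpha> t) x)"
  using velocity_shift[OF smooth_orbit, of x t] act_\<alpha>_add[of x _ t]
  by (simp add: killing_field_def add.commute[of t])

text \<open>The group need not be commutative, but the isometries \<open>\<alpha>(s)\<close> and \<open>\<alpha>(t)\<close> commute, so each preserves the
  field of the flow.\<close>

lemma killing_field_equivariant:
  assumes c: "c \<in> charts_at M x" and d: "d \<in> charts_at M (act (\<alpha> t) x)"
  shows "killing_field (act (\<alpha> t) x) d = tmap c d (act (\<alpha> t)) x (killing_field x c)"
proof -
  have x: "x \<in> points M" by (rule chart_point[OF c])
  have "act (\<alpha> s) (act (\<alpha> t) x) = act (\<alpha> t) (act (\<alpha> s) x)" for s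
    using act_\<alpha>_add[OF x, of s t] act_\<alpha>_add[OF x, of t s] by (simp add: add.commute)
  then have "killing_field (act (\<alpha> t) x) d = velocity M (\<lambda>s. act (\<alpha> t) (act (\<alpha> s) x)) 0 d"
    by (simp add: killing_field_def)
  also have "\<dots> = tmap c d (act (\<alpha> t)) (act (\<alpha> 0) x) (velocity M (\<lambda>s. act (\<alpha> s) x) 0 c)"
    by (rule velocity_compose[OF charted_N smooth_map_act[OF \<alpha>_closed] smooth_orbit[OF x] charted_N])
      (use c d act_\<alpha>_0[OF x] in auto)
  finally show ?thesis by (simp add: killing_field_def act_\<alpha>_0[OF x])
qed

lemma F_field_invariant:
  assumes x: "x \<in> points M"
  shows "F (act (\<alpha> t) x) (killing_field (act (\<alpha> t) x)) = F x (killing_field x)"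
proof -
  obtain c where c: "c \<in> charts_at M x" using chart_at_exists[OF charted_N x] by blast
  obtain d where d: "d \<in> charts_at M (act (\<alpha> t) x)" using chart_at_exists[OF charted_N act_\<alpha>_closed[OF x]] by blast
  have "pushforward M M (act (\<alpha> t)) x (killing_field x) = killing_field (act (\<alpha> t) x)"
    by (rule pushforward_eqI[OF N_smooth_manifold N_smooth_manifold smooth_map_act[OF \<alpha>_closed]
          killing_field_tangent[OF x] c d killing_field_tangent[OF act_\<alpha>_closed[OF x]] killing_field_equivariant[OF c d]])
  then show ?thesis using isometry[OF \<alpha>_closed x killing_field_tangent[OF x], of t] by simp
qed

definition nonzero_domain :: "('m, real^'n) chart \<Rightarrow> (real^'n) set" where
  "nonzero_domain d = {\<xi> \<in> crd d ` dom_of d. field_coords d \<xi> \<noteq> 0}"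

text \<open>The speed of the orbits as a function of the coordinates.\<close>

definition speed :: "('m, real^'n) chart \<Rightarrow> real^'n \<Rightarrow> real" where
  "speed d \<xi> = local_metric M F d \<xi> (field_coords d \<xi>)"

lemma field_coords_smooth: "d \<in> atlas M \<Longrightarrow> smooth_on (crd d ` dom_of d) (field_coords d)"
  unfolding field_coords_def by (rule fundamental_field_smooth[OF e])

lemma nonzero_domain_open: assumes d: "d \<in> atlas M" shows "open (nonzero_domain d)"
proof -
  have "nonzero_domain d = crd d ` dom_of d \<inter> field_coords d -` (UNIV - {0})" by (auto simp: nonzero_domain_def)
  moreover have "open (crd d ` dom_of d \<inter> field_coords d -` (UNIV - {0}))"
    by (rule continuous_open_preimage[OF smooth_on_imp_continuous_on[OF field_coords_smooth[OF d]] chart_image_open[OF charted_N d]]) auto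
  ultimately show ?thesis by simp
qed

lemma field_coords_smooth_nonzero: "d \<in> atlas M \<Longrightarrow> smooth_on (nonzero_domain d) (field_coords d)"
  by (rule smooth_on_subset[OF field_coords_smooth]) (auto simp: nonzero_domain_def)

lemma speed_eq: "d \<in> charts_at M x \<Longrightarrow> speed d (crd d x) = F x (killing_field x)"
  using F_in_chart[of d x "killing_field x"] killing_field_tangent[OF chart_point] killing_field_in_chart by (simp add: speed_def)

lemma speed_smooth:
  assumes d: "d \<in> atlas M"
  shows "smooth_on (nonzero_domain d) (speed d)"
proof -
  interpret lf: local_finsler "crd d ` dom_of d" "local_metric M F d" by (rule local_finsler_chart[OF d])
  have "smooth_on (nonzero_domain d) (\<lambda>\<xi>. (\<xi>, field_coords d \<xi>))"
    by (intro smooth_on_Pair nonzero_domain_open[OF d] smooth_on_id field_coords_smooth_nonzero[OF d])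
  moreover have "(\<lambda>\<xi>. (\<xi>, field_coords d \<xi>)) ` nonzero_domain d \<subseteq> crd d ` dom_of d \<times> (UNIV - {0})" by (auto simp: nonzero_domain_def)
  ultimately have "smooth_on (nonzero_domain d) (\<lambda>\<xi>. (\<lambda>(x, y). local_metric M F d x y) (\<xi>, field_coords d \<xi>))"
    by (intro smooth_on_compose[OF nonzero_domain_open[OF d] _ _ _ lf.smooth_L]) (auto intro: open_Times lf.open_S)
  then show ?thesis by (simp add: speed_def[abs_def])
qed

lemma speed_pos: assumes d: "d \<in> atlas M" and \<xi>: "\<xi> \<in> nonzero_domain d" shows "speed d \<xi> > 0"
proof -
  interpret lf: local_finsler "crd d ` dom_of d" "local_metric M F d" by (rule local_finsler_chart[OF d])
  show ?thesis using lf.metric_pos \<xi> by (auto simp: speed_def nonzero_domain_def)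
qed

text \<open>The speed is constant along each orbit because the flow consists of isometries that preserve
  its field.\<close>

lemma speed_derivative_along_flow:
  assumes d: "d \<in> charts_at M x" and nz: "killing_field x d \<noteq> 0"
  shows "frechet_derivative (speed d) (at (crd d x)) (field_coords d (crd d x)) = 0"
proof -
  have x: "x \<in> points M" by (rule chart_point[OF d])
  note d' = charts_atD[OF d]
  let ?\<gamma> = "\<lambda>t. act (\<alpha> t) x"
  have d0: "d \<in> charts_at M (?\<gamma> 0)" using d act_\<alpha>_0[OF x] by simp
  have xV: "crd d x \<in> nonzero_domain d" using nz d'(2) killing_field_in_chart[OF d] by (auto simp: nonzero_domain_def)
  have "((crd d \<circ> ?\<gamma>) has_vector_derivative field_coords d (crd d x)) (at 0)"
    using velocity_has_vector_derivative[OF smooth_orbit[OF x] d0] velocity_orbit[OF x, of 0]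
      killing_field_in_chart[OF d] act_\<alpha>_0[OF x] by simp
  moreover have "(speed d has_derivative frechet_derivative (speed d) (at (crd d x))) (at ((crd d \<circ> ?\<gamma>) 0))"
    using smooth_on_has_derivative[OF speed_smooth[OF d'(1)] xV] act_\<alpha>_0[OF x] by simp
  ultimately have 1: "(speed d \<circ> (crd d \<circ> ?\<gamma>) has_derivative (\<lambda>h. frechet_derivative (speed d) (at (crd d x)) (h *\<^sub>R field_coords d (crd d x)))) (at 0)"
    unfolding has_vector_derivative_def using diff_chain_at[of "crd d \<circ> ?\<gamma>"] by (fastforce simp: comp_def)
  have "open {t. ?\<gamma> t \<in> dom_of d}"
  proof -
    have "continuous_map euclidean (mtop M) ?\<gamma>" using smooth_orbit[OF x] by (simp add: smooth_map_line_iff)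
    from openin_continuous_map_preimage[OF this chart_openin[OF charted_N d'(1)]] show ?thesis by simp
  qed
  moreover have "speed d ((crd d \<circ> ?\<gamma>) t) = F x (killing_field x)" if "?\<gamma> t \<in> dom_of d" for t
    using speed_eq[of d "?\<gamma> t"] F_field_invariant[OF x, of t] that d'(1) by (simp add: charts_at_def)
  ultimately have "(speed d \<circ> (crd d \<circ> ?\<gamma>) has_derivative (\<lambda>h. 0)) (at 0)"
    using has_derivative_transform_within_open[OF has_derivative_const[of "F x (killing_field x)" "at 0"], of "{t. ?\<gamma> t \<in> dom_of d}" "speed d \<circ> (crd d \<circ> ?\<gamma>)"]
      d'(2) act_\<alpha>_0[OF x] by simp
  from has_derivative_unique[OF 1 this] show ?thesis by (metis scaleR_one)
qed

text \<open>The second derivative of the orbit through \<open>x\<close> in the chart \<open>d\<close>.\<close>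

definition acceleration :: "('m, real^'n) chart \<Rightarrow> 'm \<Rightarrow> real^'n" where
  "acceleration d x = frechet_derivative (field_coords d) (at (crd d x)) (field_coords d (crd d x))"

lemma energy_derivative_along_flow:
  assumes d: "d \<in> charts_at M x" and nz: "killing_field x d \<noteq> 0"
  shows "frechet_derivative (local_finsler.E (local_metric M F d)) (at (crd d x, field_coords d (crd d x)))
    (field_coords d (crd d x), acceleration d x) = 0"
proof -
  note d' = charts_atD[OF d]
  interpret lf: local_finsler "crd d ` dom_of d" "local_metric M F d" by (rule local_finsler_chart[OF d'(1)])
  let ?x = "crd d x" and ?D = "frechet_derivative (field_coords d) (at (crd d x))"
  have xV: "?x \<in> nonzero_domain d" using nz d'(2) killing_field_in_chart[OF d] by (auto simp: nonzero_domain_def)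
  then have x\<Omega>: "(?x, field_coords d ?x) \<in> lf.\<Omega>" by (auto simp: nonzero_domain_def)
  have dK: "(field_coords d has_derivative ?D) (at ?x)" by (rule smooth_on_has_derivative[OF field_coords_smooth_nonzero[OF d'(1)] xV])
  have "((\<lambda>\<xi>. (\<xi>, field_coords d \<xi>)) has_derivative (\<lambda>h. (h, ?D h))) (at ?x)"
    by (intro has_derivative_Pair has_derivative_ident dK)
  from diff_chain_at[OF this smooth_on_has_derivative[OF lf.smooth_E x\<Omega>]]
  have 1: "((\<lambda>\<xi>. lf.E (\<xi>, field_coords d \<xi>)) has_derivative (\<lambda>h. frechet_derivative lf.E (at (?x, field_coords d ?x)) (h, ?D h))) (at ?x)"
    by (simp add: o_def)
  have Espeed: "lf.E (\<xi>, field_coords d \<xi>) = (1/2) * (speed d \<xi>)\<^sup>2" for \<xi> by (simp add: lf.E_def speed_def)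
  have "((\<lambda>\<xi>. (1/2) * (speed d \<xi>)\<^sup>2) has_derivative (\<lambda>h. speed d ?x * frechet_derivative (speed d) (at ?x) h)) (at ?x)"
    using smooth_on_has_derivative[OF speed_smooth[OF d'(1)] xV]
    by (auto intro!: derivative_eq_intros)
  then have "((\<lambda>\<xi>. lf.E (\<xi>, field_coords d \<xi>)) has_derivative (\<lambda>h. speed d ?x * frechet_derivative (speed d) (at ?x) h)) (at ?x)"
    unfolding Espeed .
  from fun_cong[OF has_derivative_unique[OF 1 this], of "field_coords d ?x"] show ?thesis
    using speed_derivative_along_flow[OF d nz] by (simp add: acceleration_def)
qed

text \<open>The isometry \<open>\<alpha>(t)\<close> carries the orbit to itself, so in coordinates it maps position, velocity and
  acceleration at \<open>x\<close> to those at \<open>\<alpha>(t)x\<close>. For the acceleration this is the derivative of the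
  equivariance of the field along itself.\<close>

lemma euler_lagrange_along_orbit:
  assumes c: "c \<in> charts_at M x" and nz: "killing_field x c \<noteq> 0"
    and EL: "\<And>w. euler_lagrange (local_finsler.E (local_metric M F c)) w (crd c x) (field_coords c (crd c x)) (acceleration c x) = 0"
    and d: "d \<in> charts_at M (act (\<alpha> t) x)"
  shows "euler_lagrange (local_finsler.E (local_metric M F d)) w (crd d (act (\<alpha> t) x))
     (field_coords d (crd d (act (\<alpha> t) x))) (acceleration d (act (\<alpha> t) x)) = 0"
proof -
  note c' = charts_atD[OF c] and d' = charts_atD[OF d]
  interpret lc: local_finsler "crd c ` dom_of c" "local_metric M F c" by (rule local_finsler_chart[OF c'(1)])
  interpret ld: local_finsler "crd d ` dom_of d" "local_metric M F d" by (rule local_finsler_chart[OF d'(1)])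
  let ?a = "act (\<alpha> t)"
  let ?U = "crd c ` {z \<in> dom_of c. ?a z \<in> dom_of d}"
  let ?f = "crd d \<circ> ?a \<circ> crd_inv c"
  let ?D = "\<lambda>\<xi>. frechet_derivative ?f (at \<xi>)"
  let ?\<Omega> = "?U \<times> (UNIV - {0 :: real^'n})"
  note sa = smooth_map_act[OF \<alpha>_closed[of t]]
  have U: "open ?U" "smooth_on ?U ?f"
    using smooth_map_domain_open[OF charted_N charted_N smooth_map_continuous[OF sa] c'(1) d'(1)]
      smooth_map_rep[OF sa c'(1) d'(1)] by auto
  have D: "?D (crd c z) = tmap c d ?a z" for z by (simp add: tmap_def)
  have f: "?f (crd c z) = crd d (?a z)" if "z \<in> dom_of c" for z using chart_inv[OF charted_N c'(1) that] by simp
  have ch: "c \<in> charts_at M z" "d \<in> charts_at M (?a z)" if "z \<in> dom_of c" "?a z \<in> dom_of d" for z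
    using that c'(1) d'(1) by (auto simp: charts_at_def)
  let ?x = "crd c x" and ?y = "field_coords c (crd c x)"
  have xU: "?x \<in> ?U" using c' d' by auto
  have y0: "?y \<noteq> 0" using nz killing_field_in_chart[OF c] by simp
  have cov: "euler_lagrange ld.E (?D ?x w) (?f ?x) (?D ?x ?y)
      (frechet_derivative (\<lambda>z. ?D z ?y) (at ?x) ?y + ?D ?x (acceleration c x)) = euler_lagrange lc.E w ?x ?y (acceleration c x)" for w
  proof (rule euler_lagrange_covariant[OF _ _ ld.open_\<Omega> ld.smooth_E U])
    show "open ?\<Omega>" by (intro open_Times open_Diff closed_singleton open_UNIV U(1))
    show "smooth_on ?\<Omega> lc.E" by (rule smooth_on_subset[OF lc.smooth_E]) (auto simp: lc.\<Omega>_def)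
    show "(?x, ?y) \<in> ?\<Omega>" using xU y0 by simp
    fix \<xi> y assume "(\<xi>, y) \<in> ?\<Omega>"
    then obtain z where z: "z \<in> dom_of c" "?a z \<in> dom_of d" "\<xi> = crd c z" and y: "y \<noteq> 0" by auto
    have "?D \<xi> y \<noteq> 0"
      using tmap_act_bij[OF \<alpha>_closed ch[OF z(1,2)]] linear_tmap[OF sa ch[OF z(1,2)]] y
      unfolding z(3) D by (metis bij_is_inj injD linear_0)
    then show "(?f \<xi>, ?D \<xi> y) \<in> ld.\<Omega>" using z f[OF z(1)] by auto
    show "ld.E (?f \<xi>, ?D \<xi> y) = lc.E (\<xi>, y)"
      using local_metric_isometry[OF \<alpha>_closed ch[OF z(1,2)], of y] f[OF z(1)]
      unfolding z(3) D by (simp add: ld.E_def lc.E_def)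
  qed auto
  have fx: "?f ?x = crd d (?a x)" using f c' by simp
  have Ky: "field_coords d (?f \<xi>) = ?D \<xi> (field_coords c \<xi>)" if \<xi>: "\<xi> \<in> ?U" for \<xi>
  proof -
    obtain z where z: "z \<in> dom_of c" "?a z \<in> dom_of d" "\<xi> = crd c z" using \<xi> by auto
    show ?thesis
      using killing_field_equivariant[OF ch[OF z(1,2)]] killing_field_in_chart[OF ch(1)[OF z(1,2)]]
        killing_field_in_chart[OF ch(2)[OF z(1,2)]] f[OF z(1)] unfolding z(3) D by simp
  qed
  have acc: "frechet_derivative (\<lambda>z. ?D z ?y) (at ?x) ?y + ?D ?x (acceleration c x) = acceleration d (?a x)"
  proof -
    have "((\<lambda>\<xi>. (\<xi>, field_coords c \<xi>)) has_derivative (\<lambda>h. (h, frechet_derivative (field_coords c) (at ?x) h))) (at ?x)"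
      using smooth_on_has_derivative[OF field_coords_smooth[OF c'(1)], of ?x] c'(2)
      by (intro has_derivative_Pair has_derivative_ident) auto
    from diff_chain_at[OF this has_derivative_derivative_pairing[OF U(1) xU U(2), of ?y]]
    have 1: "((\<lambda>\<xi>. ?D \<xi> (field_coords c \<xi>)) has_derivative
        (\<lambda>h. frechet_derivative (\<lambda>z. ?D z ?y) (at ?x) h + ?D ?x (frechet_derivative (field_coords c) (at ?x) h))) (at ?x)"
      by (simp add: o_def)
    have "(field_coords d has_derivative frechet_derivative (field_coords d) (at (crd d (?a x)))) (at (?f ?x))"
      unfolding fx by (rule smooth_on_has_derivative[OF field_coords_smooth[OF d'(1)]]) (use d'(2) in auto)
    from diff_chain_at[OF smooth_on_has_derivative[OF U(2) xU] this]
    have "((\<lambda>\<xi>. field_coords d (?f \<xi>)) has_derivative (\<lambda>h. frechet_derivative (field_coords d) (at (crd d (?a x))) (?D ?x h))) (at ?x)"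
      by (simp add: o_def)
    then have "((\<lambda>\<xi>. ?D \<xi> (field_coords c \<xi>)) has_derivative (\<lambda>h. frechet_derivative (field_coords d) (at (crd d (?a x))) (?D ?x h))) (at ?x)"
      by (rule has_derivative_transform_within_open[OF _ U(1) xU]) (rule Ky)
    from fun_cong[OF has_derivative_unique[OF 1 this], of ?y] show ?thesis
      using Ky[OF xU] unfolding fx acceleration_def by simp
  qed
  obtain w' where w': "?D ?x w' = w"
    using tmap_act_bij[OF \<alpha>_closed c d] unfolding D by (metis bij_pointE)
  show ?thesis using cov[of w'] EL[of w'] Ky[OF xU] unfolding w' acc fx by simp
qed

definition unit_field :: "'m \<Rightarrow> ('m, real^'n) tvec" where
  "unit_field x = tscale (1 / F x (killing_field x)) (killing_field x)"

text \<open>Dividing by \<open>F\<close> only multiplies by a constant here, since the derivative of the speed along the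
  field vanishes.\<close>

lemma nabla_unit_field:
  assumes nz: "killing_field x \<noteq> tzero"
    and EL: "\<And>d w. d \<in> charts_at M x \<Longrightarrow> euler_lagrange (local_finsler.E (local_metric M F d)) w (crd d x)
     (field_coords d (crd d x)) (acceleration d x) = 0" and x: "x \<in> points M"
  shows "nabla M F killing_field killing_field unit_field x = tzero"
proof
  fix d
  show "nabla M F killing_field killing_field unit_field x d = tzero d"
  proof (cases "d \<in> charts_at M x")
    case d: True
    note d' = charts_atD[OF d]
    interpret lf: local_finsler "crd d ` dom_of d" "local_metric M F d" by (rule local_finsler_chart[OF d'(1)])
    let ?x = "crd d x" and ?y = "field_coords d (crd d x)" and ?a = "acceleration d x"
    have fx: "killing_field x d = ?y" by (rule killing_field_in_chart[OF d])
    have y0: "?y \<noteq> 0" using nz tangent_vector_eq_0_iff[OF N_smooth_manifold killing_field_tangent[OF x] d] fx by simp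
    have xV: "?x \<in> nonzero_domain d" using y0 d'(2) by (auto simp: nonzero_domain_def)
    have uf: "unit_field (crd_inv d \<xi>) d = inverse (speed d \<xi>) *\<^sub>R field_coords d \<xi>" if \<xi>: "\<xi> \<in> nonzero_domain d" for \<xi>
    proof -
      obtain z where z: "z \<in> dom_of d" "\<xi> = crd d z" using \<xi> by (auto simp: nonzero_domain_def)
      then have "d \<in> charts_at M z" using d'(1) by (simp add: charts_at_def)
      then show ?thesis
        using speed_eq[of d z] killing_field_in_chart[of d z] chart_inv[OF charted_N d'(1) z(1)] z(2)
        by (simp add: unit_field_def tscale_def inverse_eq_divide)
    qed
    have \<kappa>: "speed d ?x \<noteq> 0" using speed_pos[OF d'(1) xV] by simp
    have comp: "frechet_derivative (\<lambda>\<xi>. unit_field (crd_inv d \<xi>) d $ i) (at ?x) ?y = inverse (speed d ?x) * ?a $ i" for i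
    proof -
      note dspeed = smooth_on_has_derivative[OF speed_smooth[OF d'(1)] xV] and dK = smooth_on_has_derivative[OF field_coords_smooth_nonzero[OF d'(1)] xV]
      have "((\<lambda>\<xi>. inverse (speed d \<xi>) * field_coords d \<xi> $ i) has_derivative
         (\<lambda>h. inverse (speed d ?x) * frechet_derivative (field_coords d) (at ?x) h $ i
            + - (inverse (speed d ?x) * frechet_derivative (speed d) (at ?x) h * inverse (speed d ?x)) * ?y $ i)) (at ?x)"
        by (intro has_derivative_mult Deriv.has_derivative_inverse[OF \<kappa> dspeed] bounded_linear.has_derivative[OF bounded_linear_vec_nth dK])
      then have "((\<lambda>\<xi>. unit_field (crd_inv d \<xi>) d $ i) has_derivative
         (\<lambda>h. inverse (speed d ?x) * frechet_derivative (field_coords d) (at ?x) h $ i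
            + - (inverse (speed d ?x) * frechet_derivative (speed d) (at ?x) h * inverse (speed d ?x)) * ?y $ i)) (at ?x)"
        by (rule has_derivative_transform_within_open[OF _ nonzero_domain_open[OF d'(1)] xV]) (simp add: uf)
      then show ?thesis
        using speed_derivative_along_flow[OF d] y0 fx by (simp add: frechet_derivative_eqI acceleration_def)
    qed
    have geo: "?a $ i + (\<Sum>j\<in>UNIV. \<Sum>k\<in>UNIV. ?y $ j * ?y $ k * chern (local_metric M F d) i j k ?x ?y) = 0" for i
      by (rule lf.euler_lagrange_imp_geodesic_equation[OF _ y0 EL[OF d]]) (use d'(2) in auto)
    have ufx: "unit_field x d = inverse (speed d ?x) *\<^sub>R ?y"
      using uf[OF xV] chart_inv[OF charted_N d'] by simp
    have "nabla M F killing_field killing_field unit_field x d $ i = 0" for i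
    proof -
      have "nabla M F killing_field killing_field unit_field x d $ i = inverse (speed d ?x) * ?a $ i +
          (\<Sum>j\<in>UNIV. \<Sum>k\<in>UNIV. inverse (speed d ?x) * (?y $ j * ?y $ k * chern (local_metric M F d) i j k ?x ?y))"
        using d by (simp add: nabla_def fx comp ufx mult.assoc)
      also have "\<dots> = inverse (speed d ?x) * (?a $ i + (\<Sum>j\<in>UNIV. \<Sum>k\<in>UNIV. ?y $ j * ?y $ k * chern (local_metric M F d) i j k ?x ?y))"
        by (simp only: sum_distrib_left distrib_left)
      finally show ?thesis by (simp add: geo)
    qed
    then show ?thesis by (simp add: tzero_def vec_eq_iff)
  qed (simp add: nabla_def tzero_def)
qed

text \<open>The field of the flow extends the velocity of the orbit to a neighbourhood of the whole orbit,
  also when the orbit returns to a point. The set where the field does not vanish is the domain of all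
  three extensions.\<close>

lemma orbit_affine_geodesic:
  assumes x: "x \<in> points M" and nz: "killing_field x \<noteq> tzero"
    and c: "c \<in> charts_at M x"
    and EL: "\<And>w. euler_lagrange (local_finsler.E (local_metric M F c)) w (crd c x) (field_coords c (crd c x)) (acceleration c x) = 0"
  shows "affine_geodesic M F UNIV (\<lambda>t. act (\<alpha> t) x)"
proof -
  let ?\<gamma> = "\<lambda>t. act (\<alpha> t) x"
  let ?U = "{z \<in> points M. killing_field z \<noteq> tzero}"
  have fc: "killing_field z = tzero \<longleftrightarrow> field_coords d (crd d z) = 0" if "d \<in> charts_at M z" for d z
    using tangent_vector_eq_0_iff[OF N_smooth_manifold killing_field_tangent[OF chart_point[OF that]] that]
      killing_field_in_chart[OF that] by simp
  have UV: "?U \<inter> dom_of d = {z \<in> dom_of d. crd d z \<in> nonzero_domain d}" if d: "d \<in> atlas M" for d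
    using fc[of d] d chart_subset_points[OF charted_N d] by (auto simp: charts_at_def nonzero_domain_def)
  have image: "crd d ` (?U \<inter> dom_of d) = nonzero_domain d" if d: "d \<in> atlas M" for d
    unfolding UV[OF d] by (auto simp: nonzero_domain_def)
  have "?U = (\<Union>d\<in>atlas M. {z \<in> dom_of d. crd d z \<in> nonzero_domain d})"
  proof -
    have "?U = (\<Union>d\<in>atlas M. ?U \<inter> dom_of d)" using charted_N by (auto simp: charted_def)
    then show ?thesis using UV by auto
  qed
  moreover have "openin (mtop M) (\<Union>d\<in>atlas M. {z \<in> dom_of d. crd d z \<in> nonzero_domain d})"
    using chart_vimage_openin[OF charted_N _ nonzero_domain_open] by blast
  ultimately have U: "openin (mtop M) ?U" by simp
  have killing_field_smooth: "smooth_vector_field M ?U killing_field"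
    unfolding smooth_vector_field_def
  proof (intro conjI ballI)
    fix d assume d: "d \<in> atlas M"
    have "killing_field (crd_inv d \<xi>) d = field_coords d \<xi>" if \<xi>: "\<xi> \<in> nonzero_domain d" for \<xi>
    proof -
      obtain z where z: "z \<in> dom_of d" "\<xi> = crd d z" using \<xi> by (auto simp: nonzero_domain_def)
      then show ?thesis using killing_field_in_chart[of d z] d chart_inv[OF charted_N d z(1)] by (simp add: charts_at_def)
    qed
    then show "smooth_on (crd d ` (?U \<inter> dom_of d)) (\<lambda>\<xi>. killing_field (crd_inv d \<xi>) d)"
      unfolding image[OF d] using smooth_on_cong[OF nonzero_domain_open[OF d], of "\<lambda>\<xi>. killing_field (crd_inv d \<xi>) d" "field_coords d"] field_coords_smooth_nonzero[OF d] by simp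
  qed (use killing_field_tangent in auto)
  have unit_smooth: "smooth_vector_field M ?U unit_field"
    unfolding smooth_vector_field_def
  proof (intro conjI ballI)
    show "unit_field z \<in> tangent_space M z" if "z \<in> ?U" for z
      unfolding unit_field_def using that by (intro tangent_space_tscale N_smooth_manifold killing_field_tangent) auto
    fix d assume d: "d \<in> atlas M"
    have "unit_field (crd_inv d \<xi>) d = inverse (speed d \<xi>) *\<^sub>R field_coords d \<xi>" if \<xi>: "\<xi> \<in> nonzero_domain d" for \<xi>
    proof -
      obtain z where z: "z \<in> dom_of d" "\<xi> = crd d z" using \<xi> by (auto simp: nonzero_domain_def)
      then have "d \<in> charts_at M z" using d by (simp add: charts_at_def)
      then show ?thesis
        using speed_eq[of d z] killing_field_in_chart[of d z] chart_inv[OF charted_N d z(1)] z(2)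
        by (simp add: unit_field_def tscale_def inverse_eq_divide)
    qed
    moreover have "smooth_on (nonzero_domain d) (\<lambda>\<xi>. inverse (speed d \<xi>) *\<^sub>R field_coords d \<xi>)"
      using speed_pos[OF d] by (intro smooth_on_scaleR nonzero_domain_open d smooth_on_inverse speed_smooth field_coords_smooth_nonzero) (auto simp: less_le)
    ultimately show "smooth_on (crd d ` (?U \<inter> dom_of d)) (\<lambda>\<xi>. unit_field (crd_inv d \<xi>) d)"
      unfolding image[OF d]
      using smooth_on_cong[OF nonzero_domain_open[OF d], of "\<lambda>\<xi>. unit_field (crd_inv d \<xi>) d" "\<lambda>\<xi>. inverse (speed d \<xi>) *\<^sub>R field_coords d \<xi>"] by simp
  qed
  have \<gamma>U: "?\<gamma> t \<in> ?U" for t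
  proof -
    obtain d where d: "d \<in> charts_at M (?\<gamma> t)" using chart_at_exists[OF charted_N act_\<alpha>_closed[OF x]] by blast
    have "killing_field x c \<noteq> 0" using nz tangent_vector_eq_0_iff[OF N_smooth_manifold killing_field_tangent[OF x] c] by simp
    then have "killing_field (?\<gamma> t) d \<noteq> 0"
      using killing_field_equivariant[OF c d] tmap_act_bij[OF \<alpha>_closed c d] linear_tmap[OF smooth_map_act[OF \<alpha>_closed] c d]
      by (metis bij_is_inj injD linear_0)
    then show ?thesis using act_\<alpha>_closed[OF x] by (auto simp: tzero_def)
  qed
  have nab: "nabla M F killing_field killing_field unit_field (?\<gamma> t) = tzero" for t
  proof (rule nabla_unit_field)
    have "killing_field x c \<noteq> 0" using nz tangent_vector_eq_0_iff[OF N_smooth_manifold killing_field_tangent[OF x] c] by simp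
    then show "euler_lagrange (local_finsler.E (local_metric M F d)) w (crd d (?\<gamma> t)) (field_coords d (crd d (?\<gamma> t))) (acceleration d (?\<gamma> t)) = 0"
      if "d \<in> charts_at M (?\<gamma> t)" for d w using euler_lagrange_along_orbit[OF c _ EL that] by blast
  qed (use \<gamma>U act_\<alpha>_closed[OF x] in auto)
  have "has_covariant_derivative M F UNIV ?\<gamma> (velocity M ?\<gamma>)
     (\<lambda>s. tscale (1 / F (?\<gamma> s) (velocity M ?\<gamma> s)) (velocity M ?\<gamma> s)) t tzero" for t
    unfolding has_covariant_derivative_def
    by (rule exI[of _ UNIV], rule exI[of _ ?U], rule exI[of _ killing_field], rule exI[of _ killing_field], rule exI[of _ unit_field])
      (use U killing_field_smooth unit_smooth \<gamma>U nab in \<open>auto simp: velocity_orbit[OF x] unit_field_def\<close>)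
  moreover have "regular_curve M UNIV ?\<gamma>"
    unfolding regular_curve_def using smooth_orbit[OF x] \<gamma>U by (auto simp: velocity_orbit[OF x])
  moreover have "F (?\<gamma> t) (velocity M ?\<gamma> t) = F x (killing_field x)" for t
    by (simp add: velocity_orbit[OF x] F_field_invariant[OF x])
  ultimately show ?thesis unfolding affine_geodesic_def geodesic_def by auto
qed

end

section \<open>Homogeneous geodesics\<close>

context finsler_action
begin

text \<open>Finds the direction as a zero of the tangent field \<open>\<omega>\<close> on the unit sphere of coordinate vectors
  at \<open>p\<close>.\<close>

theorem exists_geodesic_one_parameter_orbit:
  assumes odd: "odd CARD('n)" and p: "p \<in> points M"
    and trans: "\<And>x. x \<in> points M \<Longrightarrow> \<exists>g\<in>carrier G. act g p = x"
  shows "\<exists>X\<in>tangent_space L \<one>. X \<noteq> tzero \<and>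
    affine_geodesic M F UNIV (\<lambda>t. act (lie_exp G L (tscale t X)) p)"
proof -
  have "\<one> \<in> points L" using carrier_L one_closed by blast
  then obtain e where e: "e \<in> charts_at L \<one>" using chart_at_exists[OF charted_L] by blast
  obtain d where d: "d \<in> charts_at M p" using chart_at_exists[OF charted_N p] by blast
  note d' = charts_atD[OF d]
  interpret lf: local_finsler "crd d ` dom_of d" "local_metric M F d" by (rule local_finsler_chart[OF d'(1)])
  define x0 where "x0 = crd d p"
  have x0: "x0 \<in> crd d ` dom_of d" using d'(2) by (auto simp: x0_def)
  let ?T = "tmap e d (\<lambda>g. act g p) \<one>"
  have "linear ?T" by (rule linear_tmap[OF smooth_map_orbit[OF p] e]) (use d act_one[OF p] in simp)
  moreover have "surj ?T" by (rule orbit_map_submersion[OF trans p e d])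
  ultimately obtain \<sigma> where lin\<sigma>: "linear \<sigma>" and T\<sigma>: "?T \<circ> \<sigma> = id"
    using linear_surjective_right_inverse by blast
  have fundamental_field_\<sigma>: "fundamental_field e d (\<sigma> y) x0 = y" for y
    using fundamental_field_eq[OF e d, of "\<sigma> y"] fun_cong[OF T\<sigma>, of y] by (simp add: x0_def)
  \<comment> \<open>The acceleration at \<open>p\<close> of the orbit with velocity \<open>y\<close>. It is quadratic in \<open>y\<close>, because the field
    is linear in \<open>\<sigma>(y)\<close>.\<close>
  define a where "a = (\<lambda>y. frechet_derivative (fundamental_field e d (\<sigma> y)) (at x0) y)"
  have d_field: "(fundamental_field e d X has_derivative frechet_derivative (fundamental_field e d X) (at x0)) (at x0)" for X
    by (rule smooth_on_has_derivative[OF fundamental_field_smooth[OF e d'(1)] x0])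
  have a_expand: "a y = (\<Sum>b\<in>Basis. (y \<bullet> b) *\<^sub>R frechet_derivative (fundamental_field e d (\<sigma> b)) (at x0) y)" for y
  proof -
    have "((\<lambda>\<xi>. \<Sum>b\<in>Basis. (y \<bullet> b) *\<^sub>R fundamental_field e d (\<sigma> b) \<xi>) has_derivative
        (\<lambda>h. \<Sum>b\<in>Basis. (y \<bullet> b) *\<^sub>R frechet_derivative (fundamental_field e d (\<sigma> b)) (at x0) h)) (at x0)"
      by (intro has_derivative_sum has_derivative_scaleR_right d_field)
    moreover have "(\<Sum>b\<in>Basis. (y \<bullet> b) *\<^sub>R fundamental_field e d (\<sigma> b) \<xi>) = fundamental_field e d (\<sigma> y) \<xi>" if "\<xi> \<in> crd d ` dom_of d" for \<xi>
      using linear_expand_Basis[OF linear_compose[OF lin\<sigma> linear_fundamental_field[OF e d'(1) that]], of y] by (simp add: o_def)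
    ultimately have "(fundamental_field e d (\<sigma> y) has_derivative
        (\<lambda>h. \<Sum>b\<in>Basis. (y \<bullet> b) *\<^sub>R frechet_derivative (fundamental_field e d (\<sigma> b)) (at x0) h)) (at x0)"
      by (rule has_derivative_transform_within_open[OF _ lf.open_S x0])
    then show ?thesis by (simp add: a_def frechet_derivative_eqI)
  qed
  have a_cont: "continuous_on A a" for A
  proof -
    have "continuous_on A (frechet_derivative (fundamental_field e d X) (at x0))" for X
      by (rule linear_continuous_on[OF has_derivative_bounded_linear[OF d_field]])
    then have "continuous_on A (\<lambda>y. \<Sum>b\<in>Basis. (y \<bullet> b) *\<^sub>R frechet_derivative (fundamental_field e d (\<sigma> b)) (at x0) y)"
      by (intro continuous_intros)
    then show ?thesis by (simp add: a_expand[abs_def])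
  qed
  have flow: "\<exists>\<alpha>. killing_flow G L M act F \<alpha> e \<and> velocity L \<alpha> 0 = tvec_of L e \<one> (\<sigma> y) \<and>
      killing_flow.field_coords G L act \<alpha> e d = fundamental_field e d (\<sigma> y)" for y
  proof -
    obtain \<alpha> where \<alpha>: "one_parameter_subgroup G L \<alpha>" "velocity L \<alpha> 0 = tvec_of L e \<one> (\<sigma> y)"
      using one_ps_exists[OF tvec_of_in_tangent_space[OF L_smooth_manifold e]] by metis
    interpret kf: killing_flow G L M act F \<alpha> e by unfold_locales (rule \<alpha>(1), rule e)
    show ?thesis
      using \<alpha>(2) kf.killing_flow_axioms tvec_of_self[OF L_smooth_manifold e] by (auto simp: kf.field_coords_def)
  qed
  let ?EL = "\<lambda>y w. euler_lagrange lf.E w x0 y (a y)"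
  define \<omega> where "\<omega> = (\<lambda>y. \<Sum>b\<in>Basis. ?EL y b *\<^sub>R b)"
  have \<omega>: "\<omega> y \<bullet> w = ?EL y w" if "y \<noteq> 0" for y w
    using linear_expand_Basis[OF lf.linear_euler_lagrange[OF x0 that, of "a y"], of w]
    by (simp add: \<omega>_def inner_sum_left inner_commute[of w] mult.commute)
  have "\<exists>y\<in>sphere 0 1. \<omega> y = 0"
  proof (rule hairy_ball)
    show "odd DIM(real^'n)" using odd by simp
    show "continuous_on (sphere 0 1) \<omega>"
      unfolding \<omega>_def
      by (intro continuous_intros continuous_on_subset[OF lf.continuous_on_euler_lagrange[OF x0 a_cont]]) auto
    fix y :: "real^'n" assume "y \<in> sphere 0 1"
    then have y: "y \<noteq> 0" by auto
    obtain \<alpha> where \<alpha>: "killing_flow G L M act F \<alpha> e" "killing_flow.field_coords G L act \<alpha> e d = fundamental_field e d (\<sigma> y)"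
      using flow by blast
    interpret kf: killing_flow G L M act F \<alpha> e by (rule \<alpha>(1))
    have field_coords: "kf.field_coords d (crd d p) = y" using fundamental_field_\<sigma>[of y] by (simp add: \<alpha>(2) x0_def)
    have acc: "kf.acceleration d p = a y"
      unfolding kf.acceleration_def field_coords by (simp add: \<alpha>(2) a_def x0_def)
    have "kf.killing_field p d \<noteq> 0" using kf.killing_field_in_chart[OF d] field_coords y by simp
    from kf.energy_derivative_along_flow[OF d this]
    have "frechet_derivative lf.E (at (x0, y)) (y, a y) = 0" unfolding field_coords acc x0_def .
    then show "\<omega> y \<bullet> y = 0" using \<omega>[OF y] lf.euler_lagrange_along_velocity[OF x0 y] by simp
  qed
  then obtain y :: "real^'n" where y: "y \<noteq> 0" "\<omega> y = 0" by (metis dist_self mem_sphere zero_neq_one)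
  then have EL: "?EL y w = 0" for w using \<omega>[of y w] by simp
  obtain \<alpha> where \<alpha>: "killing_flow G L M act F \<alpha> e" "killing_flow.field_coords G L act \<alpha> e d = fundamental_field e d (\<sigma> y)"
      "velocity L \<alpha> 0 = tvec_of L e \<one> (\<sigma> y)"
    using flow by blast
  interpret kf: killing_flow G L M act F \<alpha> e by (rule \<alpha>(1))
  let ?X = "velocity L \<alpha> 0"
  have field_coords: "kf.field_coords d (crd d p) = y" using fundamental_field_\<sigma>[of y] by (simp add: \<alpha>(2) x0_def)
  have acc: "kf.acceleration d p = a y"
      unfolding kf.acceleration_def field_coords by (simp add: \<alpha>(2) a_def x0_def)
  have nz: "kf.killing_field p \<noteq> tzero"
    using tangent_vector_eq_0_iff[OF N_smooth_manifold kf.killing_field_tangent[OF p] d] kf.killing_field_in_chart[OF d] field_coords y by simp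
  have "affine_geodesic M F UNIV (\<lambda>t. act (\<alpha> t) p)"
    by (rule kf.orbit_affine_geodesic[OF p nz d]) (unfold field_coords acc, fold x0_def, rule EL)
  moreover have "?X \<in> tangent_space L \<one>"
    unfolding \<alpha>(3) by (rule tvec_of_in_tangent_space[OF L_smooth_manifold e])
  moreover have "?X \<noteq> tzero"
  proof
    assume "?X = tzero"
    then have "\<sigma> y = 0"
      using tvec_of_self[OF L_smooth_manifold e, of "\<sigma> y"] unfolding \<alpha>(3) by (simp add: tzero_def)
    then have "y = 0" using fundamental_field_\<sigma>[of y] fundamental_field_\<sigma>[of 0] linear_0[OF lin\<sigma>] by simp
    then show False using y by simp
  qed
  ultimately show ?thesis
    using lie_exp_one_ps[OF kf.one_ps] by (intro bexI[of _ ?X]) simp_all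
qed

end

lemma diffeo_id_line: "diffeo line line (\<lambda>t. t)"
proof -
  have "smooth_map line line (\<lambda>t. t)"
    unfolding smooth_map_line_iff
    by (auto simp: open_mfd_def comp_def id_def smooth_on_id)
  moreover have "inv_into UNIV (\<lambda>t::real. t) = (\<lambda>t. t)"
    by (auto simp: fun_eq_iff inv_into_f_f[of "\<lambda>t::real. t" UNIV])
  ultimately show ?thesis by (simp add: diffeo_def open_mfd_def bij_betw_def)
qed

theorem theorem7:
  fixes M :: "('m, real^'n::finite) mfd"
    and F :: "('m, real^'n) tb_fun"
    and G :: "'g monoid"
    and L :: "('g, 'e::euclidean_space) mfd"
    and act :: "'g \<Rightarrow> 'm \<Rightarrow> 'm"
    and p :: 'm
  assumes "finsler_space M F"
    and "odd CARD('n)"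
    and "lie_group G L"
    and "connected_space (mtop L)"
    and "smooth_transitive_action G L M act"
    and "\<forall>g\<in>carrier G. finsler_isometry M F (act g)"
    and "p \<in> points M"
  shows "\<exists>J \<gamma>. homogeneous_geodesic G L M F act p J \<gamma>"
proof -
  interpret ta: transitive_action G "points M" act
    using assms(5) by (simp add: smooth_transitive_action_def)
  have one: "act \<one>\<^bsub>G\<^esub> x = x" if "x \<in> points M" for x
    using fun_cong[OF ta.id_eq_one, of x] that by simp
  interpret finsler_action G L M act F
  proof (intro finsler_action.intro lie_action.intro lie_grp.intro lie_action_axioms.intro
      lie_grp_axioms.intro finsler_action_axioms.intro)
    show "group G" "lie_group G L" using assms(3) by (simp_all add: lie_group_def)
    show "smooth_manifold M" "finsler_metric M F" using assms(1) by (simp_all add: finsler_space_def)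
    show "act \<one>\<^bsub>G\<^esub> x = x" if "x \<in> points M" for x using one[OF that] .
    show "act (g \<otimes>\<^bsub>G\<^esub> h) x = act g (act h x)" if "g \<in> carrier G" "h \<in> carrier G" "x \<in> points M" for g h x
      using ta.composition_rule that by blast
    show "smooth_map (prod_mfd L M) M (\<lambda>(g, x). act g x)"
      using assms(5) by (simp add: smooth_transitive_action_def)
    show "F (act g x) (pushforward M M (act g) x v) = F x v"
      if "g \<in> carrier G" "x \<in> points M" "v \<in> tangent_space M x" for g x v
      using assms(6) that by (simp add: finsler_isometry_def)
  qed
  have "\<exists>g\<in>carrier G. act g p = x" if "x \<in> points M" for x
    using ta.unique_orbit[OF assms(7) that] .
  from exists_geodesic_one_parameter_orbit[OF assms(2,7) this]
  obtain X where X: "X \<in> lie_algebra G L" "X \<noteq> tzero"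
    and geo: "affine_geodesic M F UNIV (\<lambda>t. act (lie_exp G L (tscale t X)) p)"
    unfolding lie_algebra_def by blast
  let ?\<gamma> = "\<lambda>t. act (lie_exp G L (tscale t X)) p"
  obtain \<alpha> where \<alpha>: "one_parameter_subgroup G L \<alpha>" "velocity L \<alpha> 0 = X"
    using one_ps_exists X(1) unfolding lie_algebra_def by metis
  have "?\<gamma> 0 = p"
    using lie_exp_one_ps[OF \<alpha>(1), of 0] one_ps_0[OF \<alpha>(1)] act_one[OF assms(7)] \<alpha>(2) by simp
  then have "p \<in> ?\<gamma> ` UNIV" by (metis rangeI)
  \<comment> \<open>The speed of the orbit is constant, so the group parameter is affine and the diffeomorphism from
    \<open>t\<close> to \<open>s\<close> is the identity of the line.\<close>
  then have "homogeneous_geodesic G L M F act p UNIV ?\<gamma>"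
    unfolding homogeneous_geodesic_def using geo X diffeo_id_line
    by (intro conjI exI[of _ "\<lambda>t. t"] exI[of _ X]) auto
  then show ?thesis by blast
qed

end
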